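(* Let $1\leqslant n\leqslant 3$, let $\mathcal{M}$ be a type $\mathrm{I}_n$ von Neumann algebra, and let $A,B\in\mathcal{M}$. If $A\oplus A$ is similar to $B\oplus B$ in $\mathbb{M}_2(\mathcal{M})$, then $A$ is similar to $B$ in $\mathcal{M}$.
   Context: For elements $A,B$ of a unital algebra $\mathcal{N}$, $A$ is similar to $B$ in $\mathcal{N}$ if $XAX^{-1}=B$ for some invertible $X\in\mathcal{N}$; $A\oplus A$ denotes $\mathrm{diag}(A,A)\in\mathbb{M}_2(\mathcal{N})$. A type $\mathrm{I}_n$ von Neumann algebra is one isomorphic to $\mathbb{M}_n(\mathcal{A})$ with $\mathcal{A}$ an abelian von Neumann algebra (not assumed to act on a separable space). *)

theory Defs
  imports Complex_Main "Jordan_Normal_Form.Matrix"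
begin

text \<open>
  Complex Hilbert spaces, of arbitrary dimension (the zero space is allowed).  The inner product is
  conjugate-linear in its first argument; its positive definiteness is contained in
  \<open>cinner_self\<close>, and completeness is inherited from \<^class>\<open>banach\<close>.
\<close>

class scaleC =
  fixes scaleC :: "complex \<Rightarrow> 'a \<Rightarrow> 'a"  (infixr "*\<^sub>C" 75)

class complex_hilbert_space = banach + scaleC +
  fixes cinner :: "'a \<Rightarrow> 'a \<Rightarrow> complex"
  assumes scaleC_add_right: "c *\<^sub>C (x + y) = c *\<^sub>C x + c *\<^sub>C y"
    and scaleC_add_left: "(c + d) *\<^sub>C x = c *\<^sub>C x + d *\<^sub>C x"
    and scaleC_scaleC: "c *\<^sub>C d *\<^sub>C x = (c * d) *\<^sub>C x"
    and scaleC_of_real: "complex_of_real r *\<^sub>C x = r *\<^sub>R x"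
    and cinner_commute: "cinner x y = cnj (cinner y x)"
    and cinner_add_right: "cinner x (y + z) = cinner x y + cinner x z"
    and cinner_scaleC_right: "cinner x (c *\<^sub>C y) = c * cinner x y"
    and cinner_self: "cinner x x = complex_of_real ((norm x)\<^sup>2)"

instantiation complex :: complex_hilbert_space
begin

definition scaleC_complex :: "complex \<Rightarrow> complex \<Rightarrow> complex"
  where "scaleC_complex c x = c * x"

definition cinner_complex :: "complex \<Rightarrow> complex \<Rightarrow> complex"
  where "cinner_complex x y = cnj x * y"

instance
  by standard
    (simp_all add: scaleC_complex_def cinner_complex_def distrib_left distrib_right
      scaleR_conv_of_real mult.commute flip: complex_norm_square)

end

text \<open>The algebra \<open>B(H)\<close> of bounded complex-linear operators; the product is composition.\<close>

typedef (overloaded) 'a bop =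
  "{f :: 'a::complex_hilbert_space \<Rightarrow> 'a. bounded_linear f \<and> (\<forall>c x. f (c *\<^sub>C x) = c *\<^sub>C f x)}"
  morphisms bop_apply Bop
proof
  show "(\<lambda>x. 0) \<in> {f :: 'a \<Rightarrow> 'a. bounded_linear f \<and> (\<forall>c x. f (c *\<^sub>C x) = c *\<^sub>C f x)}"
    using scaleC_add_right [of _ "0::'a" 0] by (simp add: bounded_linear_zero)
qed

setup_lifting type_definition_bop

lemma scaleC_minus_right: "c *\<^sub>C (- x) = - (c *\<^sub>C x)" for x :: "'a::complex_hilbert_space"
proof -
  have "c *\<^sub>C (0::'a) = 0"
    using scaleC_add_right [of c "0::'a" 0] by simp
  then show ?thesis
    using scaleC_add_right [of c x "- x"] by (simp add: eq_neg_iff_add_eq_0 add.commute)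
qed

lemma bounded_linear_scaleC: "bounded_linear (\<lambda>x::'a::complex_hilbert_space. c *\<^sub>C x)"
proof (rule bounded_linear_intro [where K = "cmod c"])
  show "c *\<^sub>C (x + y) = c *\<^sub>C x + c *\<^sub>C y" for x y :: 'a
    by (rule scaleC_add_right)
  show "c *\<^sub>C (r *\<^sub>R x) = r *\<^sub>R (c *\<^sub>C x)" for r and x :: 'a
    by (simp add: scaleC_scaleC mult.commute flip: scaleC_of_real)
  show "norm (c *\<^sub>C x) \<le> norm x * cmod c" for x :: 'a
  proof -
    have "complex_of_real ((norm (c *\<^sub>C x))\<^sup>2) = c * cinner (c *\<^sub>C x) x"
      by (simp only: cinner_scaleC_right flip: cinner_self)
    also have "cinner (c *\<^sub>C x) x = cnj (c * cinner x x)"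
      using cinner_commute [of "c *\<^sub>C x" x] by (simp only: cinner_scaleC_right)
    also have "c * \<dots> = complex_of_real ((norm x * cmod c)\<^sup>2)"
      by (simp add: cinner_self power_mult_distrib flip: complex_norm_square)
    finally have "(norm (c *\<^sub>C x))\<^sup>2 = (norm x * cmod c)\<^sup>2"
      using of_real_eq_iff by blast
    then show ?thesis
      by (simp add: power2_eq_iff_nonneg)
  qed
qed

instantiation bop :: (complex_hilbert_space) "{ring, monoid_mult, scaleC}"
begin

lift_definition zero_bop :: "'a bop" is "\<lambda>x. 0"
  using scaleC_add_right [of _ "0::'a" 0] by (simp add: bounded_linear_zero)

lift_definition one_bop :: "'a bop" is "\<lambda>x. x"
  by (simp add: bounded_linear_ident)

lift_definition plus_bop :: "'a bop \<Rightarrow> 'a bop \<Rightarrow> 'a bop" is "\<lambda>S T x. S x + T x"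
  by (simp add: bounded_linear_add scaleC_add_right)

lift_definition uminus_bop :: "'a bop \<Rightarrow> 'a bop" is "\<lambda>T x. - T x"
  by (simp add: bounded_linear_minus scaleC_minus_right)

lift_definition minus_bop :: "'a bop \<Rightarrow> 'a bop \<Rightarrow> 'a bop" is "\<lambda>S T x. S x - T x"
  by (simp add: bounded_linear_sub)
    (simp add: scaleC_add_right scaleC_minus_right flip: add_uminus_conv_diff)

lift_definition times_bop :: "'a bop \<Rightarrow> 'a bop \<Rightarrow> 'a bop" is "\<lambda>S T x. S (T x)"
  by (auto intro: bounded_linear_compose)

lift_definition scaleC_bop :: "complex \<Rightarrow> 'a bop \<Rightarrow> 'a bop" is "\<lambda>c T x. c *\<^sub>C T x"
  by (auto intro: bounded_linear_compose [OF bounded_linear_scaleC]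
      simp: scaleC_scaleC mult.commute)

instance
proof
  fix R S T :: "'a bop"
  show "R * S * T = R * (S * T)" "1 * T = T" "T * 1 = T"
    by (transfer, simp)+
  show "R + S + T = R + (S + T)" "S + T = T + S" "0 + T = T" "- T + T = 0" "S - T = S + - T"
    by (transfer, simp add: fun_eq_iff)+
  show "(R + S) * T = R * T + S * T"
    by transfer simp
  show "R * (S + T) = R * S + R * T"
    by transfer (auto simp: fun_eq_iff dest!: bounded_linear.linear linear_add)
qed

end

text \<open>The Hilbert space adjoint; it exists and is unique by the Riesz representation theorem.\<close>

definition adj :: "'a::complex_hilbert_space bop \<Rightarrow> 'a bop"
  where "adj T = (THE S. \<forall>x y. cinner (bop_apply S x) y = cinner x (bop_apply T y))"

definition commutant :: "'a::complex_hilbert_space bop set \<Rightarrow> 'a bop set"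
  where "commutant M = {T. \<forall>S\<in>M. S * T = T * S}"

text \<open>
  A von Neumann algebra on \<open>H\<close> is a self-adjoint subset of \<open>B(H)\<close> that equals its double
  commutant; it is then automatically a unital subalgebra.
\<close>

definition von_neumann_algebra :: "'a::complex_hilbert_space bop set \<Rightarrow> bool"
  where "von_neumann_algebra M \<longleftrightarrow> (\<forall>T\<in>M. adj T \<in> M) \<and> commutant (commutant M) = M"

definition abelian_von_neumann_algebra :: "'a::complex_hilbert_space bop set \<Rightarrow> bool"
  where "abelian_von_neumann_algebra M \<longleftrightarrow>
    von_neumann_algebra M \<and> (\<forall>S\<in>M. \<forall>T\<in>M. S * T = T * S)"

definition matrix_algebra :: "nat \<Rightarrow> 'b set \<Rightarrow> 'b mat set"
  where "matrix_algebra n N = {X \<in> carrier_mat n n. \<forall>i<n. \<forall>j<n. X $$ (i, j) \<in> N}"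

definition star_isomorphism_mat ::
    "nat \<Rightarrow> 'h::complex_hilbert_space bop set \<Rightarrow> 'k::complex_hilbert_space bop set
      \<Rightarrow> ('h bop \<Rightarrow> 'k bop mat) \<Rightarrow> bool"
  where "star_isomorphism_mat n M \<A> \<phi> \<longleftrightarrow>
    bij_betw \<phi> M (matrix_algebra n \<A>) \<and>
    (\<forall>S\<in>M. \<forall>T\<in>M. \<phi> (S + T) = \<phi> S + \<phi> T) \<and>
    (\<forall>c. \<forall>T\<in>M. \<phi> (c *\<^sub>C T) = map_mat (scaleC c) (\<phi> T)) \<and>
    (\<forall>S\<in>M. \<forall>T\<in>M. \<phi> (S * T) = \<phi> S * \<phi> T) \<and>
    (\<forall>T\<in>M. \<phi> (adj T) = map_mat adj (transpose_mat (\<phi> T)))"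

text \<open>
  Type \<open>I\<^sub>n\<close>.  The abelian algebra may act on a Hilbert space other than that of \<open>M\<close>.  Since a
  type cannot be quantified inside a formula, that space is a type parameter; as a hypothesis with
  \<open>'k\<close> free, the predicate expresses that such an algebra exists on some Hilbert space.
\<close>

definition type_I_von_neumann_algebra ::
    "'k::complex_hilbert_space itself \<Rightarrow> nat \<Rightarrow> 'h::complex_hilbert_space bop set \<Rightarrow> bool"
  where "type_I_von_neumann_algebra _ n M \<longleftrightarrow>
    von_neumann_algebra M \<and>
    (\<exists>(\<A> :: 'k bop set) \<phi>. abelian_von_neumann_algebra \<A> \<and> star_isomorphism_mat n M \<A> \<phi>)"

text \<open>Similarity in an algebra with carrier \<open>N\<close> and unit \<open>u\<close>.\<close>

definition similar_in :: "'b::times set \<Rightarrow> 'b \<Rightarrow> 'b \<Rightarrow> 'b \<Rightarrow> bool"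
  where "similar_in N u A B \<longleftrightarrow>
    (\<exists>X\<in>N. \<exists>Y\<in>N. X * Y = u \<and> Y * X = u \<and> X * A * Y = B)"

definition diag2 :: "'b::zero \<Rightarrow> 'b \<Rightarrow> 'b mat"
  where "diag2 A B = mat_of_rows_list 2 [[A, 0], [0, B]]"

end

theory Submission
  imports Defs "HOL-Analysis.Analysis" "HOL-Computational_Algebra.Fundamental_Theorem_Algebra"
begin

text \<open>
  An abelian von Neumann algebra \<open>N\<close> is the algebra of continuous functions on a compact,
  totally disconnected space, and \<open>M\<close> is the algebra of continuous functions on that space with values
  in the matrices of size \<open>n\<close>.  The theorem asks for an everywhere invertible function \<open>T\<close> with
  \<open>T A = B T\<close>.  Total disconnectedness reduces this to a single point: a solution
  \<open>T\<close> that is invertible at a point is invertible on a clopen neighbourhood, and finitely many solutions on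
  disjoint clopen sets can be glued (\<open>intertwiner_patching\<close>).  A solution with nowhere vanishing
  determinant is inverted by Cramer's rule (\<open>invertible_if_fibres_invertible\<close>).

  At a point, let \<open>E\<close> be the space of values of the solutions of \<open>T A = B T\<close>, and \<open>F\<close> that for
  \<open>T B = A T\<close>.  In general \<open>E\<close> is smaller than the space of intertwiners of the two value matrices, so the Jordan form
  of these matrices is of no help.  What survives evaluation is \<open>E F E \<subseteq> E\<close>, \<open>F E F \<subseteq> F\<close> and the
  similarity of the doubled elements, which is an invertible matrix of size two over \<open>E\<close> with inverse over \<open>F\<close>.
  This suffices for \<open>E\<close> to contain an invertible map (\<open>E_contains_injective\<close>), by an argument of
  Krull--Schmidt type.  Consider pairs \<open>(V, W)\<close> of subspaces with \<open>E V \<subseteq> W\<close> and \<open>F W \<subseteq> V\<close>.  The matrix of size two embeds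
  \<open>V \<times> V\<close> into \<open>W \<times> W\<close>, and its inverse does the converse, so \<open>V\<close> and \<open>W\<close> have the same dimension.  On a simple
  subquotient of such pairs \<open>E\<close> induces all rank-one maps, as in Burnside's theorem, and therefore
  some bijection.  Along a composition series, one generic linear combination is
  injective on all subquotients at once.

  The points of the space are ultrafilters of projections of \<open>N\<close>.  The double commutant property
  provides projections onto kernels, which applied to \<open>\<bar>s\<bar> - s\<close> gives spectral projections of a
  self-adjoint \<open>s\<close> (\<open>spectral_projection\<close>).  These show that every element of \<open>N\<close> is close to a number
  on some member of a given ultrafilter, which defines its value there (\<open>eval_at\<close>).  Compactness takes the form
  of \<open>local_to_global\<close>, a direct consequence of Zorn's lemma.
\<close>

\<comment> \<open>From here on, the dollar sign denotes the components of Cartesian vectors only.\<close>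
no_notation Matrix.vec_index (infixl "$" 100)

section \<open>Closed subspaces and adjoints in a complex Hilbert space\<close>

lemma scaleC_one [simp]: "1 *\<^sub>C x = x" for x :: "'a::complex_hilbert_space"
  using scaleC_of_real [of 1 x] by simp

lemma scaleC_zero_left [simp]: "0 *\<^sub>C x = 0" for x :: "'a::complex_hilbert_space"
  using scaleC_of_real [of 0 x] by simp

lemma scaleC_zero_right [simp]: "c *\<^sub>C 0 = (0 :: 'a::complex_hilbert_space)"
  using scaleC_add_right [of c "0::'a" 0] by simp

lemma scaleC_minus1 [simp]: "(-1) *\<^sub>C x = - x" for x :: "'a::complex_hilbert_space"
  using scaleC_of_real [of "-1" x] by simp

lemma scaleC_diff_right: "c *\<^sub>C (x - y) = c *\<^sub>C x - c *\<^sub>C y" for x :: "'a::complex_hilbert_space"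
  using scaleC_add_right [of c x "- y"] by (simp add: scaleC_minus_right)

lemma scaleC_minus_left: "(- c) *\<^sub>C x = - (c *\<^sub>C x)" for x :: "'a::complex_hilbert_space"
  using scaleC_scaleC [of "-1" c x] by simp

lemma scaleC_diff_left: "(c - d) *\<^sub>C x = c *\<^sub>C x - d *\<^sub>C x" for x :: "'a::complex_hilbert_space"
  using scaleC_add_left [of c "- d" x] by (simp add: scaleC_minus_left)

lemma cinner_scaleC_left: "cinner (c *\<^sub>C x) y = cnj c * cinner x y"
  by (subst (1 2) cinner_commute) (simp add: cinner_scaleC_right)

lemma cinner_add_left: "cinner (x + y) z = cinner x z + cinner y z"
  by (subst (1 2 3) cinner_commute) (simp add: cinner_add_right)

lemma cinner_zero_right [simp]: "cinner x 0 = 0"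
  using cinner_scaleC_right [of x 0 x] by simp

lemma cinner_zero_left [simp]: "cinner 0 x = 0"
  by (subst cinner_commute) simp

lemma cinner_minus_right: "cinner x (- y) = - cinner x y"
  using cinner_scaleC_right [of x "-1" y] by simp

lemma cinner_minus_left: "cinner (- x) y = - cinner x y"
  using cinner_scaleC_left [of "-1" x y] by simp

lemma cinner_diff_right: "cinner x (y - z) = cinner x y - cinner x z"
  using cinner_add_right [of x y "- z"] by (simp add: cinner_minus_right)

lemma cinner_diff_left: "cinner (x - y) z = cinner x z - cinner y z"
  using cinner_add_left [of x "- y" z] by (simp add: cinner_minus_left)

lemma norm_scaleC: "norm (c *\<^sub>C x) = cmod c * norm x" for x :: "'a::complex_hilbert_space"
proof -
  have "complex_of_real ((norm (c *\<^sub>C x))\<^sup>2) = complex_of_real ((cmod c * norm x)\<^sup>2)"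
    unfolding cinner_self [symmetric] cinner_scaleC_left cinner_scaleC_right
    by (simp add: cinner_self power_mult_distrib flip: complex_norm_square)
  then have "(norm (c *\<^sub>C x))\<^sup>2 = (cmod c * norm x)\<^sup>2"
    using of_real_eq_iff by blast
  then show ?thesis
    by (simp add: power2_eq_iff_nonneg)
qed

lemma norm_square_cinner: "(norm x)\<^sup>2 = Re (cinner x x)"
  by (simp add: cinner_self)

lemma Re_cinner_commute: "Re (cinner x y) = Re (cinner y x)"
  by (subst cinner_commute) simp

lemma norm_add_square: "(norm (x + y))\<^sup>2 = (norm x)\<^sup>2 + 2 * Re (cinner x y) + (norm y)\<^sup>2"
  for x :: "'a::complex_hilbert_space"
  using Re_cinner_commute [of y x]
  by (simp add: norm_square_cinner cinner_add_left cinner_add_right)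

lemma norm_diff_square: "(norm (x - y))\<^sup>2 = (norm x)\<^sup>2 - 2 * Re (cinner x y) + (norm y)\<^sup>2"
  for x :: "'a::complex_hilbert_space"
  using norm_add_square [of x "- y"] by (simp add: cinner_minus_right)

lemma parallelogram_law:
  "(norm (x + y))\<^sup>2 + (norm (x - y))\<^sup>2 = 2 * (norm x)\<^sup>2 + 2 * (norm y)\<^sup>2"
  for x :: "'a::complex_hilbert_space"
  by (simp add: norm_add_square norm_diff_square)

text \<open>Subtracting from \<open>r\<close> its component along \<open>y\<close> is the optimal choice; it gives both the
  Cauchy--Schwarz inequality and the orthogonality of best approximations.\<close>

lemma norm_diff_component:
  fixes r y :: "'a::complex_hilbert_space"
  assumes "y \<noteq> 0"
  shows "(norm (r - (cinner y r / complex_of_real ((norm y)\<^sup>2)) *\<^sub>C y))\<^sup>2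
    = (norm r)\<^sup>2 - (cmod (cinner y r))\<^sup>2 / (norm y)\<^sup>2"
proof -
  let ?c = "cinner y r / complex_of_real ((norm y)\<^sup>2)"
  have "?c * cinner r y = complex_of_real ((cmod (cinner y r))\<^sup>2 / (norm y)\<^sup>2)"
    by (subst (2) cinner_commute) (simp flip: complex_norm_square)
  then have "Re (cinner r (?c *\<^sub>C y)) = (cmod (cinner y r))\<^sup>2 / (norm y)\<^sup>2"
    by (simp only: cinner_scaleC_right Re_complex_of_real)
  moreover have "norm (?c *\<^sub>C y) = cmod (cinner y r) / norm y"
    using assms by (simp add: norm_scaleC norm_divide norm_power) (simp add: power2_eq_square)
  ultimately show ?thesis
    by (simp add: norm_diff_square power_divide)
qed

lemma cinner_Cauchy_Schwarz: "cmod (cinner x y) \<le> norm x * norm y"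
  for x :: "'a::complex_hilbert_space"
proof (cases "x = 0")
  case False
  have "(cmod (cinner x y))\<^sup>2 / (norm x)\<^sup>2 \<le> (norm y)\<^sup>2"
    using norm_diff_component [OF False, of y] zero_le_power2 by (smt (verit))
  then have "(cmod (cinner x y))\<^sup>2 \<le> (norm x * norm y)\<^sup>2"
    using False by (simp add: divide_le_eq power_mult_distrib mult.commute)
  then show ?thesis
    by (rule power2_le_imp_le) simp
qed simp

lemma bounded_linear_cinner: "bounded_linear (\<lambda>y. cinner x y)"
proof (rule bounded_linear_intro [where K = "norm x"])
  show "norm (cinner x y) \<le> norm y * norm x" for y
    using cinner_Cauchy_Schwarz [of x y] by (simp only: mult.commute)
qed (simp_all add: cinner_add_right cinner_scaleC_right scaleR_conv_of_real flip: scaleC_of_real)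

lemma cinner_tendsto_right:
  fixes y :: "'a::complex_hilbert_space"
  assumes "f \<longlonglongrightarrow> y"
  shows "(\<lambda>n. cinner x (f n)) \<longlonglongrightarrow> cinner x y"
proof -
  from bounded_linear_cinner show ?thesis
    using assms bounded_linear.tendsto by blast
qed

lemma cinner_tendsto_left:
  fixes x :: "'a::complex_hilbert_space"
  assumes "f \<longlonglongrightarrow> x"
  shows "(\<lambda>n. cinner (f n) y) \<longlonglongrightarrow> cinner x y"
  using tendsto_cnj [OF cinner_tendsto_right [OF assms, of y]] by (simp flip: cinner_commute)

definition closed_csubspace :: "'a::complex_hilbert_space set \<Rightarrow> bool"
  where "closed_csubspace L \<longleftrightarrow>
    0 \<in> L \<and> (\<forall>x\<in>L. \<forall>y\<in>L. x + y \<in> L) \<and> (\<forall>c. \<forall>x\<in>L. c *\<^sub>C x \<in> L) \<and> closed L"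

lemma closed_csubspace_diff: "closed_csubspace L \<Longrightarrow> x \<in> L \<Longrightarrow> y \<in> L \<Longrightarrow> x - y \<in> L"
  unfolding closed_csubspace_def by (metis scaleC_minus1 diff_conv_add_uminus)

text \<open>A minimizing sequence is Cauchy by the parallelogram law, and its limit is the best
  approximation, hence the orthogonal projection.\<close>

lemma orthogonal_projection_exists:
  fixes L :: "'a::complex_hilbert_space set"
  assumes "closed_csubspace L"
  shows "\<exists>p\<in>L. \<forall>y\<in>L. cinner y (x - p) = 0"
proof -
  have L: "0 \<in> L" "\<And>x y. x \<in> L \<Longrightarrow> y \<in> L \<Longrightarrow> x + y \<in> L" "\<And>c x. x \<in> L \<Longrightarrow> c *\<^sub>C x \<in> L" "closed L"
    using assms by (auto simp: closed_csubspace_def)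
  define D where "D = (\<lambda>y. (norm (x - y))\<^sup>2) ` L"
  define d where "d = Inf D"
  have D: "D \<noteq> {}" "bdd_below D"
    using L(1) by (auto simp: D_def intro!: bdd_belowI [where m = 0])
  have d: "d \<le> (norm (x - y))\<^sup>2" if "y \<in> L" for y
    unfolding d_def using D that by (intro cInf_lower) (auto simp: D_def)
  have "\<exists>y\<in>L. (norm (x - y))\<^sup>2 < d + 1 / real (Suc n)" for n
  proof -
    have "Inf D < d + 1 / real (Suc n)"
      by (simp add: d_def)
    then show ?thesis
      using cInf_lessD [OF D(1)] by (auto simp: D_def)
  qed
  then obtain f where f: "\<And>n. f n \<in> L" "\<And>n. (norm (x - f n))\<^sup>2 < d + 1 / real (Suc n)"
    by metis
  have close: "(norm (f m - f n))\<^sup>2 \<le> 2 / real (Suc m) + 2 / real (Suc n)" for m n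
  proof -
    let ?h = "(1/2) *\<^sub>C (f m + f n)"
    have "(x - f m) + (x - f n) = 2 *\<^sub>C (x - ?h)"
      by (simp add: scaleC_diff_right scaleC_scaleC)
        (metis add_diff_eq diff_add_eq diff_diff_eq2 diff_diff_add one_add_one scaleC_add_left scaleC_one)
    then have "(norm ((x - f m) + (x - f n)))\<^sup>2 = 4 * (norm (x - ?h))\<^sup>2"
      by (simp add: norm_scaleC power_mult_distrib)
    moreover have "d \<le> (norm (x - ?h))\<^sup>2"
      by (intro d L f)
    moreover have "norm ((x - f m) - (x - f n)) = norm (f m - f n)"
      by (simp add: norm_minus_commute)
    ultimately have "(norm (f m - f n))\<^sup>2 \<le> 2 * (norm (x - f m))\<^sup>2 + 2 * (norm (x - f n))\<^sup>2 - 4 * d"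
      using parallelogram_law [of "x - f m" "x - f n"] by simp
    then show ?thesis
      using f(2) [of m] f(2) [of n] by simp
  qed
  have "Cauchy f"
  proof (rule CauchyI)
    fix e :: real
    assume "0 < e"
    then obtain N where N: "4 / e\<^sup>2 < real N"
      using reals_Archimedean2 by blast
    have "norm (f m - f n) < e" if "m \<ge> N" "n \<ge> N" for m n
    proof -
      have "4 < e\<^sup>2 * real (Suc N)"
        using N \<open>0 < e\<close> by (simp add: divide_less_eq algebra_simps add_strict_increasing)
      then have "4 / real (Suc N) < e\<^sup>2"
        by (simp add: divide_less_eq)
      moreover have "2 / real (Suc m) \<le> 2 / real (Suc N)" "2 / real (Suc n) \<le> 2 / real (Suc N)"
        using that by (auto intro!: divide_left_mono)
      ultimately have "(norm (f m - f n))\<^sup>2 < e\<^sup>2"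
        using close [of m n] by (simp add: add_divide_distrib [symmetric])
      then show ?thesis
        by (rule power_less_imp_less_base) (use \<open>0 < e\<close> in simp)
    qed
    then show "\<exists>N. \<forall>m\<ge>N. \<forall>n\<ge>N. norm (f m - f n) < e"
      by blast
  qed
  then obtain p where p: "f \<longlonglongrightarrow> p"
    using Cauchy_convergent convergent_def by blast
  have "p \<in> L"
    using closed_sequentially [OF L(4) _ p] f by blast
  have "(\<lambda>n. (norm (x - f n))\<^sup>2) \<longlonglongrightarrow> (norm (x - p))\<^sup>2"
    by (intro tendsto_intros p)
  moreover have "(\<lambda>n. d + 1 / real (Suc n)) \<longlonglongrightarrow> d + 0"
    by (intro tendsto_intros LIMSEQ_Suc [OF lim_const_over_n])
  ultimately have "(norm (x - p))\<^sup>2 \<le> d + 0"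
    using f(2) by (intro LIMSEQ_le) (auto intro!: exI [of _ 0] less_imp_le)
  then have pd: "(norm (x - p))\<^sup>2 \<le> d"
    by simp
  have "cinner y (x - p) = 0" if "y \<in> L" for y
  proof (cases "y = 0")
    case False
    let ?c = "cinner y (x - p) / complex_of_real ((norm y)\<^sup>2)"
    have "d \<le> (norm (x - (p + ?c *\<^sub>C y)))\<^sup>2"
      by (intro d L \<open>p \<in> L\<close> that)
    also have "\<dots> = (norm (x - p))\<^sup>2 - (cmod (cinner y (x - p)))\<^sup>2 / (norm y)\<^sup>2"
      using norm_diff_component [OF False, of "x - p"] by (simp add: diff_diff_eq)
    finally have "(cmod (cinner y (x - p)))\<^sup>2 / (norm y)\<^sup>2 \<le> 0"
      using pd by simp
    then show ?thesis
      using False by (simp add: divide_le_0_iff)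
  qed simp
  with \<open>p \<in> L\<close> show ?thesis
    by blast
qed

lemma bop_apply_simps [simp]:
  "bop_apply 0 x = 0" "bop_apply 1 x = x" "bop_apply (S + T) x = bop_apply S x + bop_apply T x"
  "bop_apply (S - T) x = bop_apply S x - bop_apply T x" "bop_apply (- T) x = - bop_apply T x"
  "bop_apply (S * T) x = bop_apply S (bop_apply T x)" "bop_apply (c *\<^sub>C T) x = c *\<^sub>C bop_apply T x"
  by (transfer, simp)+

lemma bop_bounded_linear: "bounded_linear (bop_apply T)"
  by transfer simp

lemma bop_linear:
  "bop_apply T (x + y) = bop_apply T x + bop_apply T y"
  "bop_apply T (x - y) = bop_apply T x - bop_apply T y"
  "bop_apply T (- x) = - bop_apply T x"
  "bop_apply T 0 = 0"
  "bop_apply T (c *\<^sub>C x) = c *\<^sub>C bop_apply T x"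
  using bop_bounded_linear [of T]
  by (simp_all add: linear_simps) (transfer, simp)

lemma bop_bound: obtains K where "K > 0" "\<And>x. norm (bop_apply T x) \<le> K * norm x"
  using bounded_linear.pos_bounded [OF bop_bounded_linear [of T]] by (auto simp: mult.commute)

lemma bop_eqI: "(\<And>x. bop_apply S x = bop_apply T x) \<Longrightarrow> S = T"
  by transfer auto

lemma bop_exists:
  fixes f :: "'a::complex_hilbert_space \<Rightarrow> 'a"
  assumes "\<And>x y. f (x + y) = f x + f y" "\<And>c x. f (c *\<^sub>C x) = c *\<^sub>C f x"
    and "\<And>x. norm (f x) \<le> K * norm x"
  obtains T where "bop_apply T = f"
proof -
  have "bounded_linear f"
    by (rule bounded_linear_intro [where K = K])
      (simp_all add: assms mult.commute flip: scaleC_of_real)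
  then have "bop_apply (Bop f) = f"
    using assms by (intro Bop_inverse) auto
  then show thesis
    by (rule that)
qed

lemma closed_csubspace_kernel: "closed_csubspace {x. bop_apply T x = 0}"
proof -
  have "closed {x. bop_apply T x = 0}"
    by (intro closed_Collect_eq continuous_on_const
        linear_continuous_on bop_bounded_linear)
  then show ?thesis
    by (simp add: closed_csubspace_def bop_linear)
qed

lemma projection_operator_exists:
  fixes L :: "'a::complex_hilbert_space set"
  assumes L: "closed_csubspace L"
  obtains P where "\<And>x. bop_apply P x \<in> L" "\<And>x y. y \<in> L \<Longrightarrow> cinner y (x - bop_apply P x) = 0"
    "\<And>x. x \<in> L \<Longrightarrow> bop_apply P x = x"
    "\<And>x. (\<And>y. y \<in> L \<Longrightarrow> cinner y x = 0) \<Longrightarrow> bop_apply P x = 0"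
proof -
  obtain p where p: "\<And>x. p x \<in> L" "\<And>x y. y \<in> L \<Longrightarrow> cinner y (x - p x) = 0"
    using orthogonal_projection_exists [OF L] by metis
  have uniq: "p x = q" if "q \<in> L" "\<And>y. y \<in> L \<Longrightarrow> cinner y (x - q) = 0" for x q
  proof -
    have "p x - q \<in> L"
      using closed_csubspace_diff [OF L] p(1) that(1) by blast
    then have "cinner (p x - q) (x - q) - cinner (p x - q) (x - p x) = 0"
      using p(2) that(2) by simp
    then have "cinner (p x - q) (p x - q) = 0"
      by (simp add: cinner_diff_right)
    then show ?thesis
      by (simp add: cinner_self)
  qed
  have L': "0 \<in> L" "\<And>x y. x \<in> L \<Longrightarrow> y \<in> L \<Longrightarrow> x + y \<in> L" "\<And>c x. x \<in> L \<Longrightarrow> c *\<^sub>C x \<in> L"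
    using L by (auto simp: closed_csubspace_def)
  have "norm (p x) \<le> 1 * norm x" for x
  proof -
    have "(norm x)\<^sup>2 = (norm (p x))\<^sup>2 + (norm (x - p x))\<^sup>2"
      using norm_add_square [of "p x" "x - p x"] p by simp
    then have "(norm (p x))\<^sup>2 \<le> (norm x)\<^sup>2"
      by simp
    then show ?thesis
      by (simp add: power2_le_iff_abs_le)
  qed
  moreover have "p (x + y) = p x + p y" for x y
  proof (rule uniq)
    fix u assume u: "u \<in> L"
    have "cinner u (x + y - (p x + p y)) = cinner u ((x - p x) + (y - p y))"
      by (simp add: algebra_simps)
    then show "cinner u (x + y - (p x + p y)) = 0"
      using p(2) [OF u, of x] p(2) [OF u, of y] by (simp only: cinner_add_right add_0)
  qed (simp add: p L')
  moreover have "p (c *\<^sub>C x) = c *\<^sub>C p x" for c x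
    by (rule uniq) (simp_all add: p L' cinner_scaleC_right flip: scaleC_diff_right)
  ultimately obtain P where P: "bop_apply P = p"
    using bop_exists [of p 1] by blast
  show thesis
    by (rule that [of P]) (auto simp: P p L' intro!: uniq)
qed

lemma cinner_extensionality: "(\<And>y. cinner x y = cinner x' y) \<Longrightarrow> x = x'"
  for x :: "'a::complex_hilbert_space"
proof -
  assume "\<And>y. cinner x y = cinner x' y"
  then have "cinner (x - x') (x - x') = 0"
    by (simp add: cinner_diff_left)
  then show "x = x'"
    by (simp add: cinner_self)
qed

text \<open>Riesz representation of the functional \<open>y \<mapsto> \<langle>x, T y\<rangle>\<close>: the representing vector is a multiple
  of any nonzero vector orthogonal to the kernel.\<close>

lemma riesz_for_operator:
  fixes T :: "'a::complex_hilbert_space bop"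
  shows "\<exists>z. \<forall>y. cinner z y = cinner x (bop_apply T y)"
proof -
  let ?f = "\<lambda>y. cinner x (bop_apply T y)"
  let ?K = "{y. ?f y = 0}"
  have "bounded_linear ?f"
  proof -
    from bounded_linear_cinner show ?thesis
      using bounded_linear_compose bop_bounded_linear by blast
  qed
  then have "closed ?K"
    by (intro closed_Collect_eq continuous_on_const linear_continuous_on)
  then have K: "closed_csubspace ?K"
    by (simp add: closed_csubspace_def bop_linear cinner_add_right cinner_scaleC_right)
  show ?thesis
  proof (cases "?K = UNIV")
    case True
    then show ?thesis
      by (intro exI [of _ 0]) auto
  next
    case False
    then obtain y0 where y0: "?f y0 \<noteq> 0"
      by auto
    obtain p where p: "p \<in> ?K" "\<And>y. y \<in> ?K \<Longrightarrow> cinner y (y0 - p) = 0"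
      using orthogonal_projection_exists [OF K, of y0] by auto
    define r where "r = y0 - p"
    have fr: "?f r \<noteq> 0"
      using y0 p(1) by (simp add: r_def bop_linear cinner_diff_right)
    then have "r \<noteq> 0"
      by (auto simp: bop_linear)
    have "cinner ((cnj (?f r) / complex_of_real ((norm r)\<^sup>2)) *\<^sub>C r) y = ?f y" for y
    proof -
      have "y - (?f y / ?f r) *\<^sub>C r \<in> ?K"
        using fr by (simp add: bop_linear cinner_diff_right cinner_scaleC_right)
      then have "cinner (y - (?f y / ?f r) *\<^sub>C r) r = 0"
        using p(2) by (simp add: r_def)
      then have "cinner r (y - (?f y / ?f r) *\<^sub>C r) = 0"
        by (subst cinner_commute) simp
      then have "cinner r y = (?f y / ?f r) * complex_of_real ((norm r)\<^sup>2)"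
        by (simp add: cinner_diff_right cinner_scaleC_right cinner_self)
      then show ?thesis
        using fr \<open>r \<noteq> 0\<close> by (simp add: cinner_scaleC_left)
    qed
    then show ?thesis
      by blast
  qed
qed

lemma cinner_adj_left: "cinner (bop_apply (adj T) x) y = cinner x (bop_apply T y)"
proof -
  obtain f where f: "\<And>x y. cinner (f x) y = cinner x (bop_apply T y)"
    using riesz_for_operator [of _ T] by metis
  obtain K where K: "K > 0" "\<And>x. norm (bop_apply T x) \<le> K * norm x"
    using bop_bound by blast
  have "norm (f x) \<le> K * norm x" for x
  proof -
    have "(norm (f x))\<^sup>2 = Re (cinner x (bop_apply T (f x)))"
      by (simp add: norm_square_cinner f)
    also have "\<dots> \<le> norm x * norm (bop_apply T (f x))"
      using cinner_Cauchy_Schwarz complex_Re_le_cmod order_trans by blast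
    also have "\<dots> \<le> norm x * (K * norm (f x))"
      by (intro mult_left_mono K) simp
    finally have "norm (f x) * norm (f x) \<le> (K * norm x) * norm (f x)"
      by (simp add: power2_eq_square ac_simps)
    then show ?thesis
      using K(1) by (cases "f x = 0") auto
  qed
  moreover have "f (x + y) = f x + f y" for x y
    by (rule cinner_extensionality) (simp add: f cinner_add_left)
  moreover have "f (c *\<^sub>C x) = c *\<^sub>C f x" for c x
    by (rule cinner_extensionality) (simp add: f cinner_scaleC_left)
  ultimately obtain S where S: "bop_apply S = f"
    using bop_exists [of f K] by blast
  have "\<forall>x y. cinner (bop_apply (adj T) x) y = cinner x (bop_apply T y)"
    unfolding adj_def
  proof (rule theI)
    show "\<forall>x y. cinner (bop_apply S x) y = cinner x (bop_apply T y)"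
      by (simp add: S f)
    show "S' = S" if "\<forall>x y. cinner (bop_apply S' x) y = cinner x (bop_apply T y)" for S'
      using that by (auto simp: S f intro!: bop_eqI cinner_extensionality [of "bop_apply S' x" for x])
  qed
  then show ?thesis
    by blast
qed

lemma cinner_adj_right: "cinner x (bop_apply (adj T) y) = cinner (bop_apply T x) y"
  using cinner_adj_left [of T y x] by (metis cinner_commute)

lemma adj_eqI: "(\<And>x y. cinner (bop_apply S x) y = cinner x (bop_apply T y)) \<Longrightarrow> adj T = S"
  by (rule bop_eqI, rule cinner_extensionality) (simp add: cinner_adj_left)

lemma adj_adj [simp]: "adj (adj T) = T"
  by (rule adj_eqI) (simp add: cinner_adj_right)

lemma adj_times: "adj (S * T) = adj T * adj S"
  by (rule adj_eqI) (simp add: cinner_adj_left)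

lemma adj_add: "adj (S + T) = adj S + adj T"
  by (rule adj_eqI) (simp add: cinner_adj_left cinner_add_left cinner_add_right)

lemma adj_diff: "adj (S - T) = adj S - adj T"
  by (rule adj_eqI) (simp add: cinner_adj_left cinner_diff_left cinner_diff_right)

lemma adj_scaleC: "adj (c *\<^sub>C T) = cnj c *\<^sub>C adj T"
  by (rule adj_eqI) (simp add: cinner_adj_left cinner_scaleC_left cinner_scaleC_right)

lemma adj_one [simp]: "adj 1 = 1" and adj_zero [simp]: "adj 0 = 0"
  by (rule adj_eqI, simp)+

section \<open>Projections in an abelian von Neumann algebra\<close>

definition projections :: "'a::complex_hilbert_space bop set \<Rightarrow> 'a bop set"
  where "projections N = {e \<in> N. e * e = e \<and> adj e = e}"

locale vn_algebra =
  fixes N :: "'a::complex_hilbert_space bop set"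
  assumes vn: "von_neumann_algebra N"
begin

lemma mem_iff: "T \<in> N \<longleftrightarrow> (\<forall>S\<in>commutant N. S * T = T * S)"
proof -
  have "commutant (commutant N) = N"
    using vn by (simp add: von_neumann_algebra_def)
  then show ?thesis
    unfolding commutant_def by blast
qed

lemma adj_mem: "T \<in> N \<Longrightarrow> adj T \<in> N"
  using vn by (simp add: von_neumann_algebra_def)

lemma commutantD: "T \<in> N \<Longrightarrow> S \<in> commutant N \<Longrightarrow> S * T = T * S"
  by (simp add: mem_iff)

lemma zero_mem [simp]: "0 \<in> N" and one_mem [simp]: "1 \<in> N"
  by (simp_all add: mem_iff)

lemma add_mem: "S \<in> N \<Longrightarrow> T \<in> N \<Longrightarrow> S + T \<in> N"
  by (simp add: mem_iff distrib_left distrib_right)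

lemma diff_mem: "S \<in> N \<Longrightarrow> T \<in> N \<Longrightarrow> S - T \<in> N"
  by (simp add: mem_iff right_diff_distrib left_diff_distrib)

lemma times_mem: "S \<in> N \<Longrightarrow> T \<in> N \<Longrightarrow> S * T \<in> N"
  unfolding mem_iff by (metis mult.assoc)

lemma scaleC_mem: "T \<in> N \<Longrightarrow> c *\<^sub>C T \<in> N"
  unfolding mem_iff
proof
  fix S assume "\<forall>S\<in>commutant N. S * T = T * S" "S \<in> commutant N"
  then have "S * T = T * S" by blast
  then show "S * (c *\<^sub>C T) = (c *\<^sub>C T) * S"
    by (intro bop_eqI) (simp add: bop_linear, metis bop_apply_simps(6))
qed

lemma adj_commutant: "T \<in> commutant N \<Longrightarrow> adj T \<in> commutant N"
  unfolding commutant_def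
proof safe
  fix S assume T: "\<forall>S\<in>N. S * T = T * S" and "S \<in> N"
  then have "adj (adj S * T) = adj (T * adj S)"
    using adj_mem by simp
  then show "S * adj T = adj T * S"
    by (simp add: adj_times)
qed

text \<open>A subspace invariant under the (self-adjoint) commutant reduces it, so its projection lies in
  the double commutant.  Kernels of elements of the algebra are of this kind; this is how
  the algebra acquires its supply of projections.\<close>

lemma projection_on_invariant_subspace:
  assumes L: "closed_csubspace L"
    and inv: "\<And>T x. T \<in> commutant N \<Longrightarrow> x \<in> L \<Longrightarrow> bop_apply T x \<in> L"
  obtains P where "P \<in> projections N" "\<And>x. bop_apply P x \<in> L"
    "\<And>x y. y \<in> L \<Longrightarrow> cinner y (x - bop_apply P x) = 0"
proof -
  obtain P where P: "\<And>x. bop_apply P x \<in> L" "\<And>x y. y \<in> L \<Longrightarrow> cinner y (x - bop_apply P x) = 0"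
    "\<And>x. x \<in> L \<Longrightarrow> bop_apply P x = x" "\<And>x. (\<And>y. y \<in> L \<Longrightarrow> cinner y x = 0) \<Longrightarrow> bop_apply P x = 0"
    using projection_operator_exists [OF L] by metis
  have idem: "P * P = P"
    by (rule bop_eqI) (simp add: P)
  have "adj P = P"
  proof (rule adj_eqI)
    fix x y
    have "cinner (bop_apply P x) (y - bop_apply P y) = 0"
      by (intro P)
    moreover have "cinner (x - bop_apply P x) (bop_apply P y) = 0"
      by (subst cinner_commute) (simp add: P)
    ultimately show "cinner (bop_apply P x) y = cinner x (bop_apply P y)"
      by (simp add: cinner_diff_left cinner_diff_right)
  qed
  moreover have "P \<in> N"
    unfolding mem_iff
  proof
    fix T assume T: "T \<in> commutant N"
    show "T * P = P * T"
    proof (rule bop_eqI)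
      fix x
      have "bop_apply P (bop_apply T (x - bop_apply P x)) = 0"
      proof (rule P(4))
        fix y assume "y \<in> L"
        then show "cinner y (bop_apply T (x - bop_apply P x)) = 0"
          using P(2) inv [OF adj_commutant [OF T]] by (simp flip: cinner_adj_left)
      qed
      moreover have "bop_apply P (bop_apply T (bop_apply P x)) = bop_apply T (bop_apply P x)"
        using P inv T by simp
      ultimately show "bop_apply (T * P) x = bop_apply (P * T) x"
        by (simp add: bop_linear)
    qed
  qed
  ultimately show thesis
    using idem P by (intro that [of P]) (auto simp: projections_def)
qed

end

locale abelian_vn = vn_algebra +
  assumes commute: "S \<in> N \<Longrightarrow> T \<in> N \<Longrightarrow> S * T = T * S"
begin

lemma commute_apply:
  "S \<in> N \<Longrightarrow> T \<in> N \<Longrightarrow> bop_apply S (bop_apply T x) = bop_apply T (bop_apply S x)"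
  by (metis commute bop_apply_simps(6))

end

text \<open>The square root of \<open>1 - z\<close> is \<open>1 - y\<close> where \<open>y\<close> is the limit of
  \<open>y\<^sub>0 = 0\<close>, \<open>y\<^sub>k\<^sub>+\<^sub>1 = (z + y\<^sub>k\<^sup>2)/2\<close>.  The same recursion for the number \<open>z = 1\<close> dominates all norms in it,
  which settles convergence, also when \<open>z\<close> has norm one.\<close>

primrec sqrt_iter :: "'a::complex_hilbert_space bop \<Rightarrow> nat \<Rightarrow> 'a bop" where
  "sqrt_iter z 0 = 0"
| "sqrt_iter z (Suc k) = (1/2) *\<^sub>C (z + sqrt_iter z k * sqrt_iter z k)"

primrec sqrt_majorant :: "nat \<Rightarrow> real" where
  "sqrt_majorant 0 = 0"
| "sqrt_majorant (Suc k) = (1 + (sqrt_majorant k)\<^sup>2) / 2"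

lemma sqrt_majorant_bounds: "0 \<le> sqrt_majorant k \<and> sqrt_majorant k \<le> 1"
  by (induction k) (simp_all add: power_le_one)

lemma sqrt_majorant_Suc_ge: "sqrt_majorant k \<le> sqrt_majorant (Suc k)"
  using zero_le_power2 [of "sqrt_majorant k - 1"] by (simp add: power2_diff)

lemma sqrt_majorant_Cauchy: "Cauchy sqrt_majorant"
proof (rule convergent_Cauchy)
  show "convergent sqrt_majorant"
    using sqrt_majorant_bounds sqrt_majorant_Suc_ge
    by (intro Bseq_mono_convergent BseqI' [where K = 1])
      (auto intro: lift_Suc_mono_le)
qed

context abelian_vn
begin

lemma sqrt_iter_mem: "z \<in> N \<Longrightarrow> sqrt_iter z k \<in> N"
  by (induction k) (auto intro: scaleC_mem add_mem times_mem)

lemma norm_sqrt_iter_le: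
  assumes "\<And>x. norm (bop_apply z x) \<le> norm x"
  shows "norm (bop_apply (sqrt_iter z k) x) \<le> sqrt_majorant k * norm x"
proof (induction k arbitrary: x)
  case (Suc k)
  let ?y = "bop_apply (sqrt_iter z k)" and ?t = "sqrt_majorant k"
  have "norm (?y (?y x)) \<le> ?t * (?t * norm x)"
    using Suc.IH [of "?y x"] Suc.IH [of x] sqrt_majorant_bounds [of k]
    by (meson mult_left_mono order_trans)
  then have "norm (bop_apply z x + ?y (?y x)) \<le> norm x + ?t * (?t * norm x)"
    using assms [of x] norm_triangle_mono by blast
  then show ?case
    by (simp add: norm_scaleC power2_eq_square algebra_simps)
qed simp

lemma norm_sqrt_iter_step:
  assumes "z \<in> N" "\<And>x. norm (bop_apply z x) \<le> norm x"
  shows "norm (bop_apply (sqrt_iter z (Suc k)) x - bop_apply (sqrt_iter z k) x)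
    \<le> (sqrt_majorant (Suc k) - sqrt_majorant k) * norm x"
proof (induction k arbitrary: x)
  case 0
  show ?case
    using assms(2) [of x] by (simp add: norm_scaleC)
next
  case (Suc k)
  let ?y = "bop_apply (sqrt_iter z (Suc k))" and ?t = "sqrt_majorant (Suc k)"
  let ?y' = "bop_apply (sqrt_iter z k)" and ?t' = "sqrt_majorant k"
  let ?d = "?y x - ?y' x"
  have "?y (?y' x) = ?y' (?y x)"
    using assms(1) by (intro commute_apply sqrt_iter_mem)
  then have "?y (?y x) - ?y' (?y' x) = ?y ?d + ?y' ?d"
    by (simp only: bop_linear) (simp add: algebra_simps)
  moreover have "norm (?y ?d + ?y' ?d) \<le> ?t * norm ?d + ?t' * norm ?d"
    using norm_sqrt_iter_le [of z, OF assms(2)] by (intro norm_triangle_mono)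
  moreover have "(?t + ?t') * norm ?d \<le> (?t + ?t') * ((?t - ?t') * norm x)"
    using sqrt_majorant_bounds [of k] sqrt_majorant_bounds [of "Suc k"] by (intro mult_left_mono Suc.IH) auto
  ultimately have "norm (?y (?y x) - ?y' (?y' x)) \<le> (?t\<^sup>2 - ?t'\<^sup>2) * norm x"
    by (simp only: power2_eq_square) (simp only: algebra_simps)
  moreover have "bop_apply (sqrt_iter z (Suc (Suc k))) x - ?y x = (1/2) *\<^sub>C (?y (?y x) - ?y' (?y' x))"
    by (simp only: sqrt_iter.simps(2) bop_apply_simps scaleC_diff_right [symmetric]) simp
  moreover have "sqrt_majorant (Suc (Suc k)) - ?t = (?t\<^sup>2 - ?t'\<^sup>2) / 2"
    by (simp only: sqrt_majorant.simps(2)) (simp add: field_simps)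
  ultimately show ?case
    by (simp only: norm_scaleC) (simp del: sqrt_majorant.simps sqrt_iter.simps)
qed

lemma norm_sqrt_iter_diff:
  assumes "z \<in> N" "\<And>x. norm (bop_apply z x) \<le> norm x" "k \<le> l"
  shows "norm (bop_apply (sqrt_iter z l) x - bop_apply (sqrt_iter z k) x)
    \<le> (sqrt_majorant l - sqrt_majorant k) * norm x"
  using assms(3)
proof (induction l rule: dec_induct)
  case (step l)
  have "norm ((bop_apply (sqrt_iter z (Suc l)) x - bop_apply (sqrt_iter z l) x)
      + (bop_apply (sqrt_iter z l) x - bop_apply (sqrt_iter z k) x))
    \<le> (sqrt_majorant (Suc l) - sqrt_majorant l) * norm x + (sqrt_majorant l - sqrt_majorant k) * norm x"
    by (intro norm_triangle_mono norm_sqrt_iter_step assms(1,2) step.IH)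
  then show ?case
    by (simp only: algebra_simps) (simp del: sqrt_majorant.simps sqrt_iter.simps add: algebra_simps)
qed simp

lemma sqrt_fixed_point:
  assumes z: "z \<in> N" "adj z = z" "\<And>x. norm (bop_apply z x) \<le> norm x"
  obtains y where "y \<in> N" "adj y = y" "\<And>x. norm (bop_apply y x) \<le> norm x" "y + y = z + y * y"
proof -
  let ?y = "\<lambda>k. bop_apply (sqrt_iter z k)"
  have le: "norm (?y k x) \<le> norm x" for k x
    using norm_sqrt_iter_le [OF z(3), of k x] sqrt_majorant_bounds [of k]
    by (meson mult_left_le_one_le norm_ge_zero order_trans)
  have "Cauchy (\<lambda>k. ?y k x)" for x
  proof (rule CauchyI)
    fix e :: real assume "e > 0"
    then have "0 < e / (norm x + 1)"
      by (intro divide_pos_pos add_nonneg_pos) auto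
    then obtain M where M: "\<And>m n. m \<ge> M \<Longrightarrow> n \<ge> M \<Longrightarrow>
        norm (sqrt_majorant m - sqrt_majorant n) < e / (norm x + 1)"
      using CauchyD [OF sqrt_majorant_Cauchy] by blast
    have *: "norm (?y l x - ?y k x) < e" if "k \<ge> M" "k \<le> l" for k l
    proof -
      have "norm (?y l x - ?y k x) \<le> (sqrt_majorant l - sqrt_majorant k) * norm x"
        by (rule norm_sqrt_iter_diff [OF z(1,3) that(2)])
      also have "\<dots> \<le> e / (norm x + 1) * norm x"
        using M [of l k] that by (intro mult_right_mono) auto
      also have "\<dots> < e"
        using \<open>e > 0\<close> by (simp add: divide_less_eq not_less add_nonneg_pos add_nonneg_nonneg algebra_simps)
      finally show ?thesis .
    qed
    have "norm (?y m x - ?y n x) < e" if "m \<ge> M" "n \<ge> M" for m n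
      using * [of m n] * [of n m] that by (cases "m \<le> n") (auto simp: norm_minus_commute)
    then show "\<exists>M. \<forall>m\<ge>M. \<forall>n\<ge>M. norm (?y m x - ?y n x) < e"
      by blast
  qed
  then have "\<exists>l. (\<lambda>k. ?y k x) \<longlonglongrightarrow> l" for x
    using Cauchy_convergent convergent_def by blast
  then obtain g where g: "\<And>x. (\<lambda>k. ?y k x) \<longlonglongrightarrow> g x"
    by metis
  have bl: "bounded_linear (\<lambda>x::'a. c *\<^sub>C x)" for c
    by (rule bounded_linear_scaleC)
  have "g (u + v) = g u + g v" for u v
    using tendsto_add [OF g [of u] g [of v]] g [of "u + v"]
    by (simp add: bop_linear) (rule LIMSEQ_unique)
  moreover have "g (c *\<^sub>C u) = c *\<^sub>C g u" for c u
    using bounded_linear.tendsto [OF bl g [of u]] g [of "c *\<^sub>C u"]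
    by (simp add: bop_linear) (rule LIMSEQ_unique)
  moreover have gle: "norm (g u) \<le> 1 * norm u" for u
    using LIMSEQ_le_const2 [OF tendsto_norm [OF g [of u]], of "norm u"] le by auto
  ultimately obtain y where y: "bop_apply y = g"
    using bop_exists [of g 1] by blast
  show thesis
  proof (rule that [of y])
    show "y \<in> N"
      unfolding mem_iff
    proof
      fix S assume S: "S \<in> commutant N"
      show "S * y = y * S"
      proof (rule bop_eqI)
        fix x
        have "bop_apply S (?y k x) = ?y k (bop_apply S x)" for k
          using commutantD [OF sqrt_iter_mem [OF z(1)] S, of k] by (metis bop_apply_simps(6))
        then have "(\<lambda>k. bop_apply S (?y k x)) \<longlonglongrightarrow> g (bop_apply S x)"
          using g by simp
        moreover have "(\<lambda>k. bop_apply S (?y k x)) \<longlonglongrightarrow> bop_apply S (g x)"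
          by (intro bounded_linear.tendsto [OF bop_bounded_linear] g)
        ultimately show "bop_apply (S * y) x = bop_apply (y * S) x"
          by (simp add: y) (rule LIMSEQ_unique)
      qed
    qed
    have "adj (sqrt_iter z k) = sqrt_iter z k" for k
      by (induction k) (simp_all add: adj_scaleC adj_add adj_times z)
    then have eq: "cinner (?y k u) v = cinner u (?y k v)" for k u v
      by (metis cinner_adj_left)
    have "cinner (g u) v = cinner u (g v)" for u v
      using cinner_tendsto_left [OF g [of u], of v] cinner_tendsto_right [OF g [of v], of u]
      unfolding eq by (rule LIMSEQ_unique)
    then show "adj y = y"
      by (intro adj_eqI) (simp add: y)
    show "norm (bop_apply y x) \<le> norm x" for x
      using gle by (simp add: y)
    show "y + y = z + y * y"
    proof (rule bop_eqI)
      fix x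
      have "(\<lambda>k. norm (?y k x - g x)) \<longlonglongrightarrow> 0"
        using g [of x] by (simp add: LIM_zero tendsto_norm_zero)
      then have "(\<lambda>k. ?y k (?y k x - g x)) \<longlonglongrightarrow> 0"
        by (rule Lim_null_comparison [OF always_eventually [OF allI [OF le]]])
      then have "(\<lambda>k. ?y k (?y k x - g x) + ?y k (g x)) \<longlonglongrightarrow> 0 + g (g x)"
        by (intro tendsto_add g)
      then have "(\<lambda>k. ?y k (?y k x)) \<longlonglongrightarrow> g (g x)"
        by (simp add: bop_linear)
      then have "(\<lambda>k. (1/2) *\<^sub>C (bop_apply z x + ?y k (?y k x))) \<longlonglongrightarrow> (1/2) *\<^sub>C (bop_apply z x + g (g x))"
        by (intro bounded_linear.tendsto [OF bl] tendsto_intros)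
      moreover have "(\<lambda>k. (1/2) *\<^sub>C (bop_apply z x + ?y k (?y k x))) \<longlonglongrightarrow> g x"
        using LIMSEQ_Suc [OF g [of x]] by simp
      ultimately have "g x = (1/2) *\<^sub>C (bop_apply z x + g (g x))"
        using LIMSEQ_unique by blast
      then have "2 *\<^sub>C g x = 2 *\<^sub>C (1/2) *\<^sub>C (bop_apply z x + g (g x))"
        by (rule arg_cong)
      then have "2 *\<^sub>C g x = bop_apply z x + g (g x)"
        by (simp only: scaleC_scaleC) simp
      then show "bop_apply (y + y) x = bop_apply (z + y * y) x"
        using scaleC_add_left [of 1 1 "g x"] by (simp add: y)
    qed
  qed
qed

text \<open>With \<open>r = \<bar>s\<bar>\<close> one has \<open>(r - s)(r + s) = 0\<close>, so \<open>s\<close> equals \<open>r \<ge> 0\<close> on the kernel of \<open>r - s\<close> and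
  equals \<open>- r \<le> 0\<close> on its orthogonal complement.\<close>

lemma spectral_projection:
  assumes s: "s \<in> N" "adj s = s"
  obtains e where "e \<in> projections N"
    "\<And>x. 0 \<le> Re (cinner (bop_apply e x) (bop_apply s (bop_apply e x)))"
    "\<And>x. Re (cinner (bop_apply (1 - e) x) (bop_apply s (bop_apply (1 - e) x))) \<le> 0"
proof -
  obtain K where K: "K > 0" "\<And>x. norm (bop_apply s x) \<le> K * norm x"
    using bop_bound by blast
  define s' where "s' = complex_of_real (1 / K) *\<^sub>C s"
  have s': "s' \<in> N" "adj s' = s'"
    using s by (simp_all add: s'_def scaleC_mem adj_scaleC)
  have s'_le: "norm (bop_apply s' x) \<le> norm x" for x
    using K by (simp add: s'_def norm_scaleC norm_divide divide_le_eq mult.commute)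
  have ss': "bop_apply s x = complex_of_real K *\<^sub>C bop_apply s' x" for x
    using K(1) by (simp add: s'_def scaleC_scaleC)
  define z where "z = 1 - s' * s'"
  have "norm (bop_apply z x) \<le> norm x" for x
  proof -
    have "cinner x (bop_apply s' (bop_apply s' x)) = cinner (bop_apply s' x) (bop_apply s' x)"
      using cinner_adj_left [of s' x "bop_apply s' x"] s'(2) by simp
    then have "(norm (bop_apply z x))\<^sup>2
        = (norm x)\<^sup>2 - 2 * (norm (bop_apply s' x))\<^sup>2 + (norm (bop_apply s' (bop_apply s' x)))\<^sup>2"
      by (simp add: z_def norm_diff_square cinner_self)
    also have "\<dots> \<le> (norm x)\<^sup>2"
      using power_mono [OF s'_le [of "bop_apply s' x"] norm_ge_zero, of 2]
        zero_le_power2 [of "norm (bop_apply s' x)"] by linarith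
    finally show ?thesis
      by (rule power2_le_imp_le) simp
  qed
  moreover have "z \<in> N" "adj z = z"
    using s' by (simp_all add: z_def diff_mem times_mem adj_diff adj_times)
  ultimately obtain y where y: "y \<in> N" "adj y = y" "\<And>x. norm (bop_apply y x) \<le> norm x"
    "y + y = z + y * y"
    using sqrt_fixed_point [of z] by metis
  define r where "r = 1 - y"
  have r: "r \<in> N" "adj r = r"
    using y by (simp_all add: r_def diff_mem adj_diff)
  have rr: "r * r = s' * s'"
    using y(4) by (simp add: r_def z_def algebra_simps)
  have r_nonneg: "0 \<le> Re (cinner x (bop_apply r x))" for x
  proof -
    have "Re (cinner x (bop_apply y x)) \<le> norm x * norm (bop_apply y x)"
      using cinner_Cauchy_Schwarz complex_Re_le_cmod order_trans by blast
    also have "\<dots> \<le> (norm x)\<^sup>2"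
      using y(3) [of x] by (simp add: power2_eq_square mult_left_mono)
    finally show ?thesis
      by (simp add: r_def cinner_diff_right norm_square_cinner)
  qed
  define L where "L = {x. bop_apply (r - s') x = 0}"
  have "closed_csubspace L"
    unfolding L_def by (rule closed_csubspace_kernel)
  moreover have "bop_apply T x \<in> L" if "T \<in> commutant N" "x \<in> L" for T x
  proof -
    have "(r - s') * T = T * (r - s')"
      using commutantD [OF diff_mem [OF r(1) s'(1)] that(1)] by simp
    then have "bop_apply (r - s') (bop_apply T x) = bop_apply T (bop_apply (r - s') x)"
      by (metis bop_apply_simps(6))
    then show ?thesis
      using that(2) by (simp add: L_def bop_linear del: bop_apply_simps)
  qed
  ultimately obtain e where e: "e \<in> projections N" "\<And>x. bop_apply e x \<in> L"
    "\<And>x y. y \<in> L \<Longrightarrow> cinner y (x - bop_apply e x) = 0"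
    using projection_on_invariant_subspace [of L] by metis
  have "(r - s') * (r + s') = 0"
    using rr commute [OF r(1) s'(1)] by (simp add: algebra_simps)
  then have rs_mem: "bop_apply (r + s') x \<in> L" for x
    unfolding L_def by (metis (mono_tags) bop_apply_simps(1,6) mem_Collect_eq)
  show thesis
  proof (rule that [OF e(1)])
    fix x
    have "bop_apply s' (bop_apply e x) = bop_apply r (bop_apply e x)"
      using e(2) [of x] by (simp add: L_def)
    then show "0 \<le> Re (cinner (bop_apply e x) (bop_apply s (bop_apply e x)))"
      using r_nonneg [of "bop_apply e x"] K(1) by (simp add: ss' cinner_scaleC_right)
    define v where "v = bop_apply (1 - e) x"
    define w where "w = bop_apply (r + s') v"
    have "cinner w w = cinner (bop_apply (adj (r + s')) v) w"
      using r s' by (simp add: w_def adj_add)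
    also have "\<dots> = cinner v (bop_apply (r + s') w)"
      by (rule cinner_adj_left)
    also have "\<dots> = cnj (cinner (bop_apply (r + s') w) (x - bop_apply e x))"
      by (subst cinner_commute) (simp add: v_def)
    also have "\<dots> = 0"
      using e(3) [OF rs_mem] by simp
    finally have "w = 0"
      by (simp add: cinner_self)
    then have "bop_apply s' v = - bop_apply r v"
      by (simp add: w_def eq_neg_iff_add_eq_0 add.commute)
    then have "Re (cinner v (bop_apply s v)) \<le> 0"
      using r_nonneg [of v] K(1) by (simp add: ss' cinner_scaleC_right cinner_minus_right)
    then show "Re (cinner (bop_apply (1 - e) x) (bop_apply s (bop_apply (1 - e) x))) \<le> 0"
      by (simp only: v_def)
  qed
qed

end

section \<open>Characters of an abelian von Neumann algebra\<close>

text \<open>The positive operators \<open>\<epsilon> - g\<close> and \<open>\<epsilon> + g\<close> commute, and their product is positive because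
  \<open>2 \<epsilon> (\<epsilon>\<^sup>2 - g\<^sup>2) = (\<epsilon> + g) (\<epsilon> - g) (\<epsilon> + g) + (\<epsilon> - g) (\<epsilon> + g) (\<epsilon> - g)\<close>.  The set \<open>L\<close> will
  be the range of a projection that commutes with \<open>g\<close>.\<close>

lemma norm_le_of_quadratic_bounds:
  fixes g :: "'a::complex_hilbert_space bop"
  assumes g: "adj g = g" and "\<epsilon> > 0"
    and inv: "\<And>x. x \<in> L \<Longrightarrow> \<epsilon> *\<^sub>R x + bop_apply g x \<in> L" "\<And>x. x \<in> L \<Longrightarrow> \<epsilon> *\<^sub>R x - bop_apply g x \<in> L"
    and bnd: "\<And>x. x \<in> L \<Longrightarrow> \<bar>Re (cinner x (bop_apply g x))\<bar> \<le> \<epsilon> * (norm x)\<^sup>2"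
    and "v \<in> L"
  shows "norm (bop_apply g v) \<le> \<epsilon> * norm v"
proof -
  define a where "a = \<epsilon> *\<^sub>R v"
  define b where "b = bop_apply g v"
  have g_a: "bop_apply g a = \<epsilon> *\<^sub>R b"
    using bop_linear(5) [of g "complex_of_real \<epsilon>" v] by (simp add: a_def b_def scaleC_of_real)
  have Rs: "Re (cinner x (r *\<^sub>R y)) = r * Re (cinner x y)" "Re (cinner (r *\<^sub>R x) y) = r * Re (cinner x y)"
    for r and x y :: 'a
    by (simp_all add: cinner_scaleC_right cinner_scaleC_left flip: scaleC_of_real)
  have gsa: "cinner (bop_apply g x) y = cinner x (bop_apply g y)" for x y
    using cinner_adj_left [of g x y] g by simp
  have 1: "Re (cinner (a + b) (bop_apply g (a + b))) \<le> \<epsilon> * (norm (a + b))\<^sup>2"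
    and 2: "- (\<epsilon> * (norm (a - b))\<^sup>2) \<le> Re (cinner (a - b) (bop_apply g (a - b)))"
    using bnd [OF inv(1) [OF \<open>v \<in> L\<close>]] bnd [OF inv(2) [OF \<open>v \<in> L\<close>]] by (auto simp: a_def b_def)
  have 3: "Re (cinner (a + b) (bop_apply g (a + b))) - Re (cinner (a - b) (bop_apply g (a - b)))
      = 2 * (Re (cinner a (bop_apply g b)) + Re (cinner b (bop_apply g a)))"
    by (simp add: bop_linear cinner_add_left cinner_add_right cinner_diff_left cinner_diff_right)
  have 4: "Re (cinner a (bop_apply g b)) = \<epsilon> * (norm b)\<^sup>2" "Re (cinner b (bop_apply g a)) = \<epsilon> * (norm b)\<^sup>2"
    by (simp_all add: g_a Rs norm_square_cinner) (simp add: a_def b_def Rs gsa)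
  have 5: "(norm (a + b))\<^sup>2 + (norm (a - b))\<^sup>2 = 2 * (\<epsilon> * norm v)\<^sup>2 + 2 * (norm b)\<^sup>2"
    using parallelogram_law [of a b] \<open>\<epsilon> > 0\<close> by (simp add: a_def)
  have "4 * (\<epsilon> * (norm b)\<^sup>2) \<le> \<epsilon> * ((norm (a + b))\<^sup>2 + (norm (a - b))\<^sup>2)"
    using 1 2 3 4 by (simp add: distrib_left)
  then have "\<epsilon> * (2 * (norm b)\<^sup>2) \<le> \<epsilon> * (2 * (\<epsilon> * norm v)\<^sup>2)"
    unfolding 5 by (simp add: distrib_left)
  then have "(norm b)\<^sup>2 \<le> (\<epsilon> * norm v)\<^sup>2"
    using \<open>\<epsilon> > 0\<close> by simp
  then show ?thesis
    unfolding b_def by (rule power2_le_imp_le) (use \<open>\<epsilon> > 0\<close> in simp)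
qed

context abelian_vn
begin

lemma projectionD:
  assumes "e \<in> projections N"
  shows "e \<in> N" "e * e = e" "adj e = e" "bop_apply e (bop_apply e x) = bop_apply e x"
  using assms by (auto simp: projections_def simp flip: bop_apply_simps(6))

lemma norm_projection_le:
  assumes "e \<in> projections N"
  shows "norm (bop_apply e x) \<le> norm x"
proof -
  have "(norm (bop_apply e x))\<^sup>2 = Re (cinner x (bop_apply e x))"
    using cinner_adj_left [of e x "bop_apply e x"] projectionD [OF assms] by (simp add: norm_square_cinner)
  also have "\<dots> \<le> norm x * norm (bop_apply e x)"
    using cinner_Cauchy_Schwarz complex_Re_le_cmod order_trans by blast
  finally show ?thesis
    by (cases "bop_apply e x = 0") (auto simp: power2_eq_square)
qed

lemma zero_projection: "0 \<in> projections N" and one_projection: "1 \<in> projections N"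
  by (simp_all add: projections_def)

lemma complement_projection: "e \<in> projections N \<Longrightarrow> 1 - e \<in> projections N"
  by (simp add: projections_def diff_mem adj_diff algebra_simps)

lemma times_projection:
  assumes "e \<in> projections N" "f \<in> projections N"
  shows "e * f \<in> projections N"
proof -
  have "e * f * (e * f) = e * (e * f) * f"
    using commute [of e f] projectionD(1) assms by (metis mult.assoc)
  then show ?thesis
    using assms commute [of e f] by (simp add: projections_def times_mem adj_times mult.assoc)
      (metis mult.assoc)
qed

definition ultrafilter :: "'a bop set \<Rightarrow> bool"
  where "ultrafilter U \<longleftrightarrow> U \<subseteq> projections N \<and> 0 \<notin> U \<and> 1 \<in> U \<and>
    (\<forall>e\<in>U. \<forall>f\<in>U. e * f \<in> U) \<and> (\<forall>e\<in>projections N. e \<in> U \<or> 1 - e \<in> U)"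

text \<open>An ideal of projections that omits \<open>1\<close> is disjoint from some ultrafilter: a
  multiplicative set maximal with this property is ultra, for if it contains neither \<open>e\<close> nor \<open>1 - e\<close>, then adjoining
  either one produces elements \<open>u e\<close> and \<open>v (1 - e)\<close> of the ideal, whence \<open>u v\<close> is in the ideal.\<close>

lemma ultrafilter_avoiding_ideal:
  assumes I0: "0 \<in> I" and I1: "1 \<notin> I"
    and Itimes: "\<And>e f. e \<in> I \<Longrightarrow> f \<in> projections N \<Longrightarrow> e * f \<in> I"
    and Iadd: "\<And>e f. e \<in> I \<Longrightarrow> f \<in> I \<Longrightarrow> e * f = 0 \<Longrightarrow> e + f \<in> I"
  obtains U where "ultrafilter U" "U \<inter> I = {}"
proof -
  define C where "C = {U. U \<subseteq> projections N \<and> 1 \<in> U \<and> (\<forall>e\<in>U. \<forall>f\<in>U. e * f \<in> U) \<and> U \<inter> I = {}}"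
  have "\<exists>U\<in>C. \<forall>X\<in>C. U \<subseteq> X \<longrightarrow> X = U"
  proof (rule subset_Zorn_nonempty)
    have "{1} \<in> C"
      using I1 by (simp add: C_def one_projection)
    then show "C \<noteq> {}" by blast
    fix K assume K: "K \<noteq> {}" "subset.chain C K"
    then have KC: "K \<subseteq> C" and tot: "\<And>X Y. X \<in> K \<Longrightarrow> Y \<in> K \<Longrightarrow> X \<subseteq> Y \<or> Y \<subseteq> X"
      by (auto simp: subset.chain_def)
    have "e * f \<in> \<Union> K" if "e \<in> X" "X \<in> K" "f \<in> Y" "Y \<in> K" for e f X Y
    proof -
      from tot [OF that(2,4)] that(1,3) consider "e \<in> Y" | "f \<in> X"
        by blast
      then show ?thesis
        using that KC unfolding C_def by cases blast+
    qed
    then have "\<forall>e\<in>\<Union> K. \<forall>f\<in>\<Union> K. e * f \<in> \<Union> K"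
      by (meson UnionE)
    moreover have "\<Union> K \<subseteq> projections N" "1 \<in> \<Union> K" "\<Union> K \<inter> I = {}"
      using K(1) KC by (auto simp: C_def)
    ultimately show "\<Union> K \<in> C"
      by (simp add: C_def)
  qed
  then obtain U where UC: "U \<in> C" and max: "\<And>X. X \<in> C \<Longrightarrow> U \<subseteq> X \<Longrightarrow> X = U"
    by blast
  then have U: "U \<subseteq> projections N" "1 \<in> U" "\<And>e f. e \<in> U \<Longrightarrow> f \<in> U \<Longrightarrow> e * f \<in> U" "U \<inter> I = {}"
    by (auto simp: C_def)
  have extend: "\<exists>u\<in>U. u * e \<in> I" if e: "e \<in> projections N" "e \<notin> U" for e
  proof (rule ccontr)
    assume none: "\<not> (\<exists>u\<in>U. u * e \<in> I)"
    define X where "X = U \<union> (\<lambda>u. u * e) ` U"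
    have UN: "u \<in> N" if "u \<in> U" for u
      using that U(1) projectionD by blast
    have comm: "e * u = u * e" if "u \<in> U" for u
      using commute projectionD(1) [OF e(1)] UN that by blast
    have "u * e * v = u * v * e" "u * e * (v * e) = u * v * e" if "u \<in> U" "v \<in> U" for u v
      using comm [OF that(2)] projectionD(2) [OF e(1)] by (metis mult.assoc)+
    then have "\<forall>x\<in>X. \<forall>y\<in>X. x * y \<in> X"
      using U(3) by (auto simp: X_def mult.assoc [symmetric])
    moreover have "X \<subseteq> projections N"
      using U(1) e(1) times_projection by (auto simp: X_def)
    moreover have "X \<inter> I = {}"
      using none U(4) by (auto simp: X_def)
    ultimately have "X \<in> C"
      using U(2) by (auto simp: C_def X_def)
    then have "X = U"
      by (rule max) (auto simp: X_def)
    moreover have "1 * e \<in> X"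
      using U(2) unfolding X_def by blast
    ultimately show False
      using e(2) by simp
  qed
  have "e \<in> U \<or> 1 - e \<in> U" if e: "e \<in> projections N" for e
  proof (rule ccontr)
    assume "\<not> ?thesis"
    then obtain u v where uv: "u \<in> U" "v \<in> U" "u * e \<in> I" "v * (1 - e) \<in> I"
      using extend e complement_projection [OF e] by metis
    have mem: "u \<in> N" "v \<in> N" "e \<in> N" "u \<in> projections N" "v \<in> projections N"
      using uv(1,2) U(1) e projectionD(1) by blast+
    have "u * e * v \<in> I" "v * (1 - e) * u \<in> I"
      using uv mem Itimes by blast+
    moreover have rearr: "u * e * v = u * v * e" "v * (1 - e) * u = u * v * (1 - e)"
    proof -
      have "e * v = v * e"
        using mem by (intro commute)
      then show "u * e * v = u * v * e"
        by (simp add: mult.assoc)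
      have "v * (1 - e) * u = u * (v * (1 - e))"
        using mem by (intro commute times_mem diff_mem one_mem)
      then show "v * (1 - e) * u = u * v * (1 - e)"
        by (simp only: mult.assoc)
    qed
    moreover have "u * v * e * (u * v * (1 - e)) = 0"
    proof -
      have *: "e * (u * v) = u * v * e"
        using mem by (intro commute times_mem)
      have "u * v * e * (u * v * (1 - e)) = u * v * (e * (u * v)) * (1 - e)"
        by (simp only: mult.assoc)
      also have "\<dots> = u * v * (u * v) * (e * (1 - e))"
        unfolding * by (simp only: mult.assoc)
      also have "e * (1 - e) = 0"
        using projectionD(2) [OF e] by (simp add: right_diff_distrib)
      finally show ?thesis
        by simp
    qed
    ultimately have "u * v * e + u * v * (1 - e) \<in> I"
      using Iadd by metis
    then have "u * v \<in> I"
      by (simp add: right_diff_distrib)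
    then show False
      using U(3) [OF uv(1,2)] U(4) by blast
  qed
  moreover have "0 \<notin> U"
    using I0 U(4) by blast
  ultimately show thesis
    using U by (intro that [of U]) (auto simp: ultrafilter_def)
qed

text \<open>Convergence along \<open>U\<close> in operator norm.  The limit is the value of \<open>a\<close> at the point \<open>U\<close> of the
  spectrum.\<close>

definition near :: "'a bop set \<Rightarrow> 'a bop \<Rightarrow> complex \<Rightarrow> bool"
  where "near U a c \<longleftrightarrow> (\<forall>\<epsilon>>0. \<exists>e\<in>U. \<forall>x. norm (bop_apply (a - c *\<^sub>C 1) (bop_apply e x)) \<le> \<epsilon> * norm x)"

lemma ultrafilterD:
  assumes "ultrafilter U"
  shows "U \<subseteq> projections N" "0 \<notin> U" "1 \<in> U" "\<And>e f. e \<in> U \<Longrightarrow> f \<in> U \<Longrightarrow> e * f \<in> U"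
    "\<And>e. e \<in> projections N \<Longrightarrow> e \<in> U \<or> 1 - e \<in> U" "\<And>e. e \<in> U \<Longrightarrow> e \<in> N"
  using assms projectionD(1) unfolding ultrafilter_def by blast+

lemma near_unique:
  assumes U: "ultrafilter U" and "near U a c" "near U a d"
  shows "c = d"
proof (rule ccontr)
  assume "c \<noteq> d"
  define \<epsilon> where "\<epsilon> = cmod (c - d) / 3"
  have "\<epsilon> > 0"
    using \<open>c \<noteq> d\<close> by (simp add: \<epsilon>_def)
  then obtain e f where ef: "e \<in> U" "f \<in> U"
    "\<And>x. norm (bop_apply (a - c *\<^sub>C 1) (bop_apply e x)) \<le> \<epsilon> * norm x"
    "\<And>x. norm (bop_apply (a - d *\<^sub>C 1) (bop_apply f x)) \<le> \<epsilon> * norm x"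
    using assms(2,3) unfolding near_def by meson
  have "e * f \<in> U" "e * f \<noteq> 0"
    using ultrafilterD [OF U] ef by metis+
  then obtain x where "bop_apply (e * f) x \<noteq> 0"
    using bop_eqI [of "e * f" 0] by auto
  define y where "y = bop_apply (e * f) x"
  have mem: "e \<in> projections N" "f \<in> projections N" "e \<in> N" "f \<in> N"
    using ultrafilterD(1,6) [OF U] ef by auto
  have "bop_apply e y = y"
    using projectionD(4) [OF mem(1)] by (simp add: y_def)
  moreover have "bop_apply f y = y"
    using projectionD(4) [OF mem(2)] commute_apply [OF mem(4,3)] by (simp add: y_def)
  ultimately have "norm (bop_apply (a - c *\<^sub>C 1) y) \<le> \<epsilon> * norm y" "norm (bop_apply (a - d *\<^sub>C 1) y) \<le> \<epsilon> * norm y"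
    using ef(3) [of y] ef(4) [of y] by simp_all
  then have "norm (bop_apply (a - d *\<^sub>C 1) y - bop_apply (a - c *\<^sub>C 1) y) \<le> \<epsilon> * norm y + \<epsilon> * norm y"
    by (meson add_mono norm_triangle_ineq4 order_trans)
  moreover have "bop_apply (a - d *\<^sub>C 1) y - bop_apply (a - c *\<^sub>C 1) y = (c - d) *\<^sub>C y"
    by (simp add: scaleC_diff_left)
  ultimately have "3 * \<epsilon> * norm y \<le> 2 * \<epsilon> * norm y"
    by (simp add: norm_scaleC \<epsilon>_def)
  then show False
    using \<open>\<epsilon> > 0\<close> \<open>bop_apply (e * f) x \<noteq> 0\<close> by (simp add: y_def)
qed

lemma near_add:
  assumes U: "ultrafilter U" and a: "near U a c" and b: "near U b d"
  shows "near U (a + b) (c + d)"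
  unfolding near_def
proof (intro allI impI)
  fix \<epsilon> :: real assume "\<epsilon> > 0"
  then have "\<epsilon> / 2 > 0" by simp
  then obtain e f where ef: "e \<in> U" "f \<in> U"
    "\<And>x. norm (bop_apply (a - c *\<^sub>C 1) (bop_apply e x)) \<le> \<epsilon> / 2 * norm x"
    "\<And>x. norm (bop_apply (b - d *\<^sub>C 1) (bop_apply f x)) \<le> \<epsilon> / 2 * norm x"
    using a b unfolding near_def by meson
  have mem: "e \<in> projections N" "f \<in> projections N" "e \<in> N" "f \<in> N"
    using ultrafilterD(1,6) [OF U] ef by auto
  show "\<exists>e\<in>U. \<forall>x. norm (bop_apply (a + b - (c + d) *\<^sub>C 1) (bop_apply e x)) \<le> \<epsilon> * norm x"
  proof (intro bexI allI)
    fix x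
    have "bop_apply (a + b - (c + d) *\<^sub>C 1) (bop_apply (e * f) x)
      = bop_apply (a - c *\<^sub>C 1) (bop_apply e (bop_apply f x)) + bop_apply (b - d *\<^sub>C 1) (bop_apply f (bop_apply e x))"
      using commute_apply [OF mem(3,4), of x] by (simp add: scaleC_add_left)
    also have "norm \<dots> \<le> \<epsilon> / 2 * norm (bop_apply f x) + \<epsilon> / 2 * norm (bop_apply e x)"
      by (intro norm_triangle_mono ef)
    also have "\<dots> \<le> \<epsilon> / 2 * norm x + \<epsilon> / 2 * norm x"
      using \<open>\<epsilon> > 0\<close> norm_projection_le mem by (intro add_mono mult_left_mono) auto
    finally show "norm (bop_apply (a + b - (c + d) *\<^sub>C 1) (bop_apply (e * f) x)) \<le> \<epsilon> * norm x"
      by simp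
  qed (intro ultrafilterD(4) [OF U] ef)
qed

lemma near_times:
  assumes U: "ultrafilter U" and N: "a \<in> N" "b \<in> N" and a: "near U a c" and b: "near U b d"
  shows "near U (a * b) (c * d)"
  unfolding near_def
proof (intro allI impI)
  fix \<epsilon> :: real assume "\<epsilon> > 0"
  obtain K where K: "K > 0" "\<And>x. norm (bop_apply a x) \<le> K * norm x"
    using bop_bound by blast
  define \<delta> where "\<delta> = \<epsilon> / (K + cmod d)"
  have Kd: "K + cmod d > 0"
    using K(1) by (simp add: add_pos_nonneg)
  then have "\<delta> > 0" 
    using \<open>\<epsilon> > 0\<close> by (simp add: \<delta>_def)
  then obtain e f where ef: "e \<in> U" "f \<in> U"
    "\<And>x. norm (bop_apply (a - c *\<^sub>C 1) (bop_apply e x)) \<le> \<delta> * norm x"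
    "\<And>x. norm (bop_apply (b - d *\<^sub>C 1) (bop_apply f x)) \<le> \<delta> * norm x"
    using a b unfolding near_def by meson
  have mem: "e \<in> projections N" "f \<in> projections N" "e \<in> N" "f \<in> N"
    using ultrafilterD(1,6) [OF U] ef by auto
  show "\<exists>e\<in>U. \<forall>x. norm (bop_apply (a * b - (c * d) *\<^sub>C 1) (bop_apply e x)) \<le> \<epsilon> * norm x"
  proof (intro bexI allI)
    fix x
    have "bop_apply (a * b - (c * d) *\<^sub>C 1) (bop_apply (e * f) x)
      = bop_apply a (bop_apply (b - d *\<^sub>C 1) (bop_apply f (bop_apply e x)))
        + d *\<^sub>C bop_apply (a - c *\<^sub>C 1) (bop_apply e (bop_apply f x))"
      using commute_apply [OF mem(3,4), of x]
      by (simp add: bop_linear scaleC_diff_right scaleC_scaleC mult.commute)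
    also have "norm \<dots> \<le> K * (\<delta> * norm (bop_apply e x)) + cmod d * (\<delta> * norm (bop_apply f x))"
    proof (intro norm_triangle_mono)
      show "norm (bop_apply a (bop_apply (b - d *\<^sub>C 1) (bop_apply f (bop_apply e x)))) \<le> K * (\<delta> * norm (bop_apply e x))"
        using K ef(4) by (meson mult_left_mono less_imp_le order_trans)
      show "norm (d *\<^sub>C bop_apply (a - c *\<^sub>C 1) (bop_apply e (bop_apply f x))) \<le> cmod d * (\<delta> * norm (bop_apply f x))"
        unfolding norm_scaleC by (intro mult_left_mono ef) simp
    qed
    also have "\<dots> \<le> K * (\<delta> * norm x) + cmod d * (\<delta> * norm x)"
      using \<open>\<delta> > 0\<close> K(1) norm_projection_le mem by (intro add_mono mult_left_mono) auto
    also have "\<dots> = \<delta> * (K + cmod d) * norm x"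
      by (simp add: algebra_simps)
    also have "\<delta> * (K + cmod d) = \<epsilon>"
      using Kd by (simp add: \<delta>_def)
    finally show "norm (bop_apply (a * b - (c * d) *\<^sub>C 1) (bop_apply (e * f) x)) \<le> \<epsilon> * norm x" .
  qed (intro ultrafilterD(4) [OF U] ef)
qed

lemma near_scalar: "ultrafilter U \<Longrightarrow> near U (c *\<^sub>C 1) c"
  unfolding near_def by (auto intro!: bexI [of _ 1] dest: ultrafilterD)

lemma near_member: "ultrafilter U \<Longrightarrow> e \<in> U \<Longrightarrow> near U e 1"
proof -
  assume "ultrafilter U" "e \<in> U"
  then have "bop_apply e (bop_apply e x) = bop_apply e x" for x
    using projectionD(4) ultrafilterD(1) by blast
  with \<open>e \<in> U\<close> show ?thesis
    unfolding near_def by (auto intro!: bexI [of _ e])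
qed

text \<open>For self-adjoint \<open>h\<close> the value is the supremum of the numbers \<open>t\<close> with \<open>h \<ge> t\<close> on a member of
  \<open>U\<close>; the spectral projections of \<open>h - t\<close> decide each \<open>t\<close>.\<close>

lemma near_exists_selfadjoint:
  assumes U: "ultrafilter U" and h: "h \<in> N" "adj h = h"
  shows "\<exists>t::real. near U h (complex_of_real t)"
proof -
  define q where "q = (\<lambda>x. Re (cinner x (bop_apply h x)))"
  define S where "S = {t. \<exists>e\<in>U. \<forall>x. t * (norm (bop_apply e x))\<^sup>2 \<le> q (bop_apply e x)}"
  obtain K where K: "K > 0" "\<And>x. norm (bop_apply h x) \<le> K * norm x"
    using bop_bound by blast
  have q_bound: "\<bar>q x\<bar> \<le> K * (norm x)\<^sup>2" for x
  proof -
    have "\<bar>q x\<bar> \<le> norm x * norm (bop_apply h x)"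
      unfolding q_def using cinner_Cauchy_Schwarz abs_Re_le_cmod order_trans by blast
    also have "\<dots> \<le> norm x * (K * norm x)"
      by (intro mult_left_mono K) simp
    finally show ?thesis
      by (simp add: power2_eq_square ac_simps)
  qed
  have "- K \<in> S"
    unfolding S_def using q_bound ultrafilterD(3) [OF U]
    by (auto intro!: bexI [of _ 1] simp: abs_le_iff) (metis minus_le_iff)
  then have "S \<noteq> {}"
    by blast
  have S_le: "t \<le> K" if "t \<in> S" for t
  proof -
    obtain e where e: "e \<in> U" "\<And>x. t * (norm (bop_apply e x))\<^sup>2 \<le> q (bop_apply e x)"
      using \<open>t \<in> S\<close> by (auto simp: S_def)
    have "e \<noteq> 0"
      using e(1) ultrafilterD(2) [OF U] by blast
    then obtain x where x: "bop_apply e x \<noteq> 0"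
      using bop_eqI [of e 0] by auto
    have "t * (norm (bop_apply e x))\<^sup>2 \<le> K * (norm (bop_apply e x))\<^sup>2"
      using e(2) [of x] q_bound [of "bop_apply e x"] by linarith
    then show ?thesis
      using x by simp
  qed
  then have bdd: "bdd_above S"
    by (rule bdd_aboveI)
  define t where "t = Sup S"
  have "\<exists>e\<in>U. \<forall>x. norm (bop_apply (h - complex_of_real t *\<^sub>C 1) (bop_apply e x)) \<le> \<epsilon> * norm x" if "\<epsilon> > 0" for \<epsilon>
  proof -
    define g where "g = h - complex_of_real t *\<^sub>C 1"
    have gN: "g \<in> N" "adj g = g"
      using h by (simp_all add: g_def diff_mem scaleC_mem adj_diff adj_scaleC)
    have qg: "Re (cinner x (bop_apply g x)) = q x - t * (norm x)\<^sup>2" for x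
      by (simp add: g_def q_def cinner_diff_right cinner_scaleC_right cinner_self)
    obtain t' where "t' \<in> S" "t - \<epsilon> < t'"
      using less_cSupE [of "t - \<epsilon>" S] \<open>S \<noteq> {}\<close> \<open>\<epsilon> > 0\<close> by (auto simp: t_def)
    then obtain e where e: "e \<in> U" "\<And>x. t' * (norm (bop_apply e x))\<^sup>2 \<le> q (bop_apply e x)"
      by (auto simp: S_def)
    define s where "s = h - complex_of_real (t + \<epsilon>) *\<^sub>C 1"
    have s: "s \<in> N" "adj s = s"
      using h by (simp_all add: s_def diff_mem scaleC_mem adj_diff adj_scaleC)
    have qs: "Re (cinner x (bop_apply s x)) = q x - (t + \<epsilon>) * (norm x)\<^sup>2" for x
      by (simp add: s_def q_def cinner_diff_right cinner_scaleC_right cinner_self algebra_simps)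
    obtain f where f: "f \<in> projections N"
      "\<And>x. 0 \<le> Re (cinner (bop_apply f x) (bop_apply s (bop_apply f x)))"
      "\<And>x. Re (cinner (bop_apply (1 - f) x) (bop_apply s (bop_apply (1 - f) x))) \<le> 0"
      using spectral_projection [OF s] by blast
    have "f \<notin> U"
    proof
      assume "f \<in> U"
      then have "t + \<epsilon> \<in> S"
        using f(2) by (auto simp: S_def qs)
      then have "t + \<epsilon> \<le> t"
        unfolding t_def using bdd by (rule cSup_upper)
      then show False
        using \<open>\<epsilon> > 0\<close> by simp
    qed
    then have f': "1 - f \<in> U"
      using ultrafilterD(5) [OF U f(1)] by blast
    define p where "p = e * (1 - f)"
    have "p \<in> U"
      unfolding p_def by (intro ultrafilterD(4) [OF U] e f')
    have mem: "e \<in> N" "1 - f \<in> N" "e \<in> projections N" "1 - f \<in> projections N"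
      using e(1) f' ultrafilterD(1,6) [OF U] by auto
    have pN: "p \<in> N" "p \<in> projections N"
      using \<open>p \<in> U\<close> ultrafilterD(1,6) [OF U] by auto
    define L where "L = {x. bop_apply p x = x}"
    have Lx: "bop_apply e x = x" "bop_apply (1 - f) x = x" if "x \<in> L" for x
      using that projectionD(4) [OF mem(3)] projectionD(4) [OF mem(4)] commute_apply [OF mem(1,2)]
      unfolding L_def p_def by (metis (mono_tags) bop_apply_simps(6) mem_Collect_eq)+
    have "norm (bop_apply g v) \<le> \<epsilon> * norm v" if "v \<in> L" for v
    proof (rule norm_le_of_quadratic_bounds [OF gN(2) \<open>\<epsilon> > 0\<close> _ _ _ that])
      fix x assume x: "x \<in> L"
      then have gx: "bop_apply p (bop_apply g x) = bop_apply g x" "bop_apply p x = x"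
        using commute_apply [OF pN(1) gN(1)] by (simp_all add: L_def)
      have "bop_apply p (\<epsilon> *\<^sub>R x) = \<epsilon> *\<^sub>R x"
        using gx(2) bop_linear(5) [of p "complex_of_real \<epsilon>" x] by (simp add: scaleC_of_real)
      then show "\<epsilon> *\<^sub>R x + bop_apply g x \<in> L" "\<epsilon> *\<^sub>R x - bop_apply g x \<in> L"
        using gx by (simp_all add: L_def bop_linear)
      have "t' * (norm x)\<^sup>2 \<le> q x" "q x \<le> (t + \<epsilon>) * (norm x)\<^sup>2"
        using e(2) [of x] f(3) [of x] Lx [OF x] qs [of x] by simp_all
      moreover have "(t - \<epsilon>) * (norm x)\<^sup>2 \<le> t' * (norm x)\<^sup>2"
        using \<open>t - \<epsilon> < t'\<close> by (intro mult_right_mono) auto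
      ultimately show "\<bar>Re (cinner x (bop_apply g x))\<bar> \<le> \<epsilon> * (norm x)\<^sup>2"
        by (simp add: qg abs_le_iff algebra_simps)
    qed
    moreover have "bop_apply p x \<in> L" for x
      using projectionD(4) [OF pN(2)] by (simp add: L_def)
    ultimately have "norm (bop_apply g (bop_apply p x)) \<le> \<epsilon> * norm x" for x
      using norm_projection_le [OF pN(2), of x] \<open>\<epsilon> > 0\<close> by (meson less_imp_le mult_left_mono order_trans)
    then show ?thesis
      using \<open>p \<in> U\<close> unfolding g_def by blast
  qed
  then show ?thesis
    unfolding near_def by blast
qed

text \<open>Both the real and the imaginary part have a value, and values are additive and multiplicative.\<close>

lemma near_exists:
  assumes U: "ultrafilter U" and a: "a \<in> N"
  shows "\<exists>c. near U a c"
proof -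
  define h where "h = (1/2) *\<^sub>C (a + adj a)"
  define k where "k = (- \<i>/2) *\<^sub>C (a - adj a)"
  have h: "h \<in> N" "adj h = h"
    using a by (simp_all add: h_def scaleC_mem add_mem adj_mem adj_scaleC adj_add add.commute)
  have k: "k \<in> N" "adj k = k"
  proof -
    show "k \<in> N"
      using a by (simp add: k_def scaleC_mem diff_mem adj_mem)
    show "adj k = k"
      by (rule bop_eqI)
        (simp add: k_def adj_scaleC adj_diff scaleC_diff_right scaleC_minus_left)
  qed
  obtain s t :: real where st: "near U h (complex_of_real s)" "near U k (complex_of_real t)"
    using near_exists_selfadjoint [OF U h] near_exists_selfadjoint [OF U k] by blast
  have "near U (h + (\<i> *\<^sub>C 1) * k) (complex_of_real s + \<i> * complex_of_real t)"
    by (intro near_add near_times near_scalar U st k scaleC_mem one_mem)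
  moreover have "h + (\<i> *\<^sub>C 1) * k = a"
  proof (rule bop_eqI)
    fix x
    have "(1/2) *\<^sub>C u + (1/2) *\<^sub>C u = u" for u :: 'a
      by (simp flip: scaleC_add_left)
    then show "bop_apply (h + (\<i> *\<^sub>C 1) * k) x = bop_apply a x"
      by (simp add: h_def k_def scaleC_scaleC scaleC_add_right scaleC_diff_right)
  qed
  ultimately show ?thesis
    by auto
qed

definition eval_at :: "'a bop set \<Rightarrow> 'a bop \<Rightarrow> complex"
  where "eval_at U a = (THE c. near U a c)"

lemma eval_at_eqI: "ultrafilter U \<Longrightarrow> near U a c \<Longrightarrow> eval_at U a = c"
  unfolding eval_at_def using near_unique by blast

lemma near_eval_at: "ultrafilter U \<Longrightarrow> a \<in> N \<Longrightarrow> near U a (eval_at U a)"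
  using near_exists eval_at_eqI by metis

lemma eval_at_add: "ultrafilter U \<Longrightarrow> a \<in> N \<Longrightarrow> b \<in> N \<Longrightarrow> eval_at U (a + b) = eval_at U a + eval_at U b"
  by (intro eval_at_eqI near_add near_eval_at)

lemma eval_at_times: "ultrafilter U \<Longrightarrow> a \<in> N \<Longrightarrow> b \<in> N \<Longrightarrow> eval_at U (a * b) = eval_at U a * eval_at U b"
  by (intro eval_at_eqI near_times near_eval_at)

lemma eval_at_one: "ultrafilter U \<Longrightarrow> eval_at U 1 = 1"
  by (simp add: eval_at_eqI near_member ultrafilterD(3))

lemma eval_at_scaleC:
  assumes "ultrafilter U" "a \<in> N"
  shows "eval_at U (c *\<^sub>C a) = c * eval_at U a"
proof -
  have "c *\<^sub>C a = (c *\<^sub>C 1) * a"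
    by (rule bop_eqI) simp
  then show ?thesis
    using assms by (auto intro!: eval_at_eqI near_times near_scalar near_eval_at scaleC_mem)
qed

lemma eval_at_zero: "ultrafilter U \<Longrightarrow> eval_at U 0 = 0"
  using eval_at_add [of U 0 0] by simp

lemma eval_at_projection:
  assumes U: "ultrafilter U" and e: "e \<in> projections N"
  shows "eval_at U e = 1 \<longleftrightarrow> e \<in> U" "eval_at U e = 0 \<or> eval_at U e = 1"
proof -
  have 1: "eval_at U e = 1" if "e \<in> U"
    using that U by (simp add: eval_at_eqI near_member)
  have 0: "eval_at U e = 0" if "1 - e \<in> U"
  proof -
    have "eval_at U (e + (1 - e)) = eval_at U e + eval_at U (1 - e)"
      using projectionD(1) [OF e] by (intro eval_at_add U diff_mem one_mem)
    moreover have "eval_at U (1 - e) = 1"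
      using that U by (intro eval_at_eqI near_member)
    ultimately have "eval_at U (e + (1 - e)) = eval_at U e + 1"
      by simp
    then show ?thesis
      using eval_at_one [OF U] by simp
  qed
  show "eval_at U e = 1 \<longleftrightarrow> e \<in> U" "eval_at U e = 0 \<or> eval_at U e = 1"
    using 0 1 ultrafilterD(5) [OF U e] by auto
qed

text \<open>Compactness of the space of ultrafilters, in the form of an induction principle: a property
  of projections that passes to smaller projections and to orthogonal sums, and that
  holds near each point, holds everywhere.\<close>

lemma local_to_global:
  assumes Q0: "Q 0"
    and Qtimes: "\<And>e f. e \<in> projections N \<Longrightarrow> f \<in> projections N \<Longrightarrow> Q e \<Longrightarrow> Q (e * f)"
    and Qadd: "\<And>e f. e \<in> projections N \<Longrightarrow> f \<in> projections N \<Longrightarrow> e * f = 0 \<Longrightarrow> Q e \<Longrightarrow> Q f \<Longrightarrow> Q (e + f)"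
    and Qlocal: "\<And>U. ultrafilter U \<Longrightarrow> \<exists>e\<in>U. Q e"
  shows "Q 1"
proof (rule ccontr)
  assume "\<not> Q 1"
  define I where "I = {e \<in> projections N. Q e}"
  have add: "e + f \<in> projections N" if "e \<in> projections N" "f \<in> projections N" "e * f = 0" for e f
    using that commute [of e f] by (simp add: projections_def add_mem adj_add algebra_simps)
  obtain U where "ultrafilter U" "U \<inter> I = {}"
  proof (rule ultrafilter_avoiding_ideal [of I])
    show "0 \<in> I" "1 \<notin> I"
      using Q0 \<open>\<not> Q 1\<close> by (simp_all add: I_def zero_projection)
    show "e * f \<in> I" if "e \<in> I" "f \<in> projections N" for e f
      using that Qtimes times_projection by (simp add: I_def)
    show "e + f \<in> I" if "e \<in> I" "f \<in> I" "e * f = 0" for e f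
      using that Qadd add by (simp add: I_def)
  qed
  moreover from this(1) obtain e where "e \<in> U" "Q e"
    using Qlocal by blast
  ultimately show False
    using ultrafilterD(1) by (auto simp: I_def)
qed

text \<open>An element with all values zero is small near each point.  Since its parts on orthogonal
  projections have orthogonal ranges, the bounds on the parts combine to one that holds everywhere.\<close>

lemma eq_zero_if_eval_at_zero:
  assumes a: "a \<in> N" and zero: "\<And>U. ultrafilter U \<Longrightarrow> eval_at U a = 0"
  shows "a = 0"
proof (rule bop_eqI)
  fix x
  have "norm (bop_apply a x) \<le> \<epsilon>" if "\<epsilon> > 0" for \<epsilon>
  proof -
    define \<delta> where "\<delta> = \<epsilon> / (norm x + 1)"
    have "\<delta> > 0"
      unfolding \<delta>_def using \<open>\<epsilon> > 0\<close> by (intro divide_pos_pos add_nonneg_pos) auto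
    have "\<forall>x. norm (bop_apply a (bop_apply 1 x)) \<le> \<delta> * norm (bop_apply 1 x)"
    proof (rule local_to_global [of "\<lambda>e. \<forall>x. norm (bop_apply a (bop_apply e x)) \<le> \<delta> * norm (bop_apply e x)"])
      fix e f assume ef: "e \<in> projections N" "f \<in> projections N" "e * f = 0"
        and e: "\<forall>x. norm (bop_apply a (bop_apply e x)) \<le> \<delta> * norm (bop_apply e x)"
        and f: "\<forall>x. norm (bop_apply a (bop_apply f x)) \<le> \<delta> * norm (bop_apply f x)"
      have orth: "cinner (bop_apply e u) (bop_apply f v) = 0" for u v
        using cinner_adj_left [of e u "bop_apply f v"] ef projectionD(3) [OF ef(1)]
        by (simp flip: bop_apply_simps(6))
      have ac: "bop_apply a (bop_apply e u) = bop_apply e (bop_apply a u)"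
        "bop_apply a (bop_apply f u) = bop_apply f (bop_apply a u)" for u
        using commute_apply a ef projectionD(1) by blast+
      show "\<forall>x. norm (bop_apply a (bop_apply (e + f) x)) \<le> \<delta> * norm (bop_apply (e + f) x)"
      proof
        fix x
        have "(norm (bop_apply a (bop_apply (e + f) x)))\<^sup>2
          = (norm (bop_apply a (bop_apply e x)))\<^sup>2 + (norm (bop_apply a (bop_apply f x)))\<^sup>2"
          by (simp add: bop_linear ac norm_add_square orth)
        also have "\<dots> \<le> (\<delta> * norm (bop_apply e x))\<^sup>2 + (\<delta> * norm (bop_apply f x))\<^sup>2"
          using e f by (intro add_mono power_mono) auto
        also have "\<dots> = (\<delta> * norm (bop_apply (e + f) x))\<^sup>2"
          by (simp add: norm_add_square orth power_mult_distrib distrib_left)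
        finally show "norm (bop_apply a (bop_apply (e + f) x)) \<le> \<delta> * norm (bop_apply (e + f) x)"
          by (rule power2_le_imp_le) (use \<open>\<delta> > 0\<close> in simp)
      qed
    next
      fix U assume U: "ultrafilter U"
      then have "near U a 0"
        using near_eval_at [OF U a] zero by simp
      then obtain e where e: "e \<in> U" "\<And>x. norm (bop_apply a (bop_apply e x)) \<le> \<delta> * norm x"
        using \<open>\<delta> > 0\<close> by (auto simp: near_def)
      moreover have "bop_apply e (bop_apply e x) = bop_apply e x" for x
        using e(1) projectionD(4) ultrafilterD(1) [OF U] by blast
      ultimately have "norm (bop_apply a (bop_apply e x)) \<le> \<delta> * norm (bop_apply e x)" for x
        using e(2) [of "bop_apply e x"] by simp
      with e(1) show "\<exists>e\<in>U. \<forall>x. norm (bop_apply a (bop_apply e x)) \<le> \<delta> * norm (bop_apply e x)"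
        by blast
    qed (simp_all add: bop_linear)
    then have "norm (bop_apply a x) \<le> \<delta> * norm x"
      by simp
    also have "\<dots> \<le> \<epsilon>"
      using \<open>\<epsilon> > 0\<close> by (simp add: \<delta>_def divide_le_eq not_less add_nonneg_pos add_nonneg_nonneg algebra_simps)
    finally show ?thesis .
  qed
  then have "norm (bop_apply a x) \<le> 0"
    using field_le_epsilon [of "norm (bop_apply a x)" 0] by simp
  then show "bop_apply a x = bop_apply 0 x"
    by simp
qed

text \<open>To invert \<open>1 - z\<close> is to solve the fixed-point equation \<open>x = y + z x\<close> of a contraction.  Uniqueness of the
  solution makes the inverse commute with everything that commutes with \<open>z\<close>.\<close>

lemma inverse_near_one:
  assumes z: "z \<in> N" "\<And>x. norm (bop_apply z x) \<le> 1/2 * norm x"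
  obtains b where "b \<in> N" "(1 - z) * b = 1"
proof -
  have "\<exists>!x. y + bop_apply z x = x" for y
  proof -
    have "dist (y + bop_apply z u) (y + bop_apply z v) \<le> 1/2 * dist u v" for u v
      using z(2) [of "u - v"] by (simp add: dist_norm bop_linear)
    then show ?thesis
      by (intro banach_fix_type [where c = "1/2"]) auto
  qed
  then obtain g where g: "\<And>y. y + bop_apply z (g y) = g y" and uniq: "\<And>y x. y + bop_apply z x = x \<Longrightarrow> x = g y"
    by metis
  have "norm (g y) \<le> 2 * norm y" for y
    using norm_triangle_ineq [of y "bop_apply z (g y)"] z(2) [of "g y"] by (simp add: g)
  moreover have "g (x + y) = g x + g y" for x y
    using g [of x] g [of y] by (intro uniq [symmetric]) (simp add: bop_linear, metis add.assoc add.commute)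
  moreover have "g (c *\<^sub>C x) = c *\<^sub>C g x" for c x
    using g [of x] by (intro uniq [symmetric]) (simp add: bop_linear flip: scaleC_add_right)
  ultimately obtain b where b: "bop_apply b = g"
    using bop_exists [of g 2] by blast
  have "b \<in> N"
    unfolding mem_iff
  proof
    fix S assume S: "S \<in> commutant N"
    show "S * b = b * S"
    proof (rule bop_eqI)
      fix x
      have "bop_apply S (bop_apply z u) = bop_apply z (bop_apply S u)" for u
        using commutantD [OF z(1) S] by (metis bop_apply_simps(6))
      then have "bop_apply S x + bop_apply z (bop_apply S (g x)) = bop_apply S (g x)"
        by (metis bop_linear(1) g)
      then show "bop_apply (S * b) x = bop_apply (b * S) x"
        using uniq by (simp add: b)
    qed
  qed
  moreover have "(1 - z) * b = 1"
    using g by (intro bop_eqI) (simp add: b, metis add_diff_cancel_right')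
  ultimately show thesis
    by (rule that)
qed

text \<open>On a member of \<open>U\<close> where \<open>a\<close> differs from its value \<open>c\<close> by at most \<open>\<bar>c\<bar> / 2\<close>, the quotient
  \<open>a / c\<close> differs from the identity by at most one half.\<close>

lemma locally_invertible:
  assumes U: "ultrafilter U" and a: "a \<in> N" and "eval_at U a \<noteq> 0"
  shows "\<exists>e\<in>U. \<exists>b\<in>N. a * b = e"
proof -
  let ?c = "eval_at U a"
  obtain e where e: "e \<in> U" "\<And>x. norm (bop_apply (a - ?c *\<^sub>C 1) (bop_apply e x)) \<le> cmod ?c / 2 * norm x"
    using near_eval_at [OF U a] \<open>?c \<noteq> 0\<close> unfolding near_def by (metis half_gt_zero zero_less_norm_iff)
  have eN: "e \<in> N" "e * e = e"
    using e(1) ultrafilterD(1,6) [OF U] projectionD(2) by auto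
  define z where "z = (- 1 / ?c) *\<^sub>C ((a - ?c *\<^sub>C 1) * e)"
  have "z \<in> N"
    by (simp add: z_def scaleC_mem times_mem diff_mem a eN)
  moreover have "norm (bop_apply z x) \<le> 1/2 * norm x" for x
    using e(2) [of x] \<open>?c \<noteq> 0\<close>
    by (simp add: z_def norm_scaleC norm_divide divide_le_eq mult.commute del: bop_apply_simps(4))
  ultimately obtain b where b: "b \<in> N" "(1 - z) * b = 1"
    using inverse_near_one by blast
  have "a * e = ?c *\<^sub>C ((1 - z) * e)"
  proof (rule bop_eqI)
    fix x
    have "bop_apply e (bop_apply e x) = bop_apply e x"
      using eN by (simp flip: bop_apply_simps(6))
    then show "bop_apply (a * e) x = bop_apply (?c *\<^sub>C ((1 - z) * e)) x"
      using \<open>?c \<noteq> 0\<close>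
      by (simp add: z_def scaleC_diff_right scaleC_add_right scaleC_scaleC scaleC_minus_right scaleC_minus_left)
  qed
  define b' where "b' = (1 / ?c) *\<^sub>C (e * b)"
  have "a * b' = e"
  proof (rule bop_eqI)
    fix x
    have "bop_apply (a * e) (bop_apply b x) = ?c *\<^sub>C bop_apply (1 - z) (bop_apply e (bop_apply b x))"
      using \<open>a * e = _\<close> by simp
    also have "bop_apply e (bop_apply b x) = bop_apply b (bop_apply e x)"
      by (rule commute_apply [OF eN(1) b(1)])
    also have "bop_apply (1 - z) (bop_apply b (bop_apply e x)) = bop_apply e x"
      using b(2) by (metis bop_apply_simps(2,6))
    finally show "bop_apply (a * b') x = bop_apply e x"
      using \<open>?c \<noteq> 0\<close> by (simp add: b'_def bop_linear scaleC_scaleC)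
  qed
  moreover have "b' \<in> N"
    by (simp add: b'_def scaleC_mem times_mem eN b)
  ultimately show ?thesis
    using e(1) by blast
qed

lemma invertible_if_eval_at_nonzero:
  assumes a: "a \<in> N" and nz: "\<And>U. ultrafilter U \<Longrightarrow> eval_at U a \<noteq> 0"
  obtains b where "b \<in> N" "a * b = 1"
proof -
  have "\<exists>b\<in>N. a * b = 1"
  proof (rule local_to_global [of "\<lambda>e. \<exists>b\<in>N. a * b = e"])
    show "\<exists>b\<in>N. a * b = 0"
      by (intro bexI [of _ 0]) auto
    show "\<exists>b\<in>N. a * b = e * f" if "e \<in> projections N" "f \<in> projections N" "\<exists>b\<in>N. a * b = e" for e f
      using that projectionD(1) times_mem by (metis mult.assoc)
    show "\<exists>b\<in>N. a * b = e + f" if "\<exists>b\<in>N. a * b = e" "\<exists>b\<in>N. a * b = f" for e f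
      using that add_mem by (metis distrib_left)
    show "\<exists>e\<in>U. \<exists>b\<in>N. a * b = e" if "ultrafilter U" for U
      using locally_invertible [OF that a nz [OF that]] .
  qed
  then show thesis
    using that by blast
qed

end

section \<open>Spaces of intertwiners on a finite-dimensional space\<close>

abbreviation clinear :: "(complex ^ 'n::finite \<Rightarrow> complex ^ 'm::finite) \<Rightarrow> bool"
  where "clinear \<equiv> Vector_Spaces.linear (*s) (*s)"

lemma clinear_simps:
  assumes "clinear f"
  shows "f (x + y) = f x + f y" "f (c *s x) = c *s f x" "f 0 = 0" "f (x - y) = f x - f y" "f (- x) = - f x"
proof -
  interpret Vector_Spaces.linear "(*s)" "(*s)" f by (rule assms)
  show "f (x + y) = f x + f y" "f (c *s x) = c *s f x" "f 0 = 0" "f (x - y) = f x - f y" "f (- x) = - f x"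
    by (simp_all add: add scale zero diff neg)
qed

lemma clinearI:
  assumes "\<And>x y. f (x + y) = f x + f y" "\<And>c x. f (c *s x) = c *s f x"
  shows "clinear f"
  using assms by (intro Vector_Spaces.linear_iff [THEN iffD2] conjI allI vec.vector_space_axioms)

lemma scaleR_eq_vector_scalar_mult: "r *\<^sub>R x = complex_of_real r *s x" for x :: "complex ^ 'n"
  by (simp add: vec_eq_iff scaleR_conv_of_real [where 'a = complex])

lemma clinear_imp_linear: "clinear f \<Longrightarrow> linear f"
  by (rule linearI) (simp_all add: clinear_simps scaleR_eq_vector_scalar_mult)

lemma csubspace_imp_subspace: "vec.subspace V \<Longrightarrow> subspace V" for V :: "(complex ^ 'n) set"
  by (simp add: vec.subspace_def subspace_def scaleR_eq_vector_scalar_mult)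

text \<open>A form of rank--nullity for the map that \<open>G\<close> induces into the quotient by \<open>W\<close>: on that
  quotient \<open>A\<close> has the same image as a complement of \<open>K\<close> in \<open>A\<close>.\<close>

lemma dim_image_sum_le:
  fixes G :: "'a::euclidean_space \<Rightarrow> 'b::euclidean_space"
  assumes "linear G" "subspace A" "subspace W" "subspace K" "K \<subseteq> A" "G ` K \<subseteq> W"
  shows "dim {G x + u |x u. x \<in> A \<and> u \<in> W} + dim K \<le> dim A + dim W"
proof -
  define C where "C = {y \<in> A. \<forall>x\<in>K. orthogonal x y}"
  have dimC: "dim C + dim K = dim A"
    unfolding C_def by (rule dim_subspace_orthogonal_to_vectors) (use assms in auto)
  have "{G x + u |x u. x \<in> A \<and> u \<in> W} \<subseteq> {x + y |x y. x \<in> G ` span C \<and> y \<in> W}"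
  proof safe
    fix x u assume xu: "x \<in> A" "u \<in> W"
    obtain y z where yz: "y \<in> span K" "\<And>w. w \<in> span K \<Longrightarrow> orthogonal z w" "x = y + z"
      using orthogonal_subspace_decomp_exists [of K x] by blast
    then have yK: "y \<in> K"
      using \<open>subspace K\<close> span_eq_iff by blast
    then have "z \<in> A"
      using xu(1) yz(3) assms(2,5) subspace_diff [of A x y] by (auto simp: add_diff_cancel_left')
    then have "z \<in> C"
      using yz(2) by (auto simp: C_def orthogonal_commute span_base)
    moreover have "G y + u \<in> W"
      using yK xu(2) assms by (auto intro: subspace_add)
    moreover have "G x + u = G z + (G y + u)"
      using \<open>linear G\<close> yz(3) by (simp add: linear_add)
    ultimately show "\<exists>x' y. G x + u = x' + y \<and> x' \<in> G ` span C \<and> y \<in> W"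
      using span_base by blast
  qed
  then have "dim {G x + u |x u. x \<in> A \<and> u \<in> W} \<le> dim {x + y |x y. x \<in> G ` span C \<and> y \<in> W}"
    by (rule dim_subset)
  also have "\<dots> \<le> dim (G ` span C) + dim W"
    using dim_sums_Int [of "G ` span C" W] assms(1,3) by (simp add: linear_subspace_image)
  also have "dim (G ` span C) \<le> dim C"
    using dim_image_le [OF assms(1), of "span C"] by simp
  finally show ?thesis
    using dimC by simp
qed

lemma dim_less_if_proper:
  "subspace V \<Longrightarrow> subspace W \<Longrightarrow> V \<subset> W \<Longrightarrow> dim V < dim W" for V :: "'a::euclidean_space set"
  by (rule ccontr) (use subspace_dim_equal [of V W] in auto)

text \<open>Evaluating a polynomial at an endomorphism \<open>T\<close>, applied to the vector \<open>u\<close>, by Horner's rule.\<close>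

definition poly_orbit :: "(complex ^ 'n::finite \<Rightarrow> complex ^ 'n) \<Rightarrow> complex ^ 'n \<Rightarrow> complex poly \<Rightarrow> complex ^ 'n"
  where "poly_orbit T u p = fold_coeffs (\<lambda>a y. a *s u + T y) p 0"

context
  fixes T :: "complex ^ 'n::finite \<Rightarrow> complex ^ 'n"
  assumes T: "clinear T"
begin

lemma poly_orbit_pCons: "poly_orbit T u (pCons a p) = a *s u + T (poly_orbit T u p)"
  by (cases "p = 0 \<and> a = 0") (auto simp: poly_orbit_def clinear_simps [OF T])

lemma poly_orbit_0: "poly_orbit T u 0 = 0"
  by (simp add: poly_orbit_def)

lemma poly_orbit_add: "poly_orbit T u (p + q) = poly_orbit T u p + poly_orbit T u q"
  by (induction p q rule: poly_induct2)
    (simp_all add: poly_orbit_0 poly_orbit_pCons clinear_simps [OF T] vec.scale_left_distrib algebra_simps)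

lemma poly_orbit_smult: "poly_orbit T u (smult c p) = c *s poly_orbit T u p"
  by (induction p) (simp_all add: poly_orbit_0 poly_orbit_pCons clinear_simps [OF T] vec.scale_right_distrib)

lemma poly_orbit_sum: "finite A \<Longrightarrow> poly_orbit T u (\<Sum>i\<in>A. f i) = (\<Sum>i\<in>A. poly_orbit T u (f i))"
  by (induction A rule: finite_induct) (simp_all add: poly_orbit_0 poly_orbit_add)

lemma poly_orbit_in:
  assumes "vec.subspace U" "u \<in> U" "T ` U \<subseteq> U"
  shows "poly_orbit T u p \<in> U"
  using assms by (induction p) (auto simp: poly_orbit_0 poly_orbit_pCons vec.subspace_0
      intro!: vec.subspace_add vec.subspace_scale)

lemma annihilating_poly: "\<exists>p. p \<noteq> 0 \<and> poly_orbit T u p = 0"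
proof -
  define g where "g = (\<lambda>i. poly_orbit T u (monom 1 i))"
  let ?I = "{..CARD('n)}"
  show ?thesis
  proof (cases "inj_on g ?I")
    case False
    then obtain i j where ij: "i \<noteq> j" "g i = g j"
      by (auto simp: inj_on_def)
    have "poly_orbit T u (monom 1 i + smult (-1) (monom 1 j)) = 0"
      using ij(2) by (simp add: poly_orbit_add poly_orbit_smult g_def del: smult_minus_left)
    moreover have "monom 1 i + smult (-1) (monom 1 j) \<noteq> (0 :: complex poly)"
      using ij(1) by (auto simp: poly_eq_iff intro!: exI [of _ i])
    ultimately show ?thesis by blast
  next
    case True
    have "vec.dependent (g ` ?I)"
    proof (rule vec.dependent_biggerset_general)
      have "vec.dim (g ` ?I) \<le> CARD('n)"
        using vec.dim_subset_UNIV [of "g ` ?I"] by (simp add: vec.dimension_def card_cart_basis)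
      then show "vec.dim (g ` ?I) < card (g ` ?I)"
        using True by (simp add: card_image)
    qed
    then obtain c v where c: "(\<Sum>v\<in>g ` ?I. c v *s v) = 0" and v: "v \<in> g ` ?I" "c v \<noteq> 0"
      by (auto simp: vec.dependent_finite)
    then obtain k where k: "k \<in> ?I" "v = g k" by blast
    define p where "p = (\<Sum>i\<in>?I. smult (c (g i)) (monom 1 i))"
    have "poly_orbit T u p = (\<Sum>i\<in>?I. c (g i) *s g i)"
      by (simp add: p_def poly_orbit_sum poly_orbit_smult g_def)
    also have "\<dots> = 0"
      using c True by (simp add: sum.reindex)
    finally have "poly_orbit T u p = 0" .
    moreover have "coeff p k = c (g k)"
      using k(1) by (simp add: p_def coeff_sum if_distrib [of "\<lambda>x. _ * x"] sum.delta cong: if_cong)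
    then have "p \<noteq> 0"
      using v(2) k(2) by auto
    ultimately show ?thesis by blast
  qed
qed

text \<open>Among the nonzero polynomials that take \<open>u\<close> into \<open>W\<close> one of least degree has a root; dividing it out
  gives an eigenvector modulo \<open>W\<close>.\<close>

lemma eigenvector_modulo_subspace:
  assumes "vec.subspace U" "vec.subspace W" "T ` U \<subseteq> U" "T ` W \<subseteq> W" "u \<in> U" "u \<notin> W"
  shows "\<exists>l. \<exists>v\<in>U. v \<notin> W \<and> T v - l *s v \<in> W"
proof -
  obtain p where p: "p \<noteq> 0" "poly_orbit T u p \<in> W"
    and least: "\<And>q. q \<noteq> 0 \<Longrightarrow> poly_orbit T u q \<in> W \<Longrightarrow> degree p \<le> degree q"
  proof -
    have "\<exists>p. p \<noteq> 0 \<and> poly_orbit T u p \<in> W"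
      using annihilating_poly [of u] vec.subspace_0 [OF assms(2)] by metis
    then obtain p where "p \<noteq> 0 \<and> poly_orbit T u p \<in> W"
      "\<And>q. q \<noteq> 0 \<and> poly_orbit T u q \<in> W \<Longrightarrow> degree p \<le> degree q"
      using ex_has_least_nat [of "\<lambda>p. p \<noteq> 0 \<and> poly_orbit T u p \<in> W" _ degree] by blast
    then show thesis
      using that by blast
  qed
  have "degree p \<noteq> 0"
  proof
    assume "degree p = 0"
    then obtain a where a: "p = [:a:]"
      using degree_eq_zeroE by blast
    then have "a *s u \<in> W" "a \<noteq> 0"
      using p by (auto simp: poly_orbit_pCons poly_orbit_0 clinear_simps [OF T])
    then have "(1 / a) *s (a *s u) \<in> W"
      using assms(2) vec.subspace_scale by blast
    then show False
      using \<open>a \<noteq> 0\<close> assms(6) by simp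
  qed
  then obtain l where "poly p l = 0"
    using fundamental_theorem_of_algebra constant_degree by metis
  then have "[:- l, 1:] dvd p"
    by (simp add: poly_eq_0_iff_dvd)
  then obtain q where q: "p = [:- l, 1:] * q"
    by (rule dvdE)
  then have "q \<noteq> 0"
    using p(1) by auto
  then have "degree p = Suc (degree q)"
    using degree_mult_eq [of "[:- l, 1:]" q] by (simp add: q del: mult_pCons_left)
  define v where "v = poly_orbit T u q"
  have "v \<notin> W"
    using least [OF \<open>q \<noteq> 0\<close>] \<open>degree p = _\<close> by (auto simp: v_def)
  moreover have "v \<in> U"
    unfolding v_def by (rule poly_orbit_in) (use assms in auto)
  moreover have "p = pCons 0 q + smult (- l) q"
    by (simp add: q mult_pCons_left)
  then have "poly_orbit T u p = T v - l *s v"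
    by (simp add: poly_orbit_add poly_orbit_smult poly_orbit_pCons v_def del: smult_minus_left)
  ultimately show ?thesis
    using p(2) by metis
qed

end

text \<open>Injectivity of the map that \<open>e\<close> induces on the quotient of \<open>V\<close> by \<open>V'\<close>, with values modulo \<open>W'\<close>.\<close>

definition inj_modulo ::
    "(complex ^ 'n::finite \<Rightarrow> complex ^ 'n) \<Rightarrow> (complex ^ 'n) set \<Rightarrow> (complex ^ 'n) set \<Rightarrow> (complex ^ 'n) set \<Rightarrow> bool"
  where "inj_modulo e V V' W' \<longleftrightarrow> (\<forall>x\<in>V. e x \<in> W' \<longrightarrow> x \<in> V')"

text \<open>Kernel vectors of \<open>e + t e'\<close> for distinct \<open>t\<close> behave like eigenvectors for distinct eigenvalues: from
  a relation between them the map \<open>e'\<close>, together with \<open>e' x\<^sub>t = - e x\<^sub>t / t\<close>, produces a relation with coefficients divided by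
  \<open>t\<close>, and a combination of the two eliminates one vector.  Hence a pencil that is
  injective at \<open>t = 0\<close> fails to be so for finitely many \<open>t\<close> only.\<close>

lemma pencil_kernels_independent:
  fixes e e' :: "complex ^ 'n::finite \<Rightarrow> complex ^ 'n"
  assumes lin: "clinear e" "clinear e'" and sub: "vec.subspace V" "vec.subspace V'" "vec.subspace W'"
    and maps: "e ` V' \<subseteq> W'" "e' ` V' \<subseteq> W'" and inj: "inj_modulo e V V' W'"
    and "finite S" and x: "\<And>t. t \<in> S \<Longrightarrow> t \<noteq> 0 \<and> x t \<in> V \<and> x t \<notin> V' \<and> e (x t) + t *s e' (x t) \<in> W'"
    and "(\<Sum>t\<in>S. a t *s x t) \<in> V'"
  shows "\<forall>t\<in>S. a t = 0"
  using \<open>finite S\<close> x \<open>(\<Sum>t\<in>S. a t *s x t) \<in> V'\<close>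
proof (induction S arbitrary: a rule: finite_induct)
  case (insert s S)
  interpret e: Vector_Spaces.linear "(*s)" "(*s)" e by (rule lin)
  interpret e': Vector_Spaces.linear "(*s)" "(*s)" e' by (rule lin)
  let ?S = "insert s S"
  let ?y = "\<Sum>t\<in>?S. (a t / t) *s x t"
  have eq: "e ?y + e' (\<Sum>t\<in>?S. a t *s x t) = (\<Sum>t\<in>?S. (a t / t) *s (e (x t) + t *s e' (x t)))"
    unfolding e.sum e'.sum e.scale e'.scale sum.distrib [symmetric] vec.scale_right_distrib vec.scale_scale
    using insert.prems(1) by (intro sum.cong) auto
  have "(\<Sum>t\<in>?S. (a t / t) *s (e (x t) + t *s e' (x t))) \<in> W'"
    using sub(3) insert.prems(1) by (intro vec.subspace_sum vec.subspace_scale) auto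
  moreover have "e' (\<Sum>t\<in>?S. a t *s x t) \<in> W'"
    using insert.prems(2) maps by auto
  ultimately have "e ?y \<in> W'"
    using vec.subspace_diff [OF sub(3)] by (simp only: eq [THEN iffD2 [OF eq_diff_eq]])
  moreover have "?y \<in> V"
    using sub(1) insert.prems(1) by (intro vec.subspace_sum vec.subspace_scale) auto
  ultimately have "?y \<in> V'"
    using inj by (simp add: inj_modulo_def)
  then have "(\<Sum>t\<in>?S. a t *s x t) - s *s ?y \<in> V'"
    using insert.prems(2) sub(2) vec.subspace_diff vec.subspace_scale by blast
  also have "(\<Sum>t\<in>?S. a t *s x t) - s *s ?y = (\<Sum>t\<in>?S. (a t - s * (a t / t)) *s x t)"
    by (simp only: vec.scale_sum_right sum_subtractf [symmetric] vec.scale_scale vec.scale_left_diff_distrib [symmetric])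
  also have "\<dots> = (\<Sum>t\<in>S. (a t - s * (a t / t)) *s x t)"
    using insert.hyps insert.prems(1) [of s] by simp
  finally have "\<forall>t\<in>S. a t - s * (a t / t) = 0"
    by (rule insert.IH [rotated]) (use insert.prems(1) in auto)
  then have 0: "\<forall>t\<in>S. a t = 0"
    using insert.hyps(2) insert.prems(1) by (auto simp: field_simps)
  then have "a s *s x s \<in> V'"
    using insert.prems(2) insert.hyps by simp
  then have "a s = 0"
  proof (rule contrapos_pp)
    assume "a s \<noteq> 0"
    then have "(1 / a s) *s (a s *s x s) = x s" by simp
    then show "a s *s x s \<notin> V'"
      using vec.subspace_scale [OF sub(2)] insert.prems(1) [of s] by (metis insertI1)
  qed
  with 0 show ?case by simp
qed simp

lemma pencil_finite_exceptions:
  fixes e e' :: "complex ^ 'n::finite \<Rightarrow> complex ^ 'n"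
  assumes lin: "clinear e" "clinear e'" and sub: "vec.subspace V" "vec.subspace V'" "vec.subspace W'"
    and maps: "e ` V' \<subseteq> W'" "e' ` V' \<subseteq> W'" and inj: "inj_modulo e V V' W'"
  shows "finite {t. \<not> inj_modulo (\<lambda>x. e x + t *s e' x) V V' W'}"
proof (rule ccontr)
  define B where "B = {t. \<not> inj_modulo (\<lambda>x. e x + t *s e' x) V V' W'}"
  assume "infinite {t. \<not> inj_modulo (\<lambda>x. e x + t *s e' x) V V' W'}"
  then have "infinite B"
    by (simp add: B_def)
  then obtain S where S: "S \<subseteq> B" "finite S" "card S = Suc CARD('n)"
    using infinite_arbitrarily_large by blast
  have "\<exists>x. x \<in> V \<and> x \<notin> V' \<and> e x + t *s e' x \<in> W'" if "t \<in> B" for t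
    using that by (auto simp: B_def inj_modulo_def)
  then obtain x where x: "\<And>t. t \<in> B \<Longrightarrow> x t \<in> V \<and> x t \<notin> V' \<and> e (x t) + t *s e' (x t) \<in> W'"
    by metis
  have "t \<noteq> 0" if "t \<in> B" for t
    using that inj by (auto simp: B_def inj_modulo_def)
  then have xS: "\<And>t. t \<in> S \<Longrightarrow> t \<noteq> 0 \<and> x t \<in> V \<and> x t \<notin> V' \<and> e (x t) + t *s e' (x t) \<in> W'"
    using x S(1) by blast
  note indep = pencil_kernels_independent [OF lin sub maps inj S(2) xS]
  have 0: "0 \<in> V'"
    by (rule vec.subspace_0 [OF sub(2)])
  have inj_x: "inj_on x S"
  proof (rule inj_onI, rule ccontr)
    fix s t assume st: "s \<in> S" "t \<in> S" "x s = x t" "s \<noteq> t"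
    define a where "a = (\<lambda>r. if r = s then 1 else if r = t then - 1 else (0::complex))"
    have "(\<Sum>r\<in>S. a r *s x r) = (\<Sum>r\<in>{s, t}. a r *s x r)"
      using st S(2) by (intro sum.mono_neutral_right) (auto simp: a_def)
    also have "\<dots> = 0"
      using st by (simp add: a_def vec.scale_minus_left)
    finally have "a s = 0"
      using indep [of a] 0 st(1) by simp
    then show False
      by (simp add: a_def)
  qed
  have "vec.independent (x ` S)"
    unfolding vec.dependent_finite [OF finite_imageI [OF S(2)]]
  proof safe
    fix c t assume "t \<in> S" "c (x t) \<noteq> 0" "(\<Sum>v\<in>x ` S. c v *s v) = 0"
    then show False
      using indep [of "\<lambda>t. c (x t)"] 0 inj_x by (simp add: sum.reindex)
  qed
  then have "card (x ` S) \<le> vec.dim (x ` S)"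
    using vec.independent_bound_general by blast
  also have "\<dots> \<le> CARD('n)"
    using vec.dim_subset_UNIV [of "x ` S"] by (simp add: vec.dimension_def card_cart_basis)
  finally show False
    using S(3) inj_x by (simp add: card_image)
qed

text \<open>The values at one point of the intertwiners from \<open>A\<close> to \<open>B\<close> and of those from \<open>B\<close> to \<open>A\<close>.  The last
  assumption says that some two-by-two matrix over \<open>E\<close> has an inverse over \<open>F\<close>.\<close>

locale intertwiners =
  fixes E F :: "(complex ^ 'n::finite \<Rightarrow> complex ^ 'n) set"
  assumes linE: "e \<in> E \<Longrightarrow> clinear e" and linF: "f \<in> F \<Longrightarrow> clinear f"
    and E_add: "e \<in> E \<Longrightarrow> e' \<in> E \<Longrightarrow> (\<lambda>x. e x + e' x) \<in> E"
    and F_add: "f \<in> F \<Longrightarrow> f' \<in> F \<Longrightarrow> (\<lambda>x. f x + f' x) \<in> F"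
    and E_scale: "e \<in> E \<Longrightarrow> (\<lambda>x. c *s e x) \<in> E"
    and F_scale: "f \<in> F \<Longrightarrow> (\<lambda>x. c *s f x) \<in> F"
    and EFE: "e \<in> E \<Longrightarrow> f \<in> F \<Longrightarrow> e' \<in> E \<Longrightarrow> (\<lambda>x. e (f (e' x))) \<in> E"
    and FEF: "f \<in> F \<Longrightarrow> e \<in> E \<Longrightarrow> f' \<in> F \<Longrightarrow> (\<lambda>x. f (e (f' x))) \<in> F"
    and invertible_2x2: "\<exists>x11\<in>E. \<exists>x12\<in>E. \<exists>x21\<in>E. \<exists>x22\<in>E. \<exists>y11\<in>F. \<exists>y12\<in>F. \<exists>y21\<in>F. \<exists>y22\<in>F. \<forall>u v.
      y11 (x11 u + x12 v) + y12 (x21 u + x22 v) = u \<and> y21 (x11 u + x12 v) + y22 (x21 u + x22 v) = v \<and>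
      x11 (y11 u + y12 v) + x12 (y21 u + y22 v) = u \<and> x21 (y11 u + y12 v) + x22 (y21 u + y22 v) = v"
begin

lemma E_nonempty: "(\<lambda>x. 0) \<in> E"
proof -
  obtain e where "e \<in> E"
    using invertible_2x2 by blast
  then show ?thesis
    using E_scale [of e 0] by simp
qed

lemma intertwiners_swap: "intertwiners F E"
proof (rule intertwiners.intro)
  show "\<exists>x11\<in>F. \<exists>x12\<in>F. \<exists>x21\<in>F. \<exists>x22\<in>F. \<exists>y11\<in>E. \<exists>y12\<in>E. \<exists>y21\<in>E. \<exists>y22\<in>E. \<forall>u v.
      y11 (x11 u + x12 v) + y12 (x21 u + x22 v) = u \<and> y21 (x11 u + x12 v) + y22 (x21 u + x22 v) = v \<and>
      x11 (y11 u + y12 v) + x12 (y21 u + y22 v) = u \<and> x21 (y11 u + y12 v) + x22 (y21 u + y22 v) = v"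
    using invertible_2x2 by blast
qed (rule linE linF E_add F_add E_scale F_scale EFE FEF; assumption)+

text \<open>The subobjects of the representation formed by two copies of the space with the maps \<open>E\<close> from the
  first to the second and \<open>F\<close> back.\<close>

definition stable :: "(complex ^ 'n) set \<Rightarrow> (complex ^ 'n) set \<Rightarrow> bool"
  where "stable V W \<longleftrightarrow> vec.subspace V \<and> vec.subspace W \<and>
    (\<forall>e\<in>E. e ` V \<subseteq> W) \<and> (\<forall>f\<in>F. f ` W \<subseteq> V)"

lemma stableD:
  assumes "stable V W"
  shows "vec.subspace V" "vec.subspace W" "subspace V" "subspace W"
    "\<And>e x. e \<in> E \<Longrightarrow> x \<in> V \<Longrightarrow> e x \<in> W" "\<And>f y. f \<in> F \<Longrightarrow> y \<in> W \<Longrightarrow> f y \<in> V"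
  using assms csubspace_imp_subspace unfolding stable_def by blast+

lemma stable_swap: "intertwiners.stable F E W V \<longleftrightarrow> stable V W"
  unfolding intertwiners.stable_def [OF intertwiners_swap] stable_def by blast

text \<open>The invertible two-by-two matrix restricts to an injection of \<open>V \<times> V\<close> into \<open>W \<times> W\<close>.\<close>

lemma stable_dim_le:
  assumes "stable V W"
  shows "dim V \<le> dim W"
proof -
  obtain x11 x12 x21 x22 y11 y12 y21 y22 where
    x: "x11 \<in> E" "x12 \<in> E" "x21 \<in> E" "x22 \<in> E"
    and yx: "\<And>u v. y11 (x11 u + x12 v) + y12 (x21 u + x22 v) = u" "\<And>u v. y21 (x11 u + x12 v) + y22 (x21 u + x22 v) = v"
    using invertible_2x2 by metis
  define X where "X = (\<lambda>p. (x11 (fst p) + x12 (snd p), x21 (fst p) + x22 (snd p)))"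
  have lin: "linear x11" "linear x12" "linear x21" "linear x22"
    using x linE clinear_imp_linear by blast+
  have "linear X"
    unfolding X_def
    by (intro linearI) (simp_all add: lin [THEN linear_add] lin [THEN linear_cmul] scaleR_right_distrib)
  moreover have "inj X"
  proof (rule injI)
    fix p q assume "X p = X q"
    then have "x11 (fst p) + x12 (snd p) = x11 (fst q) + x12 (snd q)" "x21 (fst p) + x22 (snd p) = x21 (fst q) + x22 (snd q)"
      by (auto simp: X_def)
    then show "p = q"
      using yx(1) [of "fst p" "snd p"] yx(1) [of "fst q" "snd q"] yx(2) [of "fst p" "snd p"] yx(2) [of "fst q" "snd q"]
      by (simp add: prod_eq_iff)
  qed
  ultimately have "dim (X ` (V \<times> V)) = dim (V \<times> V)"
    by (intro dim_image_eq) (auto intro: inj_on_subset)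
  moreover have "X ` (V \<times> V) \<subseteq> W \<times> W"
    using stableD [OF assms] x by (auto simp: X_def intro!: vec.subspace_add)
  then have "dim (X ` (V \<times> V)) \<le> dim (W \<times> W)"
    by (rule dim_subset)
  ultimately show ?thesis
    using stableD(3,4) [OF assms] by (simp add: dim_Times)
qed

lemma stable_dim_eq: "stable V W \<Longrightarrow> dim V = dim W"
  using stable_dim_le intertwiners.stable_dim_le [OF intertwiners_swap] stable_swap
  by (metis le_antisym)

lemma stable_eqI:
  assumes "stable V W" "stable V' W'" "V \<subseteq> V'" "W \<subseteq> W'" "V = V' \<or> W = W'"
  shows "V = V'" "W = W'"
proof -
  have "dim V = dim W" "dim V' = dim W'"
    using assms stable_dim_eq by auto
  then have "dim V = dim V'" "dim W = dim W'"
    using assms(5) by auto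
  then show "V = V'" "W = W'"
    using assms subspace_dim_equal [of V V'] subspace_dim_equal [of W W'] by (auto simp: stableD)
qed

end

locale simple_subquotient = intertwiners +
  fixes V0 W0 V1 W1
  assumes stable0: "stable V0 W0" and stable1: "stable V1 W1" and VV: "V1 \<subset> V0" and WW: "W1 \<subset> W0"
    and simple: "stable V W \<Longrightarrow> V1 \<subseteq> V \<Longrightarrow> V \<subseteq> V0 \<Longrightarrow> W1 \<subseteq> W \<Longrightarrow> W \<subseteq> W0 \<Longrightarrow> (V = V1 \<and> W = W1) \<or> (V = V0 \<and> W = W0)"
begin

lemma simple_subquotient_swap: "simple_subquotient F E W0 V0 W1 V1"
  using stable0 stable1 VV WW simple
  by (intro simple_subquotient.intro intertwiners_swap simple_subquotient_axioms.intro)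
    (auto simp: stable_swap)

text \<open>The vectors reached from \<open>x\<close> modulo \<open>W1\<close> form the second half of a stable pair whose first half
  contains \<open>x\<close>; by simplicity this pair is the full one.\<close>

lemma E_transitive:
  assumes x: "x \<in> V0" "x \<notin> V1" and w: "w \<in> W0"
  shows "\<exists>e\<in>E. e x - w \<in> W1"
proof -
  define W where "W = {y \<in> W0. \<exists>e\<in>E. e x - y \<in> W1}"
  define V where "V = {v \<in> V0. \<forall>e\<in>E. e v \<in> W}"
  note s0 = stableD [OF stable0] and s1 = stableD [OF stable1]
  have subW: "vec.subspace W"
    unfolding vec.subspace_def W_def
  proof (intro conjI ballI allI CollectI)
    show "\<exists>e\<in>E. e x - 0 \<in> W1"
      using E_nonempty vec.subspace_0 [OF s1(2)] by force
  next
    fix y z assume "y \<in> {y \<in> W0. \<exists>e\<in>E. e x - y \<in> W1}" "z \<in> {y \<in> W0. \<exists>e\<in>E. e x - y \<in> W1}"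
    then obtain e e' where "e \<in> E" "e' \<in> E" "(e x - y) + (e' x - z) \<in> W1"
      using vec.subspace_add [OF s1(2)] by blast
    then show "\<exists>e\<in>E. e x - (y + z) \<in> W1"
      by (intro bexI [of _ "\<lambda>x. e x + e' x"] E_add) (auto simp: algebra_simps)
  next
    fix c y assume "y \<in> {y \<in> W0. \<exists>e\<in>E. e x - y \<in> W1}"
    then obtain e where "e \<in> E" "c *s (e x - y) \<in> W1"
      using vec.subspace_scale [OF s1(2)] by blast
    then show "\<exists>e\<in>E. e x - c *s y \<in> W1"
      by (intro bexI [of _ "\<lambda>x. c *s e x"] E_scale) (auto simp: vec.scale_right_diff_distrib)
  qed (use s0(2) in \<open>auto intro: vec.subspace_0 vec.subspace_add vec.subspace_scale\<close>)
  have subV: "vec.subspace V"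
    unfolding vec.subspace_def V_def
    using vec.subspace_0 [OF subW] vec.subspace_0 [OF s0(1)]
    by (auto simp: linE [THEN clinear_simps(1)] linE [THEN clinear_simps(2)] linE [THEN clinear_simps(3)]
        intro!: vec.subspace_add [OF subW] vec.subspace_scale [OF subW]
        vec.subspace_add [OF s0(1)] vec.subspace_scale [OF s0(1)])
  have "e (f y) \<in> W" if "e \<in> E" "f \<in> F" "y \<in> W" for e f y
  proof -
    obtain g where g: "g \<in> E" "g x - y \<in> W1" "y \<in> W0"
      using \<open>y \<in> W\<close> by (auto simp: W_def)
    have "e (f (g x - y)) \<in> W1"
      using g that s1 by blast
    then have "e (f (g x)) - e (f y) \<in> W1"
      using that by (simp add: clinear_simps [OF linE] clinear_simps [OF linF])
    moreover have "e (f y) \<in> W0"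
      using g(3) that s0 by blast
    ultimately show ?thesis
      using EFE [OF that(1,2) g(1)] by (auto simp: W_def)
  qed
  then have "stable V W"
    using subV subW s0(6) by (auto simp: stable_def V_def) (auto simp: W_def)
  moreover have W1W: "W1 \<subseteq> W"
    using WW E_nonempty vec.subspace_neg [OF s1(2)] by (force simp: W_def)
  moreover have "V1 \<subseteq> V"
    using VV W1W s1(5) by (auto simp: V_def)
  moreover have "x \<in> V"
    using x s0(5) vec.subspace_0 [OF s1(2)] by (force simp: V_def W_def)
  ultimately have "W = W0"
    using simple [of V W] x(2) by (auto simp: V_def W_def)
  then show ?thesis
    using w by (auto simp: W_def)
qed

lemma F_transitive: "y \<in> W0 \<Longrightarrow> y \<notin> W1 \<Longrightarrow> v \<in> V0 \<Longrightarrow> \<exists>f\<in>F. f y - v \<in> V1"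
  by (rule simple_subquotient.E_transitive [OF simple_subquotient_swap])

lemma subspace_sum_set:
  assumes "clinear g" "vec.subspace A" "vec.subspace B"
  shows "vec.subspace {g x + u |x u. x \<in> A \<and> u \<in> B}"
  unfolding vec.subspace_def
proof (intro conjI ballI allI)
  show "0 \<in> {g x + u |x u. x \<in> A \<and> u \<in> B}"
    using vec.subspace_0 [OF assms(2)] vec.subspace_0 [OF assms(3)] clinear_simps(3) [OF assms(1)] by force
next
  fix y z assume "y \<in> {g x + u |x u. x \<in> A \<and> u \<in> B}" "z \<in> {g x + u |x u. x \<in> A \<and> u \<in> B}"
  then obtain x u x' u' where *: "y = g x + u" "z = g x' + u'" "x \<in> A" "u \<in> B" "x' \<in> A" "u' \<in> B"
    by blast
  then have "y + z = g (x + x') + (u + u')"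
    by (simp add: clinear_simps [OF assms(1)])
  then show "y + z \<in> {g x + u |x u. x \<in> A \<and> u \<in> B}"
    using * vec.subspace_add [OF assms(2)] vec.subspace_add [OF assms(3)] by blast
next
  fix c y assume "y \<in> {g x + u |x u. x \<in> A \<and> u \<in> B}"
  then obtain x u where *: "y = g x + u" "x \<in> A" "u \<in> B"
    by blast
  then have "c *s y = g (c *s x) + c *s u"
    by (simp add: clinear_simps [OF assms(1)] vec.scale_right_distrib)
  then show "c *s y \<in> {g x + u |x u. x \<in> A \<and> u \<in> B}"
    using * vec.subspace_scale [OF assms(2)] vec.subspace_scale [OF assms(3)] by blast
qed

text \<open>The core of Burnside's theorem.  If \<open>e\<close> has least nonzero rank on the subquotient and
  \<open>e x\<close>, \<open>e y\<close> were independent, transitivity would give \<open>f\<close> with \<open>f (e x) = y\<close>; for an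
  eigenvalue \<open>l\<close> of \<open>e f\<close> on the range of \<open>e\<close> the element \<open>e f e - l e\<close> would have smaller
  rank, and it does not vanish at \<open>x\<close>.\<close>

lemma rank_one_exists:
  obtains e w y where "e \<in> E" "w \<in> W0" "w \<notin> W1" "y \<in> V0" "e y \<notin> W1"
    "\<And>x. x \<in> V0 \<Longrightarrow> \<exists>c. e x - c *s w \<in> W1"
proof -
  note s0 = stableD [OF stable0] and s1 = stableD [OF stable1]
  define R where "R = (\<lambda>e. {e x + u |x u. x \<in> V0 \<and> u \<in> W1})"
  define Q where "Q = (\<lambda>e. e \<in> E \<and> (\<exists>x\<in>V0. e x \<notin> W1))"
  have "\<exists>e. Q e"
  proof -
    obtain x w where xw: "x \<in> V0" "x \<notin> V1" "w \<in> W0" "w \<notin> W1"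
      using VV WW by blast
    then obtain e where "e \<in> E" "e x - w \<in> W1"
      using E_transitive by blast
    moreover have "e x \<notin> W1"
      using calculation(2) xw(4) vec.subspace_diff [OF s1(2), of "e x" "e x - w"] by auto
    ultimately show ?thesis
      using xw(1) by (auto simp: Q_def)
  qed
  then obtain e where Q: "Q e" and least: "\<And>e'. Q e' \<Longrightarrow> dim (R e) \<le> dim (R e')"
    using ex_has_least_nat [of Q _ "\<lambda>e. dim (R e)"] by blast
  then obtain x where x: "x \<in> V0" "e x \<notin> W1" and e: "e \<in> E"
    by (auto simp: Q_def)
  have "\<exists>c. e y - c *s e x \<in> W1" if y: "y \<in> V0" for y
  proof (rule ccontr)
    assume no: "\<nexists>c. e y - c *s e x \<in> W1"
    obtain f where f: "f \<in> F" "f (e x) - y \<in> V1"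
      using F_transitive [of "e x" y] x y e s0(5) by blast
    define T where "T = (\<lambda>z. e (f z))"
    have T: "clinear T"
      using linE [OF e] linF [OF f(1)] by (intro clinearI) (simp_all add: T_def clinear_simps)
    have subR: "vec.subspace (R e)"
      unfolding R_def by (rule subspace_sum_set [OF linE [OF e] s0(1) s1(2)])
    have W1R: "W1 \<subseteq> R e"
      using vec.subspace_0 [OF s0(1)] clinear_simps(3) [OF linE [OF e]] by (force simp: R_def)
    have RW0: "R e \<subseteq> W0"
      using s0 e WW vec.subspace_add [OF s0(2)] by (auto simp: R_def)
    have eR: "e v \<in> R e" if "v \<in> V0" for v
      using that vec.subspace_0 [OF s1(2)] by (force simp: R_def)
    have TR: "T ` R e \<subseteq> R e"
      using RW0 eR s0(6) f(1) by (auto simp: T_def)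
    have TW: "T ` W1 \<subseteq> W1"
      using s1 e f(1) by (auto simp: T_def)
    obtain l v where lv: "v \<in> R e" "v \<notin> W1" "T v - l *s v \<in> W1"
      using eigenvector_modulo_subspace [OF T subR s1(2) TR TW eR [OF x(1)] x(2)] by blast
    define G where "G = (\<lambda>z. T z - l *s z)"
    have G: "clinear G"
    proof (rule clinearI)
      show "G (x + y) = G x + G y" for x y
        by (simp add: G_def clinear_simps(1) [OF T] vec.scale_right_distrib)
      show "G (c *s x) = c *s G x" for c x
        by (simp only: G_def clinear_simps(2) [OF T] vec.scale_right_diff_distrib vec.scale_scale mult.commute [of c l])
    qed
    define e' where "e' = (\<lambda>z. e (f (e z)) + (- l) *s e z)"
    have e': "e' \<in> E"
      unfolding e'_def by (rule E_add [OF EFE [OF e f(1) e] E_scale [OF e]])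
    have e'G: "e' z = G (e z)" for z
      by (simp add: e'_def G_def T_def vec.scale_minus_left)
    have "e' x \<notin> W1"
    proof
      assume "e' x \<in> W1"
      moreover have "e (f (e x) - y) \<in> W1"
        using s1(5) e f(2) by blast
      ultimately have "e' x - e (f (e x) - y) \<in> W1"
        by (rule vec.subspace_diff [OF s1(2)])
      moreover have "e' x - e (f (e x) - y) = e y - l *s e x"
        by (simp add: e'_def clinear_simps [OF linE [OF e]] vec.scale_minus_left)
      ultimately show False
        using no by metis
    qed
    then have "Q e'"
      using e' x(1) by (auto simp: Q_def)
    define K where "K = {z \<in> R e. G z \<in> W1}"
    have K: "vec.subspace K"
      using vec.subspace_0 [OF subR] vec.subspace_0 [OF s1(2)]
      by (auto simp: K_def vec.subspace_def [of "{z \<in> R e. G z \<in> W1}"] clinear_simps [OF G]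
          intro: vec.subspace_add [OF subR] vec.subspace_scale [OF subR]
          vec.subspace_add [OF s1(2)] vec.subspace_scale [OF s1(2)])
    have "W1 \<subseteq> K"
      using W1R TW s1(2) by (auto simp: K_def G_def intro!: vec.subspace_diff vec.subspace_scale)
    moreover have "v \<in> K"
      using lv by (simp add: K_def G_def)
    ultimately have "dim W1 < dim K"
      using lv(2) K s1(2) by (intro dim_less_if_proper csubspace_imp_subspace) auto
    moreover have "dim {G z + u |z u. z \<in> R e \<and> u \<in> W1} + dim K \<le> dim (R e) + dim W1"
      by (intro dim_image_sum_le clinear_imp_linear G csubspace_imp_subspace subR s1(2) K) (auto simp: K_def)
    ultimately have "dim {G z + u |z u. z \<in> R e \<and> u \<in> W1} < dim (R e)"
      by linarith
    moreover have "R e' \<subseteq> {G z + u |z u. z \<in> R e \<and> u \<in> W1}"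
      using eR unfolding fun_cong [OF R_def, of e'] e'G by blast
    ultimately have "dim (R e') < dim (R e)"
      using dim_subset le_less_trans by blast
    then show False
      using least [OF \<open>Q e'\<close>] by simp
  qed
  then show thesis
    using that [of e "e x" x] e x s0(5) by blast
qed

text \<open>If an element of greatest rank killed a vector \<open>x\<close>, its range would be
  proper because both spaces have the same dimension.  Adding a
  rank-one element that sends \<open>x\<close> outside that range would increase the rank.\<close>

lemma E_injective_on_subquotient: "\<exists>e\<in>E. inj_modulo e V0 V1 W1"
proof -
  note s0 = stableD [OF stable0] and s1 = stableD [OF stable1]
  define K where "K = (\<lambda>e. {x \<in> V0. e x \<in> W1})"
  obtain e where e: "e \<in> E" and least: "\<And>e'. e' \<in> E \<Longrightarrow> dim (K e) \<le> dim (K e')"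
    using ex_has_least_nat [of "\<lambda>e. e \<in> E" _ "\<lambda>e. dim (K e)"] E_nonempty by blast
  have subK: "vec.subspace (K e)" if "e \<in> E" for e
    using vec.subspace_0 [OF s0(1)] vec.subspace_0 [OF s1(2)]
    by (auto simp: K_def vec.subspace_def [of "{z \<in> _. _ z}"] clinear_simps [OF linE [OF that]]
        intro: vec.subspace_add [OF s0(1)] vec.subspace_scale [OF s0(1)]
        vec.subspace_add [OF s1(2)] vec.subspace_scale [OF s1(2)])
  have "K e \<subseteq> V1"
  proof (rule ccontr)
    assume "\<not> K e \<subseteq> V1"
    then obtain x where x: "x \<in> V0" "e x \<in> W1" "x \<notin> V1"
      by (auto simp: K_def)
    have "V1 \<subseteq> K e"
      using VV s1(5) e by (auto simp: K_def)
    then have "dim V1 < dim (K e)"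
      using x by (intro dim_less_if_proper csubspace_imp_subspace s1(1) subK e) (auto simp: K_def)
    moreover have "dim {e x + u |x u. x \<in> V0 \<and> u \<in> W1} + dim (K e) \<le> dim V0 + dim W1"
      by (intro dim_image_sum_le clinear_imp_linear linE e csubspace_imp_subspace subK s0 s1) (auto simp: K_def)
    ultimately have "dim {e x + u |x u. x \<in> V0 \<and> u \<in> W1} < dim W0"
      using stable_dim_eq [OF stable0] stable_dim_eq [OF stable1] by simp
    then have "\<not> W0 \<subseteq> {e x + u |x u. x \<in> V0 \<and> u \<in> W1}"
      using dim_subset not_less by blast
    then obtain w where w: "w \<in> W0" "\<And>z u. z \<in> V0 \<Longrightarrow> u \<in> W1 \<Longrightarrow> w \<noteq> e z + u"
      by blast
    have "w \<notin> W1"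
      using w(2) [of 0 w] vec.subspace_0 [OF s0(1)] clinear_simps(3) [OF linE [OF e]] by auto
    \<comment> \<open>a rank-one element of \<open>E\<close> that sends \<open>x\<close> to a nonzero multiple of \<open>w\<close>\<close>
    obtain r v y where r: "r \<in> E" "v \<in> W0" "v \<notin> W1" "y \<in> V0" "r y \<notin> W1" "\<And>x. x \<in> V0 \<Longrightarrow> \<exists>c. r x - c *s v \<in> W1"
      using rank_one_exists by metis
    obtain g where g: "g \<in> E" "g x - w \<in> W1"
      using E_transitive [OF x(1,3) w(1)] by blast
    have "g x \<notin> W1"
      using g(2) \<open>w \<notin> W1\<close> vec.subspace_diff [OF s1(2), of "g x" "g x - w"] by auto
    moreover have "g x \<in> W0"
      using g(1) x(1) s0(5) by blast
    ultimately obtain f where f: "f \<in> F" "f (g x) - y \<in> V1"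
      using F_transitive r(4) by blast
    obtain h where h: "h \<in> F" "h v - x \<in> V1"
      using F_transitive [OF r(2,3) x(1)] by blast
    define e0 where "e0 = (\<lambda>z. g (h (r (f (g z)))))"
    have e0: "e0 \<in> E"
      unfolding e0_def using EFE [OF g(1) h(1) EFE [OF r(1) f(1) g(1)]] .
    note lin = clinear_simps [OF linE [OF g(1)]] clinear_simps [OF linE [OF r(1)]]
      clinear_simps [OF linF [OF f(1)]] clinear_simps [OF linF [OF h(1)]]
    have ghv: "g (h v) - w \<in> W1"
    proof -
      have "g (h v - x) + (g x - w) \<in> W1"
        using s1(5) g h(2) vec.subspace_add [OF s1(2)] by blast
      then show ?thesis
        by (simp add: lin)
    qed
    have e0_rank: "e0 z - c *s w \<in> W1" if "r (f (g z)) - c *s v \<in> W1" for c z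
    proof -
      have "g (h (r (f (g z)) - c *s v)) + c *s (g (h v) - w) \<in> W1"
        using s1(5,6) g(1) h(1) that ghv vec.subspace_add [OF s1(2)] vec.subspace_scale [OF s1(2)] by blast
      then show ?thesis
        by (simp add: e0_def lin vec.scale_right_diff_distrib)
    qed
    have "e0 x \<notin> W1"
    proof
      assume bad: "e0 x \<in> W1"
      have "f (g x) \<in> V0"
        using g(1) f(1) x(1) s0 by blast
      then obtain c where c: "r (f (g x)) - c *s v \<in> W1"
        using r(6) by blast
      have "c *s w \<in> W1"
        using vec.subspace_diff [OF s1(2) bad e0_rank [OF c]] by simp
      then have "c = 0"
        using \<open>w \<notin> W1\<close> vec.subspace_scale [OF s1(2), of "c *s w" "1 / c"] by (cases "c = 0") auto
      then have "r (f (g x)) \<in> W1"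
        using c by simp
      moreover have "r (f (g x) - y) \<in> W1"
        using s1(5) r(1) f(2) by blast
      ultimately have "r (f (g x)) - r (f (g x) - y) \<in> W1"
        by (rule vec.subspace_diff [OF s1(2)])
      then show False
        using r(5) by (simp add: lin)
    qed
    define e' where "e' = (\<lambda>z. e z + e0 z)"
    have e': "e' \<in> E"
      unfolding e'_def by (rule E_add [OF e e0])
    have "K e' \<subseteq> K e"
    proof
      fix z assume "z \<in> K e'"
      then have z: "z \<in> V0" "e z + e0 z \<in> W1"
        by (auto simp: K_def e'_def)
      have "f (g z) \<in> V0"
        using g(1) f(1) z(1) s0 by blast
      then obtain c where c: "e0 z - c *s w \<in> W1"
        using r(6) e0_rank by blast
      then have *: "e z + c *s w \<in> W1"
        using vec.subspace_diff [OF s1(2) z(2) c] by simp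
      have "c = 0"
      proof (rule ccontr)
        assume "c \<noteq> 0"
        have "(1 / c) *s (e z + c *s w) \<in> W1" "- (1 / c) *s z \<in> V0"
          using * z(1) vec.subspace_scale s0(1) s1(2) by blast+
        moreover have "w = e (- (1 / c) *s z) + (1 / c) *s (e z + c *s w)"
          using \<open>c \<noteq> 0\<close> by (simp add: clinear_simps [OF linE [OF e]] vec.scale_right_distrib vec.scale_minus_left)
        ultimately show False
          using w(2) by blast
      qed
      then show "z \<in> K e"
        using * z(1) by (simp add: K_def)
    qed
    moreover have "x \<in> K e" "x \<notin> K e'"
    proof -
      show "x \<in> K e"
        using x by (simp add: K_def)
      show "x \<notin> K e'"
        using x(2) \<open>e0 x \<notin> W1\<close> vec.subspace_diff [OF s1(2), of "e' x" "e x"] by (auto simp: K_def e'_def)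
    qed
    ultimately have "dim (K e') < dim (K e)"
      by (intro dim_less_if_proper csubspace_imp_subspace subK e e') blast
    then show False
      using least [OF e'] by simp
  qed
  then show ?thesis
    using e by (auto simp: K_def inj_modulo_def)
qed

end

context intertwiners
begin

text \<open>Induction along a composition series.  Injectivity of \<open>e\<^sub>1 + t e\<^sub>2\<close> is governed by \<open>e\<^sub>1\<close> on the lower
  subquotient, and after division by \<open>t\<close> by \<open>e\<^sub>2\<close> on the upper one; each excludes finitely many \<open>t\<close>.\<close>

lemma E_injective_between:
  assumes "stable V0 W0" "stable V1 W1" "V1 \<subseteq> V0" "W1 \<subseteq> W0"
  shows "\<exists>e\<in>E. inj_modulo e V0 V1 W1"
  using assms
proof (induction "dim V0 - dim V1" arbitrary: V0 W0 V1 W1 rule: less_induct)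
  case less
  note s0 = stableD [OF less.prems(1)] and s1 = stableD [OF less.prems(2)]
  show ?case
  proof (cases "V1 = V0 \<or> W1 = W0")
    case True
    then have "V1 = V0"
      using stable_eqI(1) [of V1 W1 V0 W0] less.prems by blast
    then show ?thesis
      using E_nonempty by (auto simp: inj_modulo_def)
  next
    case neq: False
    show ?thesis
    proof (cases "\<exists>V W. stable V W \<and> V1 \<subseteq> V \<and> V \<subseteq> V0 \<and> W1 \<subseteq> W \<and> W \<subseteq> W0
        \<and> \<not> (V = V1 \<and> W = W1) \<and> \<not> (V = V0 \<and> W = W0)")
      case False
      interpret simple_subquotient E F V0 W0 V1 W1
        by unfold_locales (use less.prems neq False in auto)
      show ?thesis
        by (rule E_injective_on_subquotient)
    next
      case True
      then obtain V W where VW: "stable V W" "V1 \<subseteq> V" "V \<subseteq> V0" "W1 \<subseteq> W" "W \<subseteq> W0"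
        "\<not> (V = V1 \<and> W = W1)" "\<not> (V = V0 \<and> W = W0)"
        by blast
      note s = stableD [OF VW(1)]
      have "V \<noteq> V1" "V \<noteq> V0"
        using stable_eqI [OF less.prems(2) VW(1)] stable_eqI [OF VW(1) less.prems(1)] VW by blast+
      then have dims: "dim V1 < dim V" "dim V < dim V0"
        using VW s s0 s1 by (auto intro!: dim_less_if_proper)
      obtain e1 where e1: "e1 \<in> E" "inj_modulo e1 V V1 W1"
        using less.hyps [OF diff_less_mono VW(1) less.prems(2) VW(2,4)] dims by auto
      obtain e2 where e2: "e2 \<in> E" "inj_modulo e2 V0 V W"
        using less.hyps [OF diff_less_mono2 less.prems(1) VW(1,3,5)] dims by auto
      have "finite {t. \<not> inj_modulo (\<lambda>x. e1 x + t *s e2 x) V V1 W1}" (is "finite ?B1")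
        by (rule pencil_finite_exceptions) (use e1 e2 linE s s1 in auto)
      moreover have "finite {t. \<not> inj_modulo (\<lambda>x. e2 x + t *s e1 x) V0 V W}" (is "finite ?B2")
        by (rule pencil_finite_exceptions) (use e1 e2 linE s s0 in auto)
      ultimately have "finite (insert 0 (?B1 \<union> inverse ` ?B2))"
        by blast
      then obtain t where t: "t \<notin> insert 0 (?B1 \<union> inverse ` ?B2)"
        using ex_new_if_finite [OF infinite_UNIV_char_0] by blast
      define e where "e = (\<lambda>x. e1 x + t *s e2 x)"
      have "inverse t \<notin> ?B2"
      proof
        assume "inverse t \<in> ?B2"
        then have "inverse (inverse t) \<in> inverse ` ?B2"
          by (rule imageI)
        then show False
          using t by simp
      qed
      then have i2: "inj_modulo (\<lambda>x. e2 x + inverse t *s e1 x) V0 V W"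
        by simp
      have i1: "inj_modulo e V V1 W1"
        using t by (simp add: e_def)
      have "inj_modulo e V0 V1 W1"
        unfolding inj_modulo_def
      proof (intro ballI impI)
        fix x assume x: "x \<in> V0" "e x \<in> W1"
        then have "inverse t *s e x \<in> W"
          using VW(4) s(2) vec.subspace_scale by blast
        moreover have "inverse t *s e x = e2 x + inverse t *s e1 x"
          using t by (simp add: e_def vec.scale_right_distrib add.commute)
        ultimately have "x \<in> V"
          using i2 x(1) by (simp add: inj_modulo_def)
        then show "x \<in> V1"
          using i1 x(2) by (simp add: inj_modulo_def)
      qed
      moreover have "e \<in> E"
        unfolding e_def by (rule E_add [OF e1(1) E_scale [OF e2(1)]])
      ultimately show ?thesis
        by blast
    qed
  qed
qed

theorem E_contains_injective: "\<exists>e\<in>E. inj e"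
proof -
  have "stable UNIV UNIV" "stable {0} {0}"
    by (auto simp: stable_def vec.subspace_UNIV vec.subspace_single_0
        linE [THEN clinear_simps(3)] linF [THEN clinear_simps(3)])
  then obtain e where e: "e \<in> E" "inj_modulo e UNIV {0} {0}"
    using E_injective_between by blast
  have "inj e"
  proof (rule injI)
    fix x y assume "e x = e y"
    then have "e (x - y) = 0"
      by (simp add: clinear_simps [OF linE [OF e(1)]])
    then have "x - y = 0"
      using e(2) unfolding inj_modulo_def by blast
    then show "x = y"
      by simp
  qed
  with e(1) show ?thesis by blast
qed

end

section \<open>Patching intertwiners over the spectrum\<close>

lemma mat_times_index:
  assumes "P \<in> carrier_mat n n" "Q \<in> carrier_mat n n" "i < n" "j < n"
  shows "(P * Q) $$ (i, j) = (\<Sum>k<n. P $$ (i, k) * Q $$ (k, j))"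
  using assms by (auto simp: scalar_prod_def lessThan_atLeast0 intro!: sum.cong)

text \<open>The finite type \<open>'n\<close> serves as index set of the matrices, matched with \<open>{..<n}\<close> by \<open>\<sigma>\<close>, so that
  fibres are elements of \<open>complex ^ 'n ^ 'n\<close> with its determinants and dimension theory.\<close>

locale fibred_algebra = N: abelian_vn N + M: vn_algebra M
  for N :: "'k::complex_hilbert_space bop set" and M :: "'h::complex_hilbert_space bop set" +
  fixes \<phi> :: "'h bop \<Rightarrow> 'k bop mat" and n :: nat and \<sigma> :: "'n::finite \<Rightarrow> nat"
  assumes iso: "star_isomorphism_mat n M N \<phi>" and \<sigma>: "bij_betw \<sigma> UNIV {..<n}"
begin

definition entry :: "'h bop \<Rightarrow> 'n \<Rightarrow> 'n \<Rightarrow> 'k bop"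
  where "entry T i j = \<phi> T $$ (\<sigma> i, \<sigma> j)"

definition fibre :: "'k bop set \<Rightarrow> 'h bop \<Rightarrow> complex ^ 'n ^ 'n"
  where "fibre U T = (\<chi> i j. N.eval_at U (entry T i j))"

lemma \<sigma>_less: "\<sigma> i < n"
  using \<sigma> by (auto simp: bij_betw_def)

lemma \<phi>_mem: "T \<in> M \<Longrightarrow> \<phi> T \<in> matrix_algebra n N"
  using iso by (auto simp: star_isomorphism_mat_def bij_betw_def)

lemma \<phi>_carrier: "T \<in> M \<Longrightarrow> \<phi> T \<in> carrier_mat n n"
  using \<phi>_mem by (auto simp: matrix_algebra_def)

lemma entry_mem: "T \<in> M \<Longrightarrow> entry T i j \<in> N"
  using \<phi>_mem \<sigma>_less by (auto simp: entry_def matrix_algebra_def)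

lemma entries_realized:
  assumes "\<And>i j. a i j \<in> N"
  obtains T where "T \<in> M" "\<And>i j. entry T i j = a i j"
proof -
  define P where "P = Matrix.mat n n (\<lambda>(r, c). a (inv_into UNIV \<sigma> r) (inv_into UNIV \<sigma> c))"
  have "P \<in> matrix_algebra n N"
    using assms by (auto simp: P_def matrix_algebra_def)
  then have "P \<in> \<phi> ` M"
    using iso by (simp add: star_isomorphism_mat_def bij_betw_def)
  then obtain T where T: "T \<in> M" "\<phi> T = P"
    by blast
  have "inj \<sigma>"
    using \<sigma> by (auto simp: bij_betw_def)
  then have "entry T i j = a i j" for i j
    using \<sigma>_less by (simp add: entry_def T(2) P_def)
  with T(1) show thesis
    by (rule that)
qed

lemma entries_determine:
  assumes "S \<in> M" "T \<in> M" "\<And>i j. entry S i j = entry T i j"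
  shows "S = T"
proof -
  have surj: "\<exists>i. \<sigma> i = r" if "r < n" for r
    using that \<sigma> unfolding bij_betw_def by (metis imageE lessThan_iff)
  have "\<phi> S = \<phi> T"
  proof (rule eq_matI)
    fix r c assume "r < dim_row (\<phi> T)" "c < dim_col (\<phi> T)"
    then have "r < n" "c < n"
      using \<phi>_carrier [OF assms(2)] by auto
    then obtain i j where "\<sigma> i = r" "\<sigma> j = c"
      using surj by meson
    then show "\<phi> S $$ (r, c) = \<phi> T $$ (r, c)"
      using assms(3) [of i j] by (simp add: entry_def)
  qed (use \<phi>_carrier assms(1,2) in auto)
  moreover have "inj_on \<phi> M"
    using iso by (simp add: star_isomorphism_mat_def bij_betw_def)
  ultimately show ?thesis
    using assms(1,2) by (auto dest: inj_onD)
qed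

lemma fibre_determines:
  assumes "S \<in> M" "T \<in> M" "\<And>U. N.ultrafilter U \<Longrightarrow> fibre U S = fibre U T"
  shows "S = T"
proof (rule entries_determine [OF assms(1,2)])
  fix i j
  have "entry S i j + (-1) *\<^sub>C entry T i j = 0"
  proof (rule N.eq_zero_if_eval_at_zero)
    show "entry S i j + (-1) *\<^sub>C entry T i j \<in> N"
      using assms by (intro N.add_mem N.scaleC_mem entry_mem)
    fix U assume U: "N.ultrafilter U"
    have "N.eval_at U (entry S i j) = N.eval_at U (entry T i j)"
      using assms(3) [OF U] by (simp add: fibre_def vec_eq_iff)
    then show "N.eval_at U (entry S i j + (-1) *\<^sub>C entry T i j) = 0"
      using assms(1,2) U by (simp add: N.eval_at_add N.eval_at_scaleC N.scaleC_mem entry_mem)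
  qed
  then have "bop_apply (entry S i j + (-1) *\<^sub>C entry T i j) x = 0" for x
    by simp
  then show "entry S i j = entry T i j"
    by (intro bop_eqI) simp
qed

lemma entry_add: "S \<in> M \<Longrightarrow> T \<in> M \<Longrightarrow> entry (S + T) i j = entry S i j + entry T i j"
  using iso \<sigma>_less \<phi>_carrier [of T] by (auto simp: entry_def star_isomorphism_mat_def)

lemma entry_scaleC: "T \<in> M \<Longrightarrow> entry (c *\<^sub>C T) i j = c *\<^sub>C entry T i j"
  using iso \<sigma>_less \<phi>_carrier [of T] by (auto simp: entry_def star_isomorphism_mat_def)

lemma entry_times:
  assumes "S \<in> M" "T \<in> M"
  shows "entry (S * T) i j = (\<Sum>k\<in>UNIV. entry S i k * entry T k j)"
proof -
  have "entry (S * T) i j = (\<Sum>k<n. \<phi> S $$ (\<sigma> i, k) * \<phi> T $$ (k, \<sigma> j))"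
    using iso assms \<phi>_carrier \<sigma>_less by (auto simp: entry_def star_isomorphism_mat_def mat_times_index)
  also have "\<dots> = (\<Sum>k\<in>UNIV. entry S i k * entry T k j)"
    using sum.reindex_bij_betw [OF \<sigma>, of "\<lambda>k. \<phi> S $$ (\<sigma> i, k) * \<phi> T $$ (k, \<sigma> j)"] by (simp add: entry_def)
  finally show ?thesis .
qed

context
  fixes U assumes U: "N.ultrafilter U"
begin

lemma eval_at_sum:
  "finite I \<Longrightarrow> (\<And>i. i \<in> I \<Longrightarrow> a i \<in> N) \<Longrightarrow>
    (\<Sum>i\<in>I. a i) \<in> N \<and> N.eval_at U (\<Sum>i\<in>I. a i) = (\<Sum>i\<in>I. N.eval_at U (a i))"
  by (induction I rule: finite_induct)
    (auto simp: N.eval_at_zero [OF U] N.eval_at_add [OF U] intro: N.add_mem)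

lemma fibre_add: "S \<in> M \<Longrightarrow> T \<in> M \<Longrightarrow> fibre U (S + T) = fibre U S + fibre U T"
  by (simp add: fibre_def vec_eq_iff entry_add N.eval_at_add [OF U] entry_mem)

lemma fibre_scaleC: "T \<in> M \<Longrightarrow> fibre U (c *\<^sub>C T) = Finite_Cartesian_Product.mat c ** fibre U T"
  by (simp add: fibre_def vec_eq_iff entry_scaleC N.eval_at_scaleC [OF U] entry_mem
      Finite_Cartesian_Product.mat_def matrix_matrix_mult_def if_distrib [of "\<lambda>x. x * _"] cong: if_cong)

lemma fibre_times: "S \<in> M \<Longrightarrow> T \<in> M \<Longrightarrow> fibre U (S * T) = fibre U S ** fibre U T"
  by (simp add: fibre_def vec_eq_iff entry_times matrix_matrix_mult_def eval_at_sum N.times_mem entry_mem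
      N.eval_at_times [OF U])

lemma fibre_one: "fibre U 1 = Finite_Cartesian_Product.mat 1"
proof -
  \<comment> \<open>A multiplicative surjection is unital: compare \<open>1\<close> with a preimage of the identity matrix.\<close>
  obtain T where T: "T \<in> M" "\<And>i j. entry T i j = (if i = j then 1 else 0)"
    by (rule entries_realized [of "\<lambda>i j. if i = j then 1 else 0"]) auto
  have "fibre U T = Finite_Cartesian_Product.mat 1"
    by (simp add: fibre_def vec_eq_iff T(2) Finite_Cartesian_Product.mat_def N.eval_at_one [OF U] N.eval_at_zero [OF U])
  moreover have "fibre U (1 * T) = fibre U 1 ** fibre U T"
    by (intro fibre_times M.one_mem T)
  ultimately show ?thesis
    by simp
qed

end

text \<open>The image of the Gelfand transform.  Closure under the operations below places determinants in it.\<close>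

definition sections :: "('k bop set \<Rightarrow> complex) set"
  where "sections = {g. \<exists>a\<in>N. \<forall>U. N.ultrafilter U \<longrightarrow> g U = N.eval_at U a}"

lemma sectionsI: "a \<in> N \<Longrightarrow> (\<And>U. N.ultrafilter U \<Longrightarrow> g U = N.eval_at U a) \<Longrightarrow> g \<in> sections"
  by (auto simp: sections_def)

lemma sections_const: "(\<lambda>U. c) \<in> sections"
  by (rule sectionsI [of "c *\<^sub>C 1"]) (simp_all add: N.scaleC_mem N.eval_at_scaleC N.eval_at_one)

lemma sections_add: "f \<in> sections \<Longrightarrow> g \<in> sections \<Longrightarrow> (\<lambda>U. f U + g U) \<in> sections"
  unfolding sections_def by (clarsimp, metis N.add_mem N.eval_at_add)

lemma sections_times: "f \<in> sections \<Longrightarrow> g \<in> sections \<Longrightarrow> (\<lambda>U. f U * g U) \<in> sections"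
  unfolding sections_def by (clarsimp, metis N.times_mem N.eval_at_times)

lemma sections_sum: "finite I \<Longrightarrow> (\<And>i. i \<in> I \<Longrightarrow> f i \<in> sections) \<Longrightarrow> (\<lambda>U. \<Sum>i\<in>I. f i U) \<in> sections"
  by (induction I rule: finite_induct) (auto intro: sections_const sections_add)

lemma sections_prod: "finite I \<Longrightarrow> (\<And>i. i \<in> I \<Longrightarrow> f i \<in> sections) \<Longrightarrow> (\<lambda>U. \<Prod>i\<in>I. f i U) \<in> sections"
  by (induction I rule: finite_induct) (auto intro: sections_const sections_times)

lemma sections_det:
  fixes a :: "'m::finite \<Rightarrow> 'm \<Rightarrow> 'k bop set \<Rightarrow> complex"
  assumes "\<And>i j. a i j \<in> sections"
  shows "(\<lambda>U. det (\<chi> i j. a i j U)) \<in> sections"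
  unfolding det_def using assms
  by (auto intro!: sections_sum sections_prod sections_times [OF sections_const] simp: finite_permutations)

lemma sections_fibre: "T \<in> M \<Longrightarrow> (\<lambda>U. fibre U T $ i $ j) \<in> sections"
  by (rule sectionsI [of "entry T i j"]) (simp_all add: entry_mem fibre_def)

lemma sections_det_fibre: "T \<in> M \<Longrightarrow> (\<lambda>U. det (fibre U T)) \<in> sections"
  using sections_det [of "\<lambda>i j U. fibre U T $ i $ j"] sections_fibre by simp

lemma sections_realized:
  assumes "\<And>i j. (\<lambda>U. H U $ i $ j) \<in> sections"
  obtains T where "T \<in> M" "\<And>U. N.ultrafilter U \<Longrightarrow> fibre U T = H U"
proof -
  obtain a where a: "\<And>i j. a i j \<in> N" "\<And>i j U. N.ultrafilter U \<Longrightarrow> H U $ i $ j = N.eval_at U (a i j)"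
    using assms unfolding sections_def mem_Collect_eq Bex_def by metis
  obtain T where T: "T \<in> M" "\<And>i j. entry T i j = a i j"
    using entries_realized a(1) by blast
  show thesis
    by (rule that [OF T(1)]) (simp add: fibre_def T(2) a(2) vec_eq_iff)
qed

text \<open>Cramer's rule expresses the inverse by determinants and the reciprocal of one
  determinant, which is a section because it vanishes nowhere.\<close>

lemma invertible_if_fibres_invertible:
  assumes T: "T \<in> M" and nz: "\<And>U. N.ultrafilter U \<Longrightarrow> det (fibre U T) \<noteq> 0"
  obtains S where "S \<in> M" "T * S = 1" "S * T = 1"
proof -
  obtain d where d: "d \<in> N" "\<And>U. N.ultrafilter U \<Longrightarrow> det (fibre U T) = N.eval_at U d"
    using sections_det_fibre [OF T] by (auto simp: sections_def)
  obtain b where b: "b \<in> N" "d * b = 1"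
    using N.invertible_if_eval_at_nonzero [OF d(1)] nz d(2) by metis
  have db: "N.eval_at U b = 1 / det (fibre U T)" if "N.ultrafilter U" for U
    using N.eval_at_times [OF that d(1) b(1)] b(2) N.eval_at_one [OF that] d(2) [OF that] nz [OF that]
    by (simp add: field_simps)
  define H :: "'k bop set \<Rightarrow> complex ^ 'n ^ 'n" where
    "H U = (\<chi> k i. det (\<chi> r c. if c = k then axis i 1 $ r else fibre U T $ r $ c) * N.eval_at U b)" for U
  have inv: "fibre U T ** H U = Finite_Cartesian_Product.mat 1" if U: "N.ultrafilter U" for U
  proof -
    have "fibre U T *v (\<chi> k. H U $ k $ i) = axis i 1" for i
      using cramer [OF nz [OF U], of "\<chi> k. H U $ k $ i" "axis i 1"] by (simp add: H_def db [OF U])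
    then have "(\<Sum>k\<in>UNIV. fibre U T $ j $ k * H U $ k $ i) = axis i 1 $ j" for i j
      by (simp add: matrix_vector_mult_def vec_eq_iff)
    then show ?thesis
      by (auto simp: vec_eq_iff matrix_matrix_mult_def Finite_Cartesian_Product.mat_def axis_def)
  qed
  have "(\<lambda>U. if c = k then axis i 1 $ r else fibre U T $ r $ c) \<in> sections" for i k r c
    using sections_fibre [OF T] sections_const by (cases "c = k") auto
  then have "(\<lambda>U. H U $ k $ i) \<in> sections" for k i
    unfolding H_def using b(1) by (auto intro!: sections_times sections_det intro: sectionsI)
  then obtain S where S: "S \<in> M" "\<And>U. N.ultrafilter U \<Longrightarrow> fibre U S = H U"
    using sections_realized [of H] by blast
  show thesis
  proof (rule that [OF S(1)])
    show "T * S = 1"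
      using T S inv by (intro fibre_determines) (simp_all add: M.times_mem fibre_times fibre_one)
    show "S * T = 1"
      using T S inv [THEN matrix_left_right_inverse [THEN iffD1]]
      by (intro fibre_determines) (simp_all add: M.times_mem fibre_times fibre_one)
  qed
qed

definition intertwining :: "'h bop \<Rightarrow> 'h bop \<Rightarrow> 'h bop set"
  where "intertwining A B = {T \<in> M. T * A = B * T}"

lemma intertwining_add: "S \<in> intertwining A B \<Longrightarrow> T \<in> intertwining A B \<Longrightarrow> S + T \<in> intertwining A B"
  by (simp add: intertwining_def M.add_mem distrib_left distrib_right)

lemma intertwining_times: "S \<in> intertwining B C \<Longrightarrow> T \<in> intertwining A B \<Longrightarrow> S * T \<in> intertwining A C"
  unfolding intertwining_def by (clarsimp simp: M.times_mem) (metis mult.assoc)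

lemma intertwining_scaleC:
  assumes "T \<in> intertwining A B"
  shows "c *\<^sub>C T \<in> intertwining A B"
proof -
  have "(c *\<^sub>C T) * A = c *\<^sub>C (T * A)" "B * (c *\<^sub>C T) = c *\<^sub>C (B * T)"
    by (rule bop_eqI, simp add: bop_linear)+
  then show ?thesis
    using assms by (simp add: intertwining_def M.scaleC_mem)
qed

lemma central_element:
  assumes "e \<in> N"
  obtains z where "z \<in> M" "\<And>T. T \<in> M \<Longrightarrow> z * T = T * z"
    "\<And>U T. N.ultrafilter U \<Longrightarrow> T \<in> M \<Longrightarrow> fibre U (z * T) = Finite_Cartesian_Product.mat (N.eval_at U e) ** fibre U T"
proof -
  obtain z where z: "z \<in> M" "\<And>i j. entry z i j = (if i = j then e else 0)"
    by (rule entries_realized [of "\<lambda>i j. if i = j then e else 0"]) (auto simp: assms)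
  have fz: "fibre U z = Finite_Cartesian_Product.mat (N.eval_at U e)" if "N.ultrafilter U" for U
    using N.eval_at_zero [OF that] by (simp add: fibre_def z(2) Finite_Cartesian_Product.mat_def vec_eq_iff)
  have "Finite_Cartesian_Product.mat c ** G = G ** Finite_Cartesian_Product.mat c" for c :: complex and G :: "complex ^ 'n ^ 'n"
    by (simp add: vec_eq_iff matrix_matrix_mult_def Finite_Cartesian_Product.mat_def
        if_distrib [of "\<lambda>x. x * _"] if_distrib [of "\<lambda>x. _ * x"] mult.commute cong: if_cong)
  then have "z * T = T * z" if "T \<in> M" for T
    using that z(1) by (intro fibre_determines M.times_mem) (simp_all add: fibre_times fz)
  moreover have "fibre U (z * T) = Finite_Cartesian_Product.mat (N.eval_at U e) ** fibre U T"
    if "N.ultrafilter U" "T \<in> M" for U T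
    using that z(1) by (simp add: fibre_times fz)
  ultimately show thesis
    using z(1) that by blast
qed

text \<open>Invertibility of a fibre persists on a member of the ultrafilter, where the determinant is
  invertible.  Intertwiners are cut down by the central elements that belong to projections and added up.\<close>

lemma intertwiner_patching:
  assumes local: "\<And>U. N.ultrafilter U \<Longrightarrow> \<exists>T\<in>intertwining A B. det (fibre U T) \<noteq> 0"
    and AB: "A \<in> M" "B \<in> M"
  obtains T where "T \<in> intertwining A B" "\<And>U. N.ultrafilter U \<Longrightarrow> det (fibre U T) \<noteq> 0"
proof -
  define Q where "Q e \<longleftrightarrow> (\<exists>T\<in>intertwining A B. \<forall>U. N.ultrafilter U \<longrightarrow> e \<in> U \<longrightarrow> det (fibre U T) \<noteq> 0)" for e
  have "Q 1"
  proof (rule N.local_to_global [of Q])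
    have "0 \<in> intertwining A B"
      by (simp add: intertwining_def)
    then show "Q 0"
      using N.ultrafilterD(2) by (auto simp: Q_def)
  next
    fix e f assume ef: "e \<in> projections N" "f \<in> projections N" "Q e"
    have "e \<in> U" if "N.ultrafilter U" "e * f \<in> U" for U
    proof -
      have "N.eval_at U e * N.eval_at U f = 1"
        using N.eval_at_times [OF that(1)] N.eval_at_projection(1) [OF that(1) N.times_projection [OF ef(1,2)]]
          that(2) ef N.projectionD(1) by metis
      then show ?thesis
        using N.eval_at_projection [OF that(1) ef(1)] by auto
    qed
    then show "Q (e * f)"
      using ef(3) unfolding Q_def by blast
  next
    fix e f assume ef: "e \<in> projections N" "f \<in> projections N" "e * f = 0" "Q e" "Q f"
    then obtain S T where S: "S \<in> intertwining A B" "\<And>U. N.ultrafilter U \<Longrightarrow> e \<in> U \<Longrightarrow> det (fibre U S) \<noteq> 0"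
      and T: "T \<in> intertwining A B" "\<And>U. N.ultrafilter U \<Longrightarrow> f \<in> U \<Longrightarrow> det (fibre U T) \<noteq> 0"
      unfolding Q_def by blast
    have STM: "S \<in> M" "T \<in> M"
      using S T by (auto simp: intertwining_def)
    have efN: "e \<in> N" "f \<in> N"
      using ef N.projectionD(1) by auto
    obtain z where z: "z \<in> M" "\<And>T. T \<in> M \<Longrightarrow> z * T = T * z"
      "\<And>U T. N.ultrafilter U \<Longrightarrow> T \<in> M \<Longrightarrow> fibre U (z * T) = Finite_Cartesian_Product.mat (N.eval_at U e) ** fibre U T"
      using central_element [OF efN(1)] by metis
    obtain w where w: "w \<in> M" "\<And>T. T \<in> M \<Longrightarrow> w * T = T * w"
      "\<And>U T. N.ultrafilter U \<Longrightarrow> T \<in> M \<Longrightarrow> fibre U (w * T) = Finite_Cartesian_Product.mat (N.eval_at U f) ** fibre U T"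
      using central_element [OF efN(2)] by metis
    have "z \<in> intertwining B B" "w \<in> intertwining B B"
      using z w AB by (simp_all add: intertwining_def)
    then have "z * S + w * T \<in> intertwining A B"
      using S T by (intro intertwining_add intertwining_times)
    moreover have "det (fibre U (z * S + w * T)) \<noteq> 0" if U: "N.ultrafilter U" "e + f \<in> U" for U
    proof -
      have "N.eval_at U (e * f) = N.eval_at U e * N.eval_at U f" "N.eval_at U (e + f) = N.eval_at U e + N.eval_at U f"
        using efN U by (simp_all add: N.eval_at_times N.eval_at_add)
      moreover have "N.eval_at U (e + f) = 1"
        using U by (intro N.eval_at_eqI N.near_member)
      ultimately consider "N.eval_at U e = 1" "N.eval_at U f = 0" | "N.eval_at U e = 0" "N.eval_at U f = 1"
        using ef(3) N.eval_at_zero [OF U(1)] by force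
      then show ?thesis
      proof cases
        case 1
        then have "fibre U (z * S + w * T) = fibre U S"
          using z w STM U(1) by (simp add: fibre_add M.times_mem matrix_mul_lid Finite_Cartesian_Product.mat_0)
        then show ?thesis
          using S(2) [OF U(1)] 1 N.eval_at_projection(1) [OF U(1) ef(1)] by simp
      next
        case 2
        then have "fibre U (z * S + w * T) = fibre U T"
          using z w STM U(1) by (simp add: fibre_add M.times_mem matrix_mul_lid Finite_Cartesian_Product.mat_0)
        then show ?thesis
          using T(2) [OF U(1)] 2 N.eval_at_projection(1) [OF U(1) ef(2)] by simp
      qed
    qed
    ultimately show "Q (e + f)"
      unfolding Q_def by blast
  next
    fix U assume U: "N.ultrafilter U"
    then obtain T where T: "T \<in> intertwining A B" "det (fibre U T) \<noteq> 0"
      using local by blast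
    then have "T \<in> M"
      by (simp add: intertwining_def)
    then obtain d where d: "d \<in> N" "\<And>U. N.ultrafilter U \<Longrightarrow> det (fibre U T) = N.eval_at U d"
      using sections_det_fibre by (auto simp: sections_def)
    obtain e b where e: "e \<in> U" "b \<in> N" "d * b = e"
      using N.locally_invertible [OF U d(1)] T(2) d(2) [OF U] by auto
    have "det (fibre V T) \<noteq> 0" if V: "N.ultrafilter V" "e \<in> V" for V
    proof -
      have "N.eval_at V d * N.eval_at V b = N.eval_at V e"
        using N.eval_at_times [OF V(1) d(1) e(2)] e(3) by simp
      also have "\<dots> = 1"
        using V by (intro N.eval_at_eqI N.near_member)
      finally show ?thesis
        using d(2) [OF V(1)] by auto
    qed
    then show "\<exists>e\<in>U. Q e"
      using e(1) T(1) unfolding Q_def by blast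
  qed
  then obtain T where "T \<in> intertwining A B" "\<And>U. N.ultrafilter U \<Longrightarrow> 1 \<in> U \<Longrightarrow> det (fibre U T) \<noteq> 0"
    unfolding Q_def by blast
  then show thesis
    using N.ultrafilterD(3) that by blast
qed

lemma local_invertible_intertwiner:
  assumes U: "N.ultrafilter U"
    and X: "X11 \<in> intertwining A B" "X12 \<in> intertwining A B" "X21 \<in> intertwining A B" "X22 \<in> intertwining A B"
    and Y: "Y11 \<in> intertwining B A" "Y12 \<in> intertwining B A" "Y21 \<in> intertwining B A" "Y22 \<in> intertwining B A"
    and XY: "X11 * Y11 + X12 * Y21 = 1" "X11 * Y12 + X12 * Y22 = 0" "X21 * Y11 + X22 * Y21 = 0" "X21 * Y12 + X22 * Y22 = 1"
    and YX: "Y11 * X11 + Y12 * X21 = 1" "Y11 * X12 + Y12 * X22 = 0" "Y21 * X11 + Y22 * X21 = 0" "Y21 * X12 + Y22 * X22 = 1"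
  shows "\<exists>T\<in>intertwining A B. det (fibre U T) \<noteq> 0"
proof -
  define act where "act T = (\<lambda>x. fibre U T *v x)" for T
  have M: "T \<in> M" if "T \<in> intertwining A B \<or> T \<in> intertwining B A" for T
    using that by (auto simp: intertwining_def)
  have act_add: "act (S + T) x = act S x + act T x" if "S \<in> M" "T \<in> M" for S T x
    using that by (simp add: act_def fibre_add [OF U] matrix_vector_mult_add_rdistrib)
  have act_times: "act (S * T) x = act S (act T x)" if "S \<in> M" "T \<in> M" for S T x
    using that by (simp add: act_def fibre_times [OF U] matrix_vector_mul_assoc)
  have act_scale: "act (c *\<^sub>C T) x = c *s act T x" if "T \<in> M" for c T x
  proof -
    have "Finite_Cartesian_Product.mat c *v y = c *s y" for y :: "complex ^ 'n"
      by (simp add: vec_eq_iff matrix_vector_mult_def Finite_Cartesian_Product.mat_def if_distrib [of "\<lambda>x. x * _"] cong: if_cong)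
    then show ?thesis
      using that by (simp add: act_def fibre_scaleC [OF U] flip: matrix_vector_mul_assoc)
  qed
  have lin: "clinear (act T)" for T
    unfolding act_def by (rule matrix_vector_mul_linear_gen)
  have act_one: "act 1 x = x" for x
    by (simp add: act_def fibre_one [OF U])
  have act_zero: "act 0 x = 0" for x
    using act_add [of 0 0 x] by simp
  have dist: "act P (act Q1 u + act Q2 v) + act R (act S1 u + act S2 v)
      = act (P * Q1 + R * S1) u + act (P * Q2 + R * S2) v"
    if "P \<in> M" "Q1 \<in> M" "Q2 \<in> M" "R \<in> M" "S1 \<in> M" "S2 \<in> M" for P Q1 Q2 R S1 S2 u v
    using that by (simp add: act_add act_times M.times_mem clinear_simps(1) [OF lin])
  interpret intertwiners "act ` intertwining A B" "act ` intertwining B A"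
  proof (rule intertwiners.intro)
    show "\<exists>x11\<in>act ` intertwining A B. \<exists>x12\<in>act ` intertwining A B. \<exists>x21\<in>act ` intertwining A B. \<exists>x22\<in>act ` intertwining A B.
      \<exists>y11\<in>act ` intertwining B A. \<exists>y12\<in>act ` intertwining B A. \<exists>y21\<in>act ` intertwining B A. \<exists>y22\<in>act ` intertwining B A. \<forall>u v.
      y11 (x11 u + x12 v) + y12 (x21 u + x22 v) = u \<and> y21 (x11 u + x12 v) + y22 (x21 u + x22 v) = v \<and>
      x11 (y11 u + y12 v) + x12 (y21 u + y22 v) = u \<and> x21 (y11 u + y12 v) + x22 (y21 u + y22 v) = v"
      apply (rule bexI [OF _ imageI [OF X(1)]], rule bexI [OF _ imageI [OF X(2)]],
          rule bexI [OF _ imageI [OF X(3)]], rule bexI [OF _ imageI [OF X(4)]],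
          rule bexI [OF _ imageI [OF Y(1)]], rule bexI [OF _ imageI [OF Y(2)]],
          rule bexI [OF _ imageI [OF Y(3)]], rule bexI [OF _ imageI [OF Y(4)]])
      using X Y by (simp add: dist M XY YX act_one act_zero)
    show "(\<lambda>x. e x + e' x) \<in> act ` intertwining A B" if "e \<in> act ` intertwining A B" "e' \<in> act ` intertwining A B" for e e'
    proof -
      obtain S T where "S \<in> intertwining A B" "T \<in> intertwining A B" "e = act S" "e' = act T"
        using \<open>e \<in> _\<close> \<open>e' \<in> _\<close> by blast
      then show ?thesis
        using M by (intro image_eqI [of _ _ "S + T"] intertwining_add) (simp_all add: fun_eq_iff act_add)
    qed
    show "(\<lambda>x. e x + e' x) \<in> act ` intertwining B A" if "e \<in> act ` intertwining B A" "e' \<in> act ` intertwining B A" for e e'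
    proof -
      obtain S T where "S \<in> intertwining B A" "T \<in> intertwining B A" "e = act S" "e' = act T"
        using \<open>e \<in> _\<close> \<open>e' \<in> _\<close> by blast
      then show ?thesis
        using M by (intro image_eqI [of _ _ "S + T"] intertwining_add) (simp_all add: fun_eq_iff act_add)
    qed
    show "(\<lambda>x. c *s e x) \<in> act ` intertwining A B" if "e \<in> act ` intertwining A B" for c e
      using that M by (auto intro!: image_eqI [of _ _ "c *\<^sub>C T" for T] intertwining_scaleC simp: fun_eq_iff act_scale)
    show "(\<lambda>x. c *s e x) \<in> act ` intertwining B A" if "e \<in> act ` intertwining B A" for c e
      using that M by (auto intro!: image_eqI [of _ _ "c *\<^sub>C T" for T] intertwining_scaleC simp: fun_eq_iff act_scale)
    show "(\<lambda>x. e (f (e' x))) \<in> act ` intertwining A B"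
      if efe: "e \<in> act ` intertwining A B" "f \<in> act ` intertwining B A" "e' \<in> act ` intertwining A B" for e f e'
    proof -
      obtain R S T where "R \<in> intertwining A B" "S \<in> intertwining B A" "T \<in> intertwining A B"
        "e = act R" "f = act S" "e' = act T"
        using efe by blast
      then show ?thesis
        using M by (intro image_eqI [of _ _ "R * (S * T)"])
          (auto simp: fun_eq_iff act_times M.times_mem intro: intertwining_times)
    qed
    show "(\<lambda>x. e (f (e' x))) \<in> act ` intertwining B A"
      if efe: "e \<in> act ` intertwining B A" "f \<in> act ` intertwining A B" "e' \<in> act ` intertwining B A" for e f e'
    proof -
      obtain R S T where "R \<in> intertwining B A" "S \<in> intertwining A B" "T \<in> intertwining B A"
        "e = act R" "f = act S" "e' = act T"
        using efe by blast
      then show ?thesis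
        using M by (intro image_eqI [of _ _ "R * (S * T)"])
          (auto simp: fun_eq_iff act_times M.times_mem intro: intertwining_times)
    qed
  qed (use lin in blast)+
  obtain T where T: "T \<in> intertwining A B" "inj (act T)"
    using E_contains_injective by blast
  then have "det (fibre U T) \<noteq> 0"
    unfolding act_def by (metis invertible_det_nz invertible_left_inverse matrix_left_invertible_injective)
  with T(1) show ?thesis
    by blast
qed

end

text \<open>The equations \<open>X (A \<oplus> A) = (B \<oplus> B) X\<close> and \<open>Y (B \<oplus> B) = (A \<oplus> A) Y\<close> for \<open>Y = X\<^sup>-\<^sup>1\<close> say that the
  entries of \<open>X\<close> and \<open>Y\<close> are intertwiners between \<open>A\<close> and \<open>B\<close>, in the two directions.\<close>

lemma similar_if_diag_similar:
  fixes M :: "'h::complex_hilbert_space bop set"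
  assumes M: "type_I_von_neumann_algebra TYPE('k::complex_hilbert_space) CARD('n::finite) M"
    and AB: "A \<in> M" "B \<in> M"
    and sim: "similar_in (matrix_algebra 2 M) (1\<^sub>m 2) (diag2 A A) (diag2 B B)"
  shows "similar_in M 1 A B"
proof -
  obtain N :: "'k bop set" and \<phi> where N: "abelian_von_neumann_algebra N"
    and iso: "star_isomorphism_mat CARD('n) M N \<phi>" and vnM: "von_neumann_algebra M"
    using M by (auto simp: type_I_von_neumann_algebra_def)
  obtain \<sigma> :: "'n \<Rightarrow> nat" where "bij_betw \<sigma> UNIV {..<CARD('n)}"
    using ex_bij_betw_finite_nat [of "UNIV :: 'n set"] by (auto simp: lessThan_atLeast0)
  then interpret fibred_algebra N M \<phi> "CARD('n)" \<sigma>
    using N vnM iso by unfold_locales (auto simp: abelian_von_neumann_algebra_def)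
  obtain X Y where X: "X \<in> matrix_algebra 2 M" and Y: "Y \<in> matrix_algebra 2 M"
    and XY: "X * Y = 1\<^sub>m 2" and YX: "Y * X = 1\<^sub>m 2" and XAY: "X * diag2 A A * Y = diag2 B B"
    using sim unfolding similar_in_def by blast
  have carr: "X \<in> carrier_mat 2 2" "Y \<in> carrier_mat 2 2"
    using X Y by (auto simp: matrix_algebra_def)
  have D: "diag2 C C \<in> carrier_mat 2 2" "\<And>i j. i < 2 \<Longrightarrow> j < 2 \<Longrightarrow> diag2 C C $$ (i, j) = (if i = j then C else 0)"
    for C :: "'h bop"
    by (auto simp: diag2_def mat_of_rows_list_def less_2_cases_iff)
  have idx: "(P * Q) $$ (i, j) = P $$ (i, 0) * Q $$ (0, j) + P $$ (i, 1) * Q $$ (1, j)"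
    if "P \<in> carrier_mat 2 2" "Q \<in> carrier_mat 2 2" "i < 2" "j < 2" for P Q :: "'h bop mat" and i j
    using mat_times_index [OF that] by (simp add: numeral_2_eq_2)
  have one: "P * 1\<^sub>m 2 = P" "1\<^sub>m 2 * P = P" if "P \<in> carrier_mat 2 2" for P :: "'h bop mat"
    using that by (auto intro!: eq_matI simp: idx less_2_cases_iff simp del: index_mult_mat(1))
  have "X * diag2 A A = X * diag2 A A * (Y * X)"
    using one carr D by (simp add: YX)
  also have "\<dots> = X * diag2 A A * Y * X"
    using carr D(1) by (intro assoc_mult_mat [symmetric] mult_carrier_mat) auto
  finally have XA: "X * diag2 A A = diag2 B B * X"
    by (simp add: XAY)
  have "Y * diag2 B B = Y * (X * (diag2 A A * Y))"
    using assoc_mult_mat [OF carr(1) D(1) carr(2)] by (simp only: XAY [symmetric])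
  also have "\<dots> = Y * X * (diag2 A A * Y)"
    using carr D(1) by (intro assoc_mult_mat [symmetric] mult_carrier_mat) auto
  finally have YB: "Y * diag2 B B = diag2 A A * Y"
    using one(2) [OF mult_carrier_mat [OF D(1) carr(2)]] by (simp add: YX)
  have Xij: "X $$ (i, j) \<in> intertwining A B" if "i < 2" "j < 2" for i j
  proof -
    have "(X * diag2 A A) $$ (i, j) = (diag2 B B * X) $$ (i, j)"
      by (simp add: XA)
    then have "X $$ (i, j) * A = B * X $$ (i, j)"
      using that carr D by (auto simp: idx less_2_cases_iff)
    then show ?thesis
      using X that by (auto simp: intertwining_def matrix_algebra_def)
  qed
  have Yij: "Y $$ (i, j) \<in> intertwining B A" if "i < 2" "j < 2" for i j
  proof -
    have "(Y * diag2 B B) $$ (i, j) = (diag2 A A * Y) $$ (i, j)"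
      by (simp add: YB)
    then have "Y $$ (i, j) * B = A * Y $$ (i, j)"
      using that carr D by (auto simp: idx less_2_cases_iff)
    then show ?thesis
      using Y that by (auto simp: intertwining_def matrix_algebra_def)
  qed
  have XYij: "X $$ (i, 0) * Y $$ (0, j) + X $$ (i, 1) * Y $$ (1, j) = (if i = j then 1 else 0)"
    and YXij: "Y $$ (i, 0) * X $$ (0, j) + Y $$ (i, 1) * X $$ (1, j) = (if i = j then 1 else 0)"
    if "i < 2" "j < 2" for i j
    using idx [OF carr that] idx [OF carr(2,1) that] that by (simp_all add: XY YX)
  have "\<exists>T\<in>intertwining A B. det (fibre U T) \<noteq> 0" if "N.ultrafilter U" for U
    by (rule local_invertible_intertwiner [OF that Xij [of 0 0] Xij [of 0 1] Xij [of 1 0] Xij [of 1 1]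
        Yij [of 0 0] Yij [of 0 1] Yij [of 1 0] Yij [of 1 1]]) (simp_all add: XYij YXij del: One_nat_def)
  then obtain T where T: "T \<in> intertwining A B" "\<And>U. N.ultrafilter U \<Longrightarrow> det (fibre U T) \<noteq> 0"
    using intertwiner_patching AB by metis
  then have TM: "T \<in> M" "T * A = B * T"
    by (auto simp: intertwining_def)
  obtain S where S: "S \<in> M" "T * S = 1" "S * T = 1"
    using invertible_if_fibres_invertible [OF TM(1) T(2)] by blast
  have "T * A * S = B"
    using TM(2) S(2) by (simp add: mult.assoc)
  then show ?thesis
    using TM(1) S unfolding similar_in_def by blast
qed

text \<open>The size of the matrices is the cardinality of an index type; the numeral types supply the sizes.\<close>

theorem proposition4p7:
  fixes n :: nat
    and M :: "'h::complex_hilbert_space bop set"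
    and A B :: "'h bop"
  assumes "1 \<le> n" and "n \<le> 3"
    and "type_I_von_neumann_algebra TYPE('k::complex_hilbert_space) n M"
    and "A \<in> M" and "B \<in> M"
    and "similar_in (matrix_algebra 2 M) (1\<^sub>m 2) (diag2 A A) (diag2 B B)"
  shows "similar_in M 1 A B"
proof -
  consider "n = CARD(1)" | "n = CARD(2)" | "n = CARD(3)"
    using assms(1,2) by force
  then show ?thesis
    by cases (use assms(3-6) similar_if_diag_similar in blast)+
qed

end
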